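(* Let $n\ge 2$, let $0<r_1<\ldots<r_n$ and $\rho:=\{r_1,\ldots,r_n\}$. Let $k\neq 0$ be an integer, let $\nu_1,\ldots,\nu_n$ be arbitrary real values, and let $\sigma\in\mathcal{S}_k(\rho)$ be the unique Beppo Levi $L_k$-spline on $\rho$ such that $\sigma(r_j)=\nu_j$ for $j\in\{1,\ldots,n\}$. Then $\|\sigma\|_k<\|g\|_k$ for every function $g$ on $(0,\infty)$ such that $g(r_j)=\nu_j$ for all $j\in\{1,\ldots,n\}$ and $g\neq\sigma$ on $(0,\infty)$ (i.e. $g$ and $\sigma$ are not identical there), where $g\in\Lambda_1$ if $|k|=1$, while $g\in\Lambda_2$ if $|k|\ge 2$.
   Context: For an integer $k\neq 0$ define the ordinary differential operators on $(0,\infty)$ $$L_k:=r\frac{d^4}{dr^4}+2\frac{d^3}{dr^3}-\frac{2k^2+1}{r}\frac{d^2}{dr^2}+\frac{2k^2+1}{r^2}\frac{d}{dr}+\frac{k^4-4k^2}{r^3}=r\left(\frac{d^2}{dr^2}+\frac1r\frac{d}{dr}-\frac{k^2}{r^2}\right)^2,$$ $$G_k:=\frac1r\left[\frac{d^2}{dr^2}-\frac{2|k|+1}{r}\frac{d}{dr}+\frac{|k|(|k|+2)}{r^2}\right],\qquad R_k:=\frac1r\left[\frac{d^2}{dr^2}+\frac{2|k|-1}{r}\frac{d}{dr}+\frac{|k|(|k|-2)}{r^2}\right].$$ Let $\rho=\{r_1,\ldots,r_n\}$ with $0<r_1<\ldots<r_n$. A function $\eta:[0,\infty)\to\mathbb{C}$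 is called a Beppo Levi $L_k$-spline on $\rho$ if: (i) $L_k\eta(r)=0$ for all $r\in(r_j,r_{j+1})$ and all $j\in\{1,\ldots,n-1\}$; (ii) $G_k\eta(r)=0$ for all $r\in(0,r_1)$ and $R_k\eta(r)=0$ for all $r>r_n$; (iii) $\eta$ is $C^2$-continuous at each knot $r_1,\ldots,r_n$. The value at $0$ is understood by continuity, i.e. $\eta(0)=0$. The space of all Beppo Levi $L_k$-splines on $\rho$ is denoted $\mathcal{S}_k(\rho)$. For $n\ge2$, $k\ne0$ and given real values $\nu_1,\ldots,\nu_n$ there is a unique $\sigma\in\mathcal{S}_k(\rho)$ with $\sigma(r_j)=\nu_j$ for all $j$. $AC_{\mathrm{loc}}(0,\infty)$ is the vector space of functions $\psi:(0,\infty)\to\mathbb{C}$ that are absolutely continuous on every interval $[a,b]$, $0<a<b<\infty$. $\Lambda_1$ is the vector space of functions $\psi\in C^1(0,\infty)$ with $\psi'\in AC_{\mathrm{loc}}(0,\infty)$ such that $r^{1/2}\psi''$ and $r^{-1/2}\psi'-r^{-3/2}\psi$ belong to $L^2(0,\infty)$. $\Lambda_2$ is the vector space of functions $\psi\in C^1(0,\infty)$ with $\psi'\in AC_{\mathrm{loc}}(0,\infty)$ such that $r^{1/2}\psi''$, $r^{-1/2}\psi'$ and $r^{-3/2}\psi$ all belong to $L^2(0,\infty)$. Restricted to $(0,\infty)$, $\mathcal{S}_k(\rho)$ is a subspace of $\Lambda_1$ if $|k|=1$ and of $\Lambda_2$ if $|k|\ge2$. For such functions, $$\|\psi\|_k^2:=\int_0^\infty\left\{\left|\frac{d^2\psi}{dr^2}\right|^2+2k^2\left|\frac{\psi}{r^2}-\frac1r\frac{d\psi}{dr}\right|^2+\left|k^2\frac{\psi}{r^2}-\frac1r\frac{d\psi}{dr}\right|^2\right\}r\,dr.$$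 *)

theory Defs
  imports "HOL-Analysis.Analysis"
begin

text \<open>
  Functions on \<open>(0,\<infinity>)\<close> or \<open>[0,\<infinity>)\<close> are represented by total functions of type
  \<open>real \<Rightarrow> complex\<close>; only their values on the half-line in question are ever used
  (all derivatives are taken at interior points).
\<close>

definition nderiv :: "nat \<Rightarrow> (real \<Rightarrow> complex) \<Rightarrow> real \<Rightarrow> complex" where
  "nderiv m f = ((\<lambda>g x. vector_derivative g (at x)) ^^ m) f"

text \<open>
  \<^const>\<open>vector_derivative\<close> returns an unspecified value where the function is not
  differentiable, so existence of the derivatives is always required separately.
\<close>

definition times_differentiable_on :: "nat \<Rightarrow> (real \<Rightarrow> complex) \<Rightarrow> real set \<Rightarrow> bool" where
  "times_differentiable_on m f S \<longleftrightarrow> (\<forall>i<m. \<forall>x\<in>S. nderiv i f differentiable (at x))"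

text \<open>The class \<open>C\<^sup>m(S)\<close>, for open \<open>S\<close>.\<close>

definition C_on :: "nat \<Rightarrow> (real \<Rightarrow> complex) \<Rightarrow> real set \<Rightarrow> bool" where
  "C_on m f S \<longleftrightarrow> times_differentiable_on m f S \<and> continuous_on S (nderiv m f)"

definition C_at :: "nat \<Rightarrow> (real \<Rightarrow> complex) \<Rightarrow> real \<Rightarrow> bool" where
  "C_at m f x \<longleftrightarrow> (\<exists>U. open U \<and> x \<in> U \<and> C_on m f U)"

definition L_op :: "int \<Rightarrow> (real \<Rightarrow> complex) \<Rightarrow> real \<Rightarrow> complex" where
  "L_op k f r =
     r *\<^sub>R nderiv 4 f r + 2 *\<^sub>R nderiv 3 f r
     - ((2 * (of_int k)\<^sup>2 + 1) / r) *\<^sub>R nderiv 2 f r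
     + ((2 * (of_int k)\<^sup>2 + 1) / r\<^sup>2) *\<^sub>R nderiv 1 f r
     + (((of_int k)^4 - 4 * (of_int k)\<^sup>2) / r^3) *\<^sub>R f r"

definition G_op :: "int \<Rightarrow> (real \<Rightarrow> complex) \<Rightarrow> real \<Rightarrow> complex" where
  "G_op k f r =
     (1 / r) *\<^sub>R (nderiv 2 f r
       - ((2 * \<bar>of_int k\<bar> + 1) / r) *\<^sub>R nderiv 1 f r
       + (\<bar>of_int k\<bar> * (\<bar>of_int k\<bar> + 2) / r\<^sup>2) *\<^sub>R f r)"

definition R_op :: "int \<Rightarrow> (real \<Rightarrow> complex) \<Rightarrow> real \<Rightarrow> complex" where
  "R_op k f r =
     (1 / r) *\<^sub>R (nderiv 2 f r
       + ((2 * \<bar>of_int k\<bar> - 1) / r) *\<^sub>R nderiv 1 f r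
       + (\<bar>of_int k\<bar> * (\<bar>of_int k\<bar> - 2) / r\<^sup>2) *\<^sub>R f r)"

text \<open>
  The space \<open>S\<^sub>k(\<rho>)\<close> of Beppo Levi \<open>L\<^sub>k\<close>-splines on the knot set
  \<open>\<rho> = {\<rho> 1 < \<dots> < \<rho> n}\<close>, the knots being given as an increasing sequence.
  That an equation of order \<open>m\<close> holds on an interval includes that the function is
  \<open>m\<close> times differentiable there.  By the condition on \<open>(0, \<rho> 1)\<close> the spline tends
  to \<open>0\<close> at \<open>0\<close>, so \<open>\<eta> 0 = 0\<close> is the value by continuity.
\<close>

definition BL_splines :: "int \<Rightarrow> nat \<Rightarrow> (nat \<Rightarrow> real) \<Rightarrow> (real \<Rightarrow> complex) set" where
  "BL_splines k n \<rho> = {\<eta>.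
     (\<forall>j\<in>{1..<n}. times_differentiable_on 4 \<eta> {\<rho> j<..<\<rho> (Suc j)} \<and>
        (\<forall>r\<in>{\<rho> j<..<\<rho> (Suc j)}. L_op k \<eta> r = 0)) \<and>
     times_differentiable_on 2 \<eta> {0<..<\<rho> 1} \<and> (\<forall>r\<in>{0<..<\<rho> 1}. G_op k \<eta> r = 0) \<and>
     times_differentiable_on 2 \<eta> {\<rho> n<..} \<and> (\<forall>r\<in>{\<rho> n<..}. R_op k \<eta> r = 0) \<and>
     (\<forall>j\<in>{1..n}. C_at 2 \<eta> (\<rho> j)) \<and>
     \<eta> 0 = 0}"

text \<open>
  Absolute continuity in the \<open>\<epsilon>\<close>-\<open>\<delta>\<close> sense: \<^term>\<open>d division_of T\<close> says that \<open>d\<close> is a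
  finite family of nonempty, non-overlapping compact intervals with union \<open>T\<close>, and
  \<open>Inf i\<close>, \<open>Sup i\<close> are the endpoints of the interval \<open>i\<close>.
\<close>

definition abs_continuous_on :: "real set \<Rightarrow> (real \<Rightarrow> complex) \<Rightarrow> bool" where
  "abs_continuous_on S f \<longleftrightarrow>
     (\<forall>\<epsilon>>0. \<exists>\<delta>>0. \<forall>d T. d division_of T \<and> T \<subseteq> S \<and> (\<Sum>i\<in>d. Sup i - Inf i) < \<delta> \<longrightarrow>
        (\<Sum>i\<in>d. cmod (f (Sup i) - f (Inf i))) < \<epsilon>)"

definition AC_loc :: "(real \<Rightarrow> complex) set" where
  "AC_loc = {\<psi>. \<forall>a b. 0 < a \<and> a < b \<longrightarrow> abs_continuous_on {a..b} \<psi>}"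

definition L2_on :: "real set \<Rightarrow> (real \<Rightarrow> complex) \<Rightarrow> bool" where
  "L2_on S f \<longleftrightarrow> set_borel_measurable lebesgue S f \<and>
     set_integrable lebesgue S (\<lambda>r. (cmod (f r))\<^sup>2)"

text \<open>
  For \<open>\<psi>'\<close> locally absolutely continuous, \<open>\<psi>''\<close> exists almost everywhere; its value on
  the remaining null set is irrelevant below.
\<close>

definition Lambda1 :: "(real \<Rightarrow> complex) set" where
  "Lambda1 = {\<psi>. C_on 1 \<psi> {0<..} \<and> nderiv 1 \<psi> \<in> AC_loc \<and>
     L2_on {0<..} (\<lambda>r. (r powr (1/2)) *\<^sub>R nderiv 2 \<psi> r) \<and>
     L2_on {0<..} (\<lambda>r. (r powr (-1/2)) *\<^sub>R nderiv 1 \<psi> r - (r powr (-3/2)) *\<^sub>R \<psi> r)}"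

definition Lambda2 :: "(real \<Rightarrow> complex) set" where
  "Lambda2 = {\<psi>. C_on 1 \<psi> {0<..} \<and> nderiv 1 \<psi> \<in> AC_loc \<and>
     L2_on {0<..} (\<lambda>r. (r powr (1/2)) *\<^sub>R nderiv 2 \<psi> r) \<and>
     L2_on {0<..} (\<lambda>r. (r powr (-1/2)) *\<^sub>R nderiv 1 \<psi> r) \<and>
     L2_on {0<..} (\<lambda>r. (r powr (-3/2)) *\<^sub>R \<psi> r)}"

definition BL_norm :: "int \<Rightarrow> (real \<Rightarrow> complex) \<Rightarrow> real" where
  "BL_norm k \<psi> = sqrt (LINT r:{0<..}|lebesgue.
     ((cmod (nderiv 2 \<psi> r))\<^sup>2
      + 2 * (of_int k)\<^sup>2 * (cmod (\<psi> r /\<^sub>R r\<^sup>2 - nderiv 1 \<psi> r /\<^sub>R r))\<^sup>2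
      + (cmod ((of_int k)\<^sup>2 *\<^sub>R (\<psi> r /\<^sub>R r\<^sup>2) - nderiv 1 \<psi> r /\<^sub>R r))\<^sup>2) * r)"

end

theory Submission
  imports Defs
begin

text \<open>
  Put \<open>h = g - \<sigma>\<close>. Expanding the quadratic form gives
  \<open>\<parallel>g\<parallel>\<^sup>2 = \<parallel>\<sigma>\<parallel>\<^sup>2 + \<parallel>h\<parallel>\<^sup>2 + 2 \<langle>\<sigma>, h\<rangle>\<close>, and the point is that the polarised form
  \<open>\<langle>\<sigma>, h\<rangle>\<close> vanishes. Since \<open>L\<^sub>k \<sigma> = 0\<close> between the knots, its integrand is the derivative of
  \<open>P = r \<sigma>'' \<bullet> h' + W \<bullet> h\<close> with \<open>W\<close> of third order in \<open>\<sigma>\<close>. At the knots \<open>h = 0\<close>, \<open>W\<close> stays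
  bounded and \<open>\<sigma>''\<close> is continuous, so \<open>P\<close> has no jump there. On the end intervals \<open>\<sigma>\<close> is a
  combination of two explicit powers and \<open>\<Lambda>\<^sub>1\<close>, \<open>\<Lambda>\<^sub>2\<close> bound \<open>h\<close> along sequences tending to \<open>0\<close> and
  \<open>\<infinity>\<close>, along which \<open>P\<close> tends to \<open>0\<close>. The inequality is strict because \<open>\<parallel>h\<parallel> = 0\<close> forces
  \<open>h' = h / r\<close>, so \<open>h\<close> is a multiple of \<open>r\<close>, and it vanishes at a knot.

  As \<open>h'\<close> is only absolutely continuous, this uses that such functions are differentiable almost
  everywhere (by Vitali's covering theorem) and satisfy the fundamental theorem of calculus (by a gauge argument).
\<close>

section \<open>Vitali coverings and absolute continuity\<close>

text \<open>The conditions on \<open>g\<close> are square integrability conditions, so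
  \<open>h\<close> has no pointwise bound near 0 or infinity. All identities are therefore proved on
  compact intervals, and the limit is taken only along endpoints at which \<open>end_size\<close> of
  \<open>g\<close> is at most 1. There the boundary term is at most a decaying size of \<sigma>
  times a bounded size of \<open>h\<close>.

  Strictness has to survive this limit. It comes from a fixed margin: at a point \<open>z\<close>
  where \<open>h'\<close> differs from \<open>h / r\<close> the first-order part of the energy of
  \<open>h\<close> is positive, so it has a positive integral \<delta> over
  \<open>{z..z + 1}\<close>. On every large compact interval the energy of \<sigma> plus \<delta>
  plus boundary terms is at most the energy of \<open>g\<close>; the energies of \<sigma> and
  \<open>h\<close> over the whole half-line do not enter at that stage.

  Third derivatives of \<sigma> are available only between the knots, and on the end intervals just
  two derivatives are given. \<open>W\<close> bridges this: between the knots it is built from the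
  third derivative, on the end intervals from the differential equation of second order.\<close>

lemma division_telescope:
  fixes f :: "real \<Rightarrow> 'a::real_normed_vector"
  assumes "a \<le> b" "q division_of {a..b}"
  shows "(\<Sum>C\<in>q. f (Sup C) - f (Inf C)) = f b - f a"
proof -
  have inf: "Inf C \<in> C" if "C \<in> q" for C
  proof -
    obtain u v where "C = {u..v}"
      using division_ofD(4)[OF assms(2) \<open>C \<in> q\<close>] by auto
    moreover have "C \<noteq> {}"
      using division_ofD(3)[OF assms(2) that] .
    ultimately show ?thesis by auto
  qed
  have inj: "inj_on (\<lambda>C. (Inf C, C)) q"
    by (auto intro: inj_onI)
  \<comment> \<open>The tags are arbitrary; left endpoints turn the division into a tagged one, for
    which sums of increments telescope.\<close>
  have "(\<lambda>C. (Inf C, C)) ` q tagged_division_of {a..b}"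
  proof (rule tagged_division_ofI)
    note d = division_ofD[OF assms(2)]
    show "finite ((\<lambda>C. (Inf C, C)) ` q)" using d(1) by simp
    have "{K. \<exists>x. (x, K) \<in> (\<lambda>C. (Inf C, C)) ` q} = q" by (auto simp: image_iff)
    then show "\<Union> {K. \<exists>x. (x, K) \<in> (\<lambda>C. (Inf C, C)) ` q} = {a..b}" using d(6) by simp
    fix x K assume xK: "(x, K) \<in> (\<lambda>C. (Inf C, C)) ` q"
    then have x: "K \<in> q" "x = Inf K" by auto
    then show "x \<in> K" using inf by auto
    show "K \<subseteq> {a..b}" "\<exists>a b. K = cbox a b" using d(2)[OF x(1)] d(4)[OF x(1)] by auto
    fix x' K' assume "(x', K') \<in> (\<lambda>C. (Inf C, C)) ` q" "(x, K) \<noteq> (x', K')"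
    then show "interior K \<inter> interior K' = {}" using x d(5)[of K K'] by auto
  qed
  then have "(\<Sum>(x,C)\<in>(\<lambda>C. (Inf C, C)) ` q. f (Sup C) - f (Inf C)) = f b - f a"
    by (rule additive_tagged_division_1[OF assms(1)])
  then show ?thesis
    by (simp add: sum.reindex[OF inj])
qed

text \<open>Vitali's theorem yields a countable disjoint family that covers \<open>S\<close> up to a
  null set; by continuity of the measure from below, a finite part of it already covers all but a
  set of measure less than \<open>\<epsilon>\<close>. The remainder is enclosed in a measurable
  \<open>Z\<close>, so that \<open>S\<close> itself may be non-measurable.\<close>

lemma vitali_finite_subfamily:
  fixes S :: "real set"
  assumes "open U" "bounded U" "S \<subseteq> U"
    and K: "\<And>C. C \<in> K \<Longrightarrow> \<exists>c d. c < d \<and> C = {c..d}"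
    and cov: "\<And>x e. x \<in> S \<Longrightarrow> 0 < e \<Longrightarrow> \<exists>C\<in>K. x \<in> C \<and> Sup C - Inf C < e"
    and "0 < \<epsilon>"
  obtains D Z where "finite D" "D \<subseteq> K" "\<And>C. C \<in> D \<Longrightarrow> C \<subseteq> U" "pairwise disjnt D"
    "Z \<in> lmeasurable" "measure lebesgue Z < \<epsilon>" "S \<subseteq> \<Union>D \<union> Z"
proof -
  \<comment> \<open>Discarding the members that leave \<open>U\<close> keeps the covering fine,
    since \<open>U\<close> is open and contains \<open>S\<close>.\<close>
  define K' where "K' = {C\<in>K. C \<subseteq> U}"
  define cen rad where "cen C = (Inf C + Sup C) / 2" and "rad C = (Sup C - Inf C) / 2" for C :: "real set"
  have ball: "cball (cen C) (rad C) = C" "0 < rad C" if "C \<in> K" for C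
  proof -
    obtain c d where "c < d" "C = {c..d}" using K[OF \<open>C \<in> K\<close>] by auto
    then show "cball (cen C) (rad C) = C" "0 < rad C"
      unfolding cen_def rad_def by (auto simp: cball_eq_atLeastAtMost field_simps)
  qed
  have "\<exists>i. i \<in> K' \<and> x \<in> cball (cen i) (rad i) \<and> rad i < e" if x: "x \<in> S" "0 < e" for x e
  proof -
    obtain r where r: "0 < r" "ball x r \<subseteq> U"
      using \<open>open U\<close> \<open>S \<subseteq> U\<close> x by (meson openE subsetD)
    obtain C where C: "C \<in> K" "x \<in> C" "Sup C - Inf C < min e r"
      using cov[OF x(1), of "min e r"] x(2) r by auto
    obtain c d where cd: "c < d" "C = {c..d}" using K[OF C(1)] by auto
    have "C \<subseteq> ball x r"
      using C cd by (auto simp: dist_real_def)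
    moreover have "rad C < e" using C(3) cd unfolding rad_def by auto
    moreover have "C \<subseteq> U" using calculation r by blast
    moreover have "x \<in> cball (cen C) (rad C)" using ball(1)[OF C(1)] C(2) by simp
    ultimately show ?thesis using C(1) unfolding K'_def by blast
  qed
  then obtain \<C> where \<C>: "countable \<C>" "\<C> \<subseteq> K'"
    "pairwise (\<lambda>i j. disjnt (cball (cen i) (rad i)) (cball (cen j) (rad j))) \<C>"
    and neg: "negligible (S - (\<Union>i\<in>\<C>. cball (cen i) (rad i)))"
    using Vitali_covering_theorem_cballs[of K' rad S cen] ball unfolding K'_def by (smt (verit) mem_Collect_eq)
  have eq: "cball (cen i) (rad i) = i" if "i \<in> \<C>" for i
    using that \<C>(2) ball unfolding K'_def by auto
  have disj: "pairwise disjnt \<C>"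
    using \<C>(3) eq by (smt (verit) pairwise_def)
  have neg': "negligible (S - \<Union>\<C>)"
    using neg eq by (simp cong: SUP_cong)
  show ?thesis
  proof (cases "\<C> = {}")
    case True
    have "S \<in> lmeasurable" "measure lebesgue S = 0"
      using neg' True by (auto simp: negligible_iff_measure)
    then show ?thesis
      using that[of "{}" S] \<open>0 < \<epsilon>\<close> by auto
  next
    case False
    \<comment> \<open>The enumeration may repeat members; as \<open>D n\<close> is a set of
      intervals, it is still pairwise disjoint and increases with \<open>n\<close>.\<close>
    define D where "D n = from_nat_into \<C> ` {..n::nat}" for n
    define A where "A n = \<Union>(D n)" for n
    have Dsub: "D n \<subseteq> \<C>" for n
      unfolding D_def using from_nat_into[OF False] by auto
    have meas: "C \<in> sets lebesgue" if "C \<in> \<C>" for C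
    proof -
      have "C \<in> K" using that \<C>(2) unfolding K'_def by auto
      then show ?thesis using K[of C] by auto
    qed
    have Am: "A n \<in> sets lebesgue" for n
      unfolding A_def using Dsub meas by (intro sets.finite_Union) (auto simp: D_def from_nat_into[OF False])
    have UA: "(\<Union>n. A n) = \<Union>\<C>"
    proof
      show "\<Union>\<C> \<subseteq> (\<Union>n. A n)"
      proof
        fix x assume "x \<in> \<Union>\<C>"
        then obtain C where C: "C \<in> \<C>" "x \<in> C" by auto
        then obtain n where "from_nat_into \<C> n = C"
          using from_nat_into_surj[OF \<C>(1)] by metis
        then have "x \<in> A n" using C unfolding A_def D_def by auto
        then show "x \<in> (\<Union>n. A n)" by auto
      qed
    qed (use Dsub in \<open>auto simp: A_def\<close>)
    have UU: "\<Union>\<C> \<subseteq> U" using \<C>(2) unfolding K'_def by auto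
    have CL: "\<Union>\<C> \<in> lmeasurable"
      using UU \<open>bounded U\<close> meas \<C>(1)
      by (intro bounded_set_imp_lmeasurable bounded_subset[OF \<open>bounded U\<close>] sets.countable_Union) auto
    have lim: "(\<lambda>n. measure lebesgue (A n)) \<longlonglongrightarrow> measure lebesgue (\<Union>\<C>)"
      unfolding UA[symmetric]
    proof (rule Lim_measure_incseq)
      show "incseq A" unfolding A_def D_def incseq_def by (meson Union_mono atMost_subset_iff image_mono)
      show "emeasure lebesgue (\<Union>n. A n) \<noteq> \<infinity>" using CL unfolding UA by (auto simp: fmeasurable_def)
    qed (use Am in auto)
    have "\<forall>\<^sub>F n in sequentially. measure lebesgue (\<Union>\<C>) - \<epsilon> < measure lebesgue (A n)"
      using \<open>0 < \<epsilon>\<close> by (intro order_tendstoD(1)[OF lim]) simp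
    from eventually_happens'[OF sequentially_bot this]
    obtain n where n: "measure lebesgue (\<Union>\<C>) - measure lebesgue (A n) < \<epsilon>"
      by (auto simp: algebra_simps)
    have sub: "A n \<subseteq> \<Union>\<C>" using UA by auto
    have AL: "A n \<in> lmeasurable"
      using fmeasurableI2[OF CL sub Am] .
    define Z where "Z = (\<Union>\<C> - A n) \<union> (S - \<Union>\<C>)"
    have Z0: "\<Union>\<C> - A n \<in> lmeasurable" "S - \<Union>\<C> \<in> lmeasurable" "measure lebesgue (S - \<Union>\<C>) = 0"
      using CL AL neg' by (auto simp: negligible_iff_measure fmeasurable.Diff)
    have "measure lebesgue Z \<le> measure lebesgue (\<Union>\<C> - A n) + measure lebesgue (S - \<Union>\<C>)"
      unfolding Z_def using Z0 by (intro measure_Un_le) auto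
    also have "\<dots> < \<epsilon>"
      using n Z0 measurable_measure_Diff[OF CL _ sub] AL by auto
    finally have "measure lebesgue Z < \<epsilon>" .
    moreover have "Z \<in> lmeasurable" unfolding Z_def using Z0 by auto
    moreover have "S \<subseteq> \<Union>(D n) \<union> Z" unfolding Z_def A_def by auto
    moreover have "pairwise disjnt (D n)" using disj Dsub pairwise_subset by blast
    moreover have "D n \<subseteq> K" "\<And>C. C \<in> D n \<Longrightarrow> C \<subseteq> U" using Dsub \<C>(2) unfolding K'_def by auto
    moreover have "finite (D n)" unfolding D_def by auto
    ultimately show ?thesis using that by blast
  qed
qed

text \<open>\<open>abs_continuous_on\<close> with values in any normed space: below it is applied
  also to real and imaginary parts and to the real-valued boundary term.\<close>

definition ac_on :: "real set \<Rightarrow> (real \<Rightarrow> 'a::real_normed_vector) \<Rightarrow> bool" where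
  "ac_on S f \<longleftrightarrow>
     (\<forall>\<epsilon>>0. \<exists>\<delta>>0. \<forall>d T. d division_of T \<and> T \<subseteq> S \<and> (\<Sum>i\<in>d. Sup i - Inf i) < \<delta> \<longrightarrow>
        (\<Sum>i\<in>d. norm (f (Sup i) - f (Inf i))) < \<epsilon>)"

lemma ac_onD:
  assumes "ac_on S f" "0 < \<epsilon>"
  shows "\<exists>\<delta>>0. \<forall>d. d division_of (\<Union>d) \<longrightarrow> \<Union>d \<subseteq> S \<longrightarrow> (\<Sum>i\<in>d. Sup i - Inf i) < \<delta> \<longrightarrow>
        (\<Sum>i\<in>d. norm (f (Sup i) - f (Inf i))) < \<epsilon>"
  using assms unfolding ac_on_def by meson

section \<open>Finite disjoint families of intervals\<close>

lemma disjoint_intervals_division: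
  fixes D :: "real set set"
  assumes "finite D" "\<And>C. C \<in> D \<Longrightarrow> \<exists>c d. c < d \<and> C = {c..d}" "pairwise disjnt D"
  shows "D division_of (\<Union>D)"
proof (rule division_ofI)
  fix k1 k2 assume "k1 \<in> D" "k2 \<in> D" "k1 \<noteq> k2"
  then have "k1 \<inter> k2 = {}" using assms(3) by (auto simp: pairwise_def disjnt_def)
  then show "interior k1 \<inter> interior k2 = {}"
    using interior_subset by blast
next
  fix k assume k: "k \<in> D"
  then obtain c d where "c < d" "k = {c..d}" using assms(2)[of k] by auto
  then show "k \<noteq> {}" "\<exists>a b. k = cbox a b" by auto
  show "k \<subseteq> \<Union>D" using k by auto
qed (use assms(1) in auto)

lemma measure_disjoint_intervals:
  fixes D :: "real set set"
  assumes "finite D" "\<And>C. C \<in> D \<Longrightarrow> \<exists>c d. c < d \<and> C = {c..d}" "pairwise disjnt D"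
  shows "\<Union>D \<in> lmeasurable" "measure lebesgue (\<Union>D) = (\<Sum>C\<in>D. Sup C - Inf C)"
proof -
  have L: "C \<in> lmeasurable" "measure lebesgue C = Sup C - Inf C" if "C \<in> D" for C
    using assms(2)[OF that] by (auto simp: content_real)
  show "\<Union>D \<in> lmeasurable" using L assms(1) by (intro fmeasurable.finite_Union) auto
  have "measure lebesgue (\<Union>D) = sum (measure lebesgue) D"
    using assms L by (intro measure_Union') (auto simp: pairwise_def)
  then show "measure lebesgue (\<Union>D) = (\<Sum>C\<in>D. Sup C - Inf C)" using L by simp
qed


text \<open>
  Cover \<open>S\<close> by finitely many disjoint intervals on which \<open>f\<close> does not increase, and again by
  intervals inside these on which the slope of \<open>f\<close> is at least \<open>c\<close>. Both families nearly exhaust the outer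
  measure \<open>m\<close> of \<open>S\<close>, so what lies between has small length and \<open>f\<close> varies little on it by
  absolute continuity; comparing the total increments gives \<open>c m \<le> 0\<close>.
\<close>

lemma dini_negligible:
  fixes f :: "real \<Rightarrow> real"
  assumes ac: "ac_on {a..b} f" and S: "S \<subseteq> {a<..<b}" and "0 < c"
    and lo: "\<And>x e. x \<in> S \<Longrightarrow> 0 < e \<Longrightarrow> \<exists>u v. u < v \<and> x \<in> {u..v} \<and> v - u < e \<and> f v \<le> f u"
    and hi: "\<And>x e. x \<in> S \<Longrightarrow> 0 < e \<Longrightarrow> \<exists>u v. u < v \<and> x \<in> {u..v} \<and> v - u < e \<and> c * (v - u) \<le> f v - f u"
  shows "negligible S"
proof -
  \<comment> \<open>The set \<open>S\<close> is not known to be measurable, so its outer measure is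
    taken as an infimum over measurable supersets.\<close>
  define M where "M = measure lebesgue ` {T. S \<subseteq> T \<and> T \<in> lmeasurable}"
  define m where "m = Inf M"
  have bdd: "bdd_below M" unfolding M_def by (intro bdd_belowI[of _ 0]) auto
  have "{a<..<b} \<in> lmeasurable" by simp
  then have ne: "M \<noteq> {}" using S unfolding M_def by blast
  have m_le: "m \<le> measure lebesgue T" if "S \<subseteq> T" "T \<in> lmeasurable" for T
    unfolding m_def by (rule cInf_lower[OF _ bdd]) (use that in \<open>auto simp: M_def\<close>)
  have approx: "\<exists>T. S \<subseteq> T \<and> T \<in> lmeasurable \<and> measure lebesgue T < e" if "m < e" for e
    using cInf_lessD[OF ne that[unfolded m_def]] unfolding M_def by auto
  have "m \<le> 0"
  proof (rule ccontr)
    assume "\<not> m \<le> 0"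
    then have "0 < m" by simp
    then have "0 < c * m / 2" using \<open>0 < c\<close> by simp
    from ac_onD[OF ac this] obtain \<delta> where \<delta>: "0 < \<delta>"
      "\<forall>d. d division_of (\<Union>d) \<longrightarrow> \<Union>d \<subseteq> {a..b} \<longrightarrow> (\<Sum>i\<in>d. Sup i - Inf i) < \<delta> \<longrightarrow>
        (\<Sum>i\<in>d. norm (f (Sup i) - f (Inf i))) < c * m / 2" by blast
    \<comment> \<open>The first family will have length below \<open>m + \<epsilon>\<close>, the
      second at least \<open>m - 2 * \<epsilon>\<close>. The gaps are then shorter than
      \<open>3 * \<epsilon> < \<delta>\<close>, while the second family still has length at least
      \<open>m / 2\<close>; its increment is thus at least \<open>c * m / 2\<close>, which the bound
      from absolute continuity contradicts.\<close>
    define \<epsilon> where "\<epsilon> = min (\<delta>/4) (m/4)"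
    have \<epsilon>: "0 < \<epsilon>" "4 * \<epsilon> \<le> \<delta>" "4 * \<epsilon> \<le> m" using \<delta> \<open>0 < m\<close> unfolding \<epsilon>_def by auto
    obtain T0 where T0: "S \<subseteq> T0" "T0 \<in> lmeasurable" "measure lebesgue T0 < m + \<epsilon>/2"
      using approx[of "m + \<epsilon>/2"] \<epsilon> by auto
    obtain T1 where T1: "open T1" "T0 \<subseteq> T1" "(T1 - T0) \<in> lmeasurable" "emeasure lebesgue (T1 - T0) < ennreal (\<epsilon>/2)"
      using sets_lebesgue_outer_open[of T0 "\<epsilon>/2"] T0 \<epsilon> by auto
    define U where "U = T1 \<inter> {a<..<b}"
    have U: "open U" "bounded U" "S \<subseteq> U" "U \<subseteq> {a<..<b}"
      unfolding U_def using T0 T1 S by (auto intro: bounded_subset[of "{a<..<b}"])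
    have U_sub: "U \<subseteq> T0 \<union> (T1 - T0)" unfolding U_def by auto
    have UL: "U \<in> lmeasurable" using U by (simp add: bounded_set_imp_lmeasurable lmeasurable_open)
    have "measure lebesgue (T1 - T0) < \<epsilon>/2"
      using T1(3,4) \<epsilon>(1) by (simp add: emeasure_eq_measure2 ennreal_less_iff)
    moreover have "measure lebesgue U \<le> measure lebesgue (T0 \<union> (T1 - T0))"
      using U_sub UL fmeasurable.Un[OF T0(2) T1(3)] by (intro measure_mono_fmeasurable) auto
    moreover have "measure lebesgue (T0 \<union> (T1 - T0)) \<le> measure lebesgue T0 + measure lebesgue (T1 - T0)"
      using T0 T1 by (intro measure_Un_le) auto
    ultimately have Um: "measure lebesgue U < m + \<epsilon>" using T0 by simp

    define K1 where "K1 = {C. \<exists>u v. u < v \<and> C = {u..v} \<and> f v \<le> f u}"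
    obtain D1 Z1 where D1: "finite D1" "D1 \<subseteq> K1" "\<And>C. C \<in> D1 \<Longrightarrow> C \<subseteq> U" "pairwise disjnt D1"
      and Z1: "Z1 \<in> lmeasurable" "measure lebesgue Z1 < \<epsilon>" "S \<subseteq> \<Union>D1 \<union> Z1"
    proof (rule vitali_finite_subfamily[OF U(1-3), of K1 \<epsilon>])
      show "\<exists>C\<in>K1. x \<in> C \<and> Sup C - Inf C < e" if xe: "x \<in> S" "0 < e" for x e
      proof -
        obtain u v where "u < v \<and> x \<in> {u..v} \<and> v - u < e \<and> f v \<le> f u" using lo[OF xe] by blast
        then show ?thesis unfolding K1_def by (intro bexI[of _ "{u..v}"]) auto
      qed
    qed (use \<epsilon> in \<open>auto simp: K1_def\<close>)
    have I1: "\<exists>c d. c < d \<and> C = {c..d}" if "C \<in> D1" for C using that D1(2) unfolding K1_def by blast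

    define V where "V = (\<Union>C\<in>D1. interior C)"
    have V: "open V" "V \<subseteq> U" "V \<subseteq> \<Union>D1"
      unfolding V_def using D1(3) interior_subset by blast+
    have bV: "bounded V" using V(2) U(2) bounded_subset by blast
    \<comment> \<open>Each interval has to lie in a single member of \<open>D1\<close>, so that the
      second family can be completed to a division of every member.\<close>
    define K2 where "K2 = {C. \<exists>u v. u < v \<and> C = {u..v} \<and> c * (v - u) \<le> f v - f u \<and> (\<exists>I\<in>D1. C \<subseteq> I)}"
    obtain D2 Z2 where D2: "finite D2" "D2 \<subseteq> K2" "\<And>C. C \<in> D2 \<Longrightarrow> C \<subseteq> V" "pairwise disjnt D2"
      and Z2: "Z2 \<in> lmeasurable" "measure lebesgue Z2 < \<epsilon>" "S \<inter> V \<subseteq> \<Union>D2 \<union> Z2"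
    proof (rule vitali_finite_subfamily[OF V(1) bV, of "S \<inter> V" K2 \<epsilon>])
      show "\<exists>C\<in>K2. x \<in> C \<and> Sup C - Inf C < e" if xe: "x \<in> S \<inter> V" "0 < e" for x e
      proof -
        obtain I where I: "I \<in> D1" "x \<in> interior I" using xe unfolding V_def by auto
        then obtain r where r: "0 < r" "ball x r \<subseteq> interior I" by (meson open_interior openE)
        obtain u v where uv: "u < v" "x \<in> {u..v}" "v - u < min e r" "c * (v - u) \<le> f v - f u"
          using hi[of x "min e r"] xe r by auto
        have "{u..v} \<subseteq> ball x r" using uv by (auto simp: dist_real_def)
        then have "{u..v} \<subseteq> I" using r interior_subset by blast
        then show ?thesis using uv I unfolding K2_def by (intro bexI[of _ "{u..v}"]) auto
      qed
    qed (use \<epsilon> in \<open>auto simp: K2_def\<close>)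
    have I2: "\<exists>c d. c < d \<and> C = {c..d}" if "C \<in> D2" for C using that D2(2) unfolding K2_def by blast
    have in1: "\<exists>I\<in>D1. C \<subseteq> I" if "C \<in> D2" for C using that D2(2) unfolding K2_def by blast

    note d1 = disjoint_intervals_division[OF D1(1) I1 D1(4)]
    note d2 = disjoint_intervals_division[OF D2(1) I2 D2(4)]
    note m1 = measure_disjoint_intervals[OF D1(1) I1 D1(4)]
    note m2 = measure_disjoint_intervals[OF D2(1) I2 D2(4)]

    \<comment> \<open>Endpoints of the first family are lost on passing to interiors; they form a
      finite set.\<close>
    define E where "E = (\<Union>C\<in>D1. {Inf C, Sup C})"
    have E: "negligible E" unfolding E_def using D1(1) by (intro negligible_finite) auto
    have "S \<subseteq> \<Union>D2 \<union> (Z1 \<union> (Z2 \<union> E))"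
    proof
      fix x assume "x \<in> S"
      show "x \<in> \<Union>D2 \<union> (Z1 \<union> (Z2 \<union> E))"
      proof (cases "x \<in> V")
        case True then show ?thesis using Z2(3) \<open>x \<in> S\<close> by auto
      next
        case False
        show ?thesis
        proof (cases "x \<in> Z1")
          case False
          then obtain I where I: "I \<in> D1" "x \<in> I" using Z1(3) \<open>x \<in> S\<close> by auto
          then obtain u v where "u < v" "I = {u..v}" using I1 by blast
          moreover have "x \<notin> interior I" using \<open>x \<notin> V\<close> I(1) unfolding V_def by auto
          ultimately have "x = Inf I \<or> x = Sup I" using I(2) by auto
          then show ?thesis using I(1) unfolding E_def by auto
        qed auto
      qed
    qed
    moreover have "Z2 \<union> E \<in> lmeasurable" "Z1 \<union> (Z2 \<union> E) \<in> lmeasurable"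
      using Z1 Z2 E by (auto simp: negligible_iff_measure)
    ultimately have "m \<le> measure lebesgue (\<Union>D2 \<union> (Z1 \<union> (Z2 \<union> E)))"
      using m2 by (intro m_le) auto
    also have "\<dots> \<le> measure lebesgue (\<Union>D2) + (measure lebesgue Z1 + (measure lebesgue Z2 + measure lebesgue E))"
      using m2 Z1 Z2 E by (intro order_trans[OF measure_Un_le] add_left_mono) (auto simp: negligible_iff_measure)
    finally have J_ge: "m - 2 * \<epsilon> \<le> measure lebesgue (\<Union>D2)"
      using Z1 Z2 E by (simp add: negligible_iff_measure)
    have "measure lebesgue (\<Union>D1) \<le> measure lebesgue U"
      using D1(3) UL m1 by (intro measure_mono_fmeasurable) auto
    then have I_le: "measure lebesgue (\<Union>D1) < m + \<epsilon>" using Um by simp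

    have "\<exists>q. {C\<in>D2. C \<subseteq> I} \<subseteq> q \<and> q division_of I" if I: "I \<in> D1" for I
    proof -
      obtain u v where uv: "u < v" "I = {u..v}" using I1[OF I] by blast
      have "{C\<in>D2. C \<subseteq> I} division_of \<Union>{C\<in>D2. C \<subseteq> I}"
        by (rule division_of_subset[OF d2]) auto
      from partial_division_extend_interval[OF this, of u v] uv show ?thesis
        by (metis (no_types, lifting) Union_least box_real(2) mem_Collect_eq)
    qed
    then obtain q where q: "\<And>I. I \<in> D1 \<Longrightarrow> {C\<in>D2. C \<subseteq> I} \<subseteq> q I" "\<And>I. I \<in> D1 \<Longrightarrow> q I division_of I"
      by metis
    define Q where "Q = (\<Union>I\<in>D1. q I)"
    have finq: "finite (q I)" if "I \<in> D1" for I using q(2)[OF that] by (rule division_of_finite)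
    have finQ: "finite Q" unfolding Q_def using D1(1) finq by auto
    have D2Q: "D2 \<subseteq> Q" unfolding Q_def using q(1) in1 by blast
    have qI: "C \<subseteq> I" "C \<noteq> {}" "\<exists>u v. C = cbox u v" if "I \<in> D1" "C \<in> q I" for C I
      using division_ofD(2-4)[OF q(2)[OF that(1)] that(2)] by auto
    have Qdiv: "Q division_of \<Union>Q"
    proof (rule division_ofI)
      fix C assume C: "C \<in> Q"
      then obtain I where "I \<in> D1" "C \<in> q I" unfolding Q_def by auto
      then show "C \<noteq> {}" "\<exists>u v. C = cbox u v" using qI by auto
      show "C \<subseteq> \<Union>Q" using C by auto
      fix C' assume C': "C' \<in> Q" "C \<noteq> C'"
      then obtain I' where I': "I' \<in> D1" "C' \<in> q I'" unfolding Q_def by auto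
      show "interior C \<inter> interior C' = {}"
      proof (cases "I = I'")
        case True
        then show ?thesis using division_ofD(5)[OF q(2)[OF \<open>I \<in> D1\<close>]] \<open>C \<in> q I\<close> I' C'(2) by auto
      next
        case False
        then have "I \<inter> I' = {}" using D1(4) \<open>I \<in> D1\<close> I'(1) by (auto simp: pairwise_def disjnt_def)
        then show ?thesis using qI(1)[OF \<open>I \<in> D1\<close> \<open>C \<in> q I\<close>] qI(1)[OF I'] interior_subset by blast
      qed
    qed (use finQ in auto)
    have Qsub: "\<Union>Q \<subseteq> {a..b}"
    proof -
      have "\<Union>Q \<subseteq> U" unfolding Q_def using qI(1) D1(3) by blast
      moreover have "{a<..<b} \<subseteq> {a..b}" by auto
      ultimately show ?thesis using U(4) by blast
    qed
    \<comment> \<open>Stated for every \<open>h\<close>: the identity function gives the length of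
      the gaps \<open>Q - D2\<close>, and \<open>f\<close> gives the increments.\<close>
    have sumQ: "(\<Sum>C\<in>Q. h (Sup C) - h (Inf C)) = (\<Sum>I\<in>D1. h (Sup I) - h (Inf I))" for h :: "real \<Rightarrow> real"
    proof -
      have "(\<Sum>C\<in>Q. h (Sup C) - h (Inf C)) = (\<Sum>I\<in>D1. \<Sum>C\<in>q I. h (Sup C) - h (Inf C))"
        unfolding Q_def
      proof (rule sum.UNION_disjoint)
        show "\<forall>I\<in>D1. \<forall>I'\<in>D1. I \<noteq> I' \<longrightarrow> q I \<inter> q I' = {}"
        proof (intro ballI impI equals0I)
          fix I I' C assume h: "I \<in> D1" "I' \<in> D1" "I \<noteq> I'" "C \<in> q I \<inter> q I'"
          then have "I \<inter> I' = {}" using D1(4) by (auto simp: pairwise_def disjnt_def)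
          then show False using qI(1)[of I C] qI(1)[of I' C] qI(2)[of I C] h by blast
        qed
      qed (use D1 finq in auto)
      also have "\<dots> = (\<Sum>I\<in>D1. h (Sup I) - h (Inf I))"
      proof (rule sum.cong[OF refl])
        fix I assume I: "I \<in> D1"
        then obtain u v where uv: "u < v" "I = {u..v}" using I1 by blast
        then show "(\<Sum>C\<in>q I. h (Sup C) - h (Inf C)) = h (Sup I) - h (Inf I)"
          using division_telescope[of u v "q I" h] q(2)[OF I] by auto
      qed
      finally show ?thesis .
    qed
    have split: "(\<Sum>C\<in>Q. h (Sup C) - h (Inf C)) = (\<Sum>C\<in>Q - D2. h (Sup C) - h (Inf C)) + (\<Sum>C\<in>D2. h (Sup C) - h (Inf C))"
      for h :: "real \<Rightarrow> real"
      by (rule sum.subset_diff[OF D2Q finQ])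
    have Rdiv: "(Q - D2) division_of \<Union>(Q - D2)" by (rule division_of_subset[OF Qdiv]) auto
    have "(\<Sum>C\<in>Q - D2. Sup C - Inf C) < \<delta>"
      using split[of "\<lambda>x. x"] sumQ[of "\<lambda>x. x"] m1(2) m2(2) I_le J_ge \<epsilon> by simp
    moreover have "\<Union>(Q - D2) \<subseteq> {a..b}" using Qsub by auto
    ultimately have le: "(\<Sum>C\<in>Q - D2. norm (f (Sup C) - f (Inf C))) < c * m / 2"
      using \<delta>(2) Rdiv by blast
    have "- (\<Sum>C\<in>Q - D2. f (Sup C) - f (Inf C)) \<le> norm (\<Sum>C\<in>Q - D2. f (Sup C) - f (Inf C))" by simp
    also have "\<dots> \<le> (\<Sum>C\<in>Q - D2. norm (f (Sup C) - f (Inf C)))" by (rule norm_sum)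
    also note le
    finally have small: "- (\<Sum>C\<in>Q - D2. f (Sup C) - f (Inf C)) < c * m / 2" .
    have s1: "(\<Sum>I\<in>D1. f (Sup I) - f (Inf I)) \<le> 0"
    proof (rule sum_nonpos)
      fix I assume "I \<in> D1"
      then obtain u v where "u < v" "I = {u..v}" "f v \<le> f u" using D1(2) unfolding K1_def by blast
      then show "f (Sup I) - f (Inf I) \<le> 0" by simp
    qed
    have "c * (\<Sum>C\<in>D2. Sup C - Inf C) \<le> (\<Sum>C\<in>D2. f (Sup C) - f (Inf C))"
      unfolding sum_distrib_left
    proof (rule sum_mono)
      fix C assume "C \<in> D2"
      then obtain u v where "u < v" "C = {u..v}" "c * (v - u) \<le> f v - f u" using D2(2) unfolding K2_def by blast
      then show "c * (Sup C - Inf C) \<le> f (Sup C) - f (Inf C)" by simp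
    qed
    also have "\<dots> < c * m / 2" using split[of f] sumQ[of f] s1 small by simp
    finally have "c * measure lebesgue (\<Union>D2) < c * (m / 2)" using m2(2) by simp
    then have "measure lebesgue (\<Union>D2) < m / 2" using \<open>0 < c\<close> by simp
    then show False using J_ge \<epsilon> by simp
  qed
  show ?thesis
    unfolding negligible_outer
  proof (intro allI impI)
    fix e :: real assume "0 < e"
    then show "\<exists>T. S \<subseteq> T \<and> T \<in> lmeasurable \<and> measure lebesgue T < e"
      using approx[of e] \<open>m \<le> 0\<close> by auto
  qed
qed

text \<open>Disjoint intervals of slope at least \<open>N\<close> inside a set of length less than
  \<open>\<delta>\<close> have total increment below 1, hence total length below
  \<open>1 / N\<close>, with \<open>N\<close> arbitrary. Pieces of length
  \<open>\<delta> / 2\<close> provide such sets.\<close>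

lemma infinite_slope_negligible:
  fixes f :: "real \<Rightarrow> real"
  assumes ac: "ac_on {a..b} f" and S: "S \<subseteq> {a<..<b}"
    and hi: "\<And>x e N. x \<in> S \<Longrightarrow> 0 < e \<Longrightarrow> \<exists>u v. u < v \<and> x \<in> {u..v} \<and> v - u < e \<and> N * (v - u) \<le> f v - f u"
  shows "negligible S"
proof -
  obtain \<delta> where \<delta>: "0 < \<delta>"
      "\<forall>d. d division_of (\<Union>d) \<longrightarrow> \<Union>d \<subseteq> {a..b} \<longrightarrow> (\<Sum>i\<in>d. Sup i - Inf i) < \<delta> \<longrightarrow>
        (\<Sum>i\<in>d. norm (f (Sup i) - f (Inf i))) < 1"
    using ac_onD[OF ac zero_less_one] by blast
  have piece: "negligible (S \<inter> {p<..<p + \<delta>/2})" for p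
    unfolding negligible_outer
  proof (intro allI impI)
    fix e :: real assume "0 < e"
    \<comment> \<open>\<open>1 / N\<close> is half of \<open>e\<close>; the other half is spent on
      the remainder \<open>Z\<close>.\<close>
    define N where "N = 2 / e"
    have N: "0 < N" using \<open>0 < e\<close> unfolding N_def by simp
    define U where "U = {p<..<p + \<delta>/2} \<inter> {a<..<b}"
    have U: "open U" "bounded U" "S \<inter> {p<..<p + \<delta>/2} \<subseteq> U" "U \<subseteq> {a..b}" "U \<in> lmeasurable"
      "measure lebesgue U \<le> \<delta>/2"
    proof -
      have "measure lebesgue U \<le> measure lebesgue {p<..<p + \<delta>/2}"
        unfolding U_def by (intro measure_mono_fmeasurable sets.Int) auto
      then show "measure lebesgue U \<le> \<delta>/2" using \<delta>(1) by simp
    qed (use S in \<open>auto simp: U_def intro: bounded_subset[of "{a<..<b}"]\<close>)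
    define K where "K = {C. \<exists>u v. u < v \<and> C = {u..v} \<and> N * (v - u) \<le> f v - f u}"
    obtain D Z where D: "finite D" "D \<subseteq> K" "\<And>C. C \<in> D \<Longrightarrow> C \<subseteq> U" "pairwise disjnt D"
      and Z: "Z \<in> lmeasurable" "measure lebesgue Z < e / 2" "S \<inter> {p<..<p + \<delta>/2} \<subseteq> \<Union>D \<union> Z"
    proof (rule vitali_finite_subfamily[OF U(1-3), of K "e / 2"])
      show "\<exists>C\<in>K. x \<in> C \<and> Sup C - Inf C < e'" if xe: "x \<in> S \<inter> {p<..<p + \<delta>/2}" "0 < e'" for x e'
      proof -
        obtain u v where "u < v \<and> x \<in> {u..v} \<and> v - u < e' \<and> N * (v - u) \<le> f v - f u"
          using hi[of x e' N] xe by blast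
        then show ?thesis unfolding K_def by (intro bexI[of _ "{u..v}"]) auto
      qed
    qed (use \<open>0 < e\<close> in \<open>auto simp: K_def\<close>)
    have I: "\<exists>c d. c < d \<and> C = {c..d}" if "C \<in> D" for C using that D(2) unfolding K_def by blast
    note m = measure_disjoint_intervals[OF D(1) I D(4)]
    note d = disjoint_intervals_division[OF D(1) I D(4)]
    have DU: "\<Union>D \<subseteq> {a..b}" using D(3) U(4) by blast
    have "measure lebesgue (\<Union>D) < \<delta>"
      using measure_mono_fmeasurable[of "\<Union>D" U lebesgue] m(1) D(3) U(5,6) \<delta>(1) by fastforce
    then have "(\<Sum>i\<in>D. norm (f (Sup i) - f (Inf i))) < 1" using \<delta>(2) d DU m(2) by simp
    moreover have "N * (\<Sum>C\<in>D. Sup C - Inf C) \<le> (\<Sum>C\<in>D. norm (f (Sup C) - f (Inf C)))"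
      unfolding sum_distrib_left
    proof (rule sum_mono)
      fix C assume "C \<in> D"
      then obtain u v where "u < v" "C = {u..v}" "N * (v - u) \<le> f v - f u" using D(2) unfolding K_def by blast
      then show "N * (Sup C - Inf C) \<le> norm (f (Sup C) - f (Inf C))" by simp
    qed
    ultimately have "N * measure lebesgue (\<Union>D) < 1" using m(2) by simp
    then have mD: "measure lebesgue (\<Union>D) < e / 2" using \<open>0 < e\<close> unfolding N_def by (simp add: field_simps)
    have "measure lebesgue (\<Union>D \<union> Z) \<le> measure lebesgue (\<Union>D) + measure lebesgue Z"
      using m(1) Z(1) by (intro measure_Un_le) auto
    then have "measure lebesgue (\<Union>D \<union> Z) < e" using mD Z(2) by simp
    then show "\<exists>T. S \<inter> {p<..<p + \<delta>/2} \<subseteq> T \<and> T \<in> lmeasurable \<and> measure lebesgue T < e"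
      using Z m(1) by (intro exI[of _ "\<Union>D \<union> Z"]) auto
  qed
  \<comment> \<open>Open pieces of length \<open>\<delta> / 2\<close> at spacing
    \<open>\<delta> / 4\<close> overlap, so no point is lost at a boundary.\<close>
  have "negligible (\<Union>k::int. S \<inter> {real_of_int k * (\<delta>/4)<..<real_of_int k * (\<delta>/4) + \<delta>/2})"
    using negligible_countable_Union[of "range (\<lambda>k::int. S \<inter> {real_of_int k * (\<delta>/4)<..<real_of_int k * (\<delta>/4) + \<delta>/2})"] piece
    by auto
  moreover have "S \<subseteq> (\<Union>k::int. S \<inter> {real_of_int k * (\<delta>/4)<..<real_of_int k * (\<delta>/4) + \<delta>/2})"
  proof
    fix x assume "x \<in> S"
    \<comment> \<open>The ceiling less one gives the strict inequality on the left that an open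
      interval requires.\<close>
    define k where "k = \<lceil>x / (\<delta>/4)\<rceil> - 1"
    have "real_of_int k < x / (\<delta>/4)" "x / (\<delta>/4) \<le> real_of_int k + 1" unfolding k_def by linarith+
    then have "real_of_int k * (\<delta>/4) < x" "x \<le> (real_of_int k + 1) * (\<delta>/4)"
      using \<delta>(1) by (simp_all add: field_simps)
    then have "x \<in> {real_of_int k * (\<delta>/4)<..<real_of_int k * (\<delta>/4) + \<delta>/2}"
      using \<delta>(1) by (auto simp: algebra_simps)
    then show "x \<in> (\<Union>k::int. S \<inter> {real_of_int k * (\<delta>/4)<..<real_of_int k * (\<delta>/4) + \<delta>/2})"
      using \<open>x \<in> S\<close> by blast
  qed
  ultimately show ?thesis by (rule negligible_subset)
qed


section \<open>Permanence properties of absolute continuity\<close>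

lemma lipschitz_ac_on:
  fixes f :: "real \<Rightarrow> 'a::real_normed_vector"
  assumes lip: "\<And>x y. x \<in> S \<Longrightarrow> y \<in> S \<Longrightarrow> norm (f x - f y) \<le> L * \<bar>x - y\<bar>"
  shows "ac_on S f"
  unfolding ac_on_def
proof (intro allI impI)
  fix \<epsilon> :: real assume "0 < \<epsilon>"
  define M where "M = \<bar>L\<bar> + 1"
  have M: "0 < M" "L \<le> M" unfolding M_def by auto
  show "\<exists>\<delta>>0. \<forall>d T. d division_of T \<and> T \<subseteq> S \<and> (\<Sum>i\<in>d. Sup i - Inf i) < \<delta> \<longrightarrow>
        (\<Sum>i\<in>d. norm (f (Sup i) - f (Inf i))) < \<epsilon>"
  proof (rule exI[of _ "\<epsilon> / M"], intro conjI allI impI)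
    fix d T assume d: "d division_of T \<and> T \<subseteq> S \<and> (\<Sum>i\<in>d. Sup i - Inf i) < \<epsilon> / M"
    have "(\<Sum>i\<in>d. norm (f (Sup i) - f (Inf i))) \<le> (\<Sum>i\<in>d. M * (Sup i - Inf i))"
    proof (rule sum_mono)
      fix i assume i: "i \<in> d"
      have dd: "d division_of T" using d by blast
      obtain u v where uv: "i = {u..v}" using division_ofD(4)[OF dd i] by auto
      then have "u \<le> v" using division_ofD(3)[OF dd i] by auto
      have "i \<subseteq> S" using division_ofD(2)[OF dd i] d by auto
      then have "u \<in> S" "v \<in> S" using uv \<open>u \<le> v\<close> by auto
      then have "norm (f v - f u) \<le> L * (v - u)" using lip[of v u] \<open>u \<le> v\<close> by simp
      also have "\<dots> \<le> M * (v - u)" using M \<open>u \<le> v\<close> by (intro mult_right_mono) auto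
      finally show "norm (f (Sup i) - f (Inf i)) \<le> M * (Sup i - Inf i)" using uv \<open>u \<le> v\<close> by simp
    qed
    also have "\<dots> < \<epsilon>" using d M by (simp add: sum_distrib_left[symmetric] pos_less_divide_eq mult.commute)
    finally show "(\<Sum>i\<in>d. norm (f (Sup i) - f (Inf i))) < \<epsilon>" .
  qed (use \<open>0 < \<epsilon>\<close> M in simp)
qed

text \<open>One criterion for sums, differences, inner products and components: in each case an
  increment of \<open>f\<close> is bounded linearly by increments of functions already known to be
  absolutely continuous.\<close>

lemma ac_on_dominated:
  fixes f :: "real \<Rightarrow> 'a::real_normed_vector" and g :: "real \<Rightarrow> 'b::real_normed_vector"
    and h :: "real \<Rightarrow> 'c::real_normed_vector"
  assumes "ac_on S g" "ac_on S h" "0 \<le> A" "0 \<le> B"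
    and dom: "\<And>x y. x \<in> S \<Longrightarrow> y \<in> S \<Longrightarrow> norm (f x - f y) \<le> A * norm (g x - g y) + B * norm (h x - h y)"
  shows "ac_on S f"
  unfolding ac_on_def
proof (intro allI impI)
  fix \<epsilon> :: real assume "0 < \<epsilon>"
  define M where "M = A + B + 1"
  have M: "0 < M" "A \<le> M" "B \<le> M" using assms(3,4) unfolding M_def by auto
  then have "0 < \<epsilon> / (2 * M)" using \<open>0 < \<epsilon>\<close> by simp
  from ac_onD[OF assms(1) this] ac_onD[OF assms(2) this]
  obtain \<delta>1 \<delta>2 where \<delta>: "0 < \<delta>1" "0 < \<delta>2"
    "\<forall>d. d division_of (\<Union>d) \<longrightarrow> \<Union>d \<subseteq> S \<longrightarrow> (\<Sum>i\<in>d. Sup i - Inf i) < \<delta>1 \<longrightarrow>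
        (\<Sum>i\<in>d. norm (g (Sup i) - g (Inf i))) < \<epsilon> / (2 * M)"
    "\<forall>d. d division_of (\<Union>d) \<longrightarrow> \<Union>d \<subseteq> S \<longrightarrow> (\<Sum>i\<in>d. Sup i - Inf i) < \<delta>2 \<longrightarrow>
        (\<Sum>i\<in>d. norm (h (Sup i) - h (Inf i))) < \<epsilon> / (2 * M)"
    by blast
  show "\<exists>\<delta>>0. \<forall>d T. d division_of T \<and> T \<subseteq> S \<and> (\<Sum>i\<in>d. Sup i - Inf i) < \<delta> \<longrightarrow>
        (\<Sum>i\<in>d. norm (f (Sup i) - f (Inf i))) < \<epsilon>"
  proof (rule exI[of _ "min \<delta>1 \<delta>2"], intro conjI allI impI)
    fix d T assume d: "d division_of T \<and> T \<subseteq> S \<and> (\<Sum>i\<in>d. Sup i - Inf i) < min \<delta>1 \<delta>2"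
    have dd: "d division_of T" and T: "T = \<Union>d" using d division_ofD(6) by blast+
    have "(\<Sum>i\<in>d. norm (f (Sup i) - f (Inf i)))
        \<le> (\<Sum>i\<in>d. M * norm (g (Sup i) - g (Inf i)) + M * norm (h (Sup i) - h (Inf i)))"
    proof (rule sum_mono)
      fix i assume i: "i \<in> d"
      obtain u v where uv: "i = {u..v}" using division_ofD(4)[OF dd i] by auto
      then have "u \<le> v" using division_ofD(3)[OF dd i] by auto
      have "i \<subseteq> S" using division_ofD(2)[OF dd i] d by auto
      then have "u \<in> S" "v \<in> S" using uv \<open>u \<le> v\<close> by auto
      then have "norm (f v - f u) \<le> A * norm (g v - g u) + B * norm (h v - h u)" by (rule dom[rotated])
      also have "\<dots> \<le> M * norm (g v - g u) + M * norm (h v - h u)"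
        using M by (intro add_mono mult_right_mono) auto
      finally show "norm (f (Sup i) - f (Inf i)) \<le> M * norm (g (Sup i) - g (Inf i)) + M * norm (h (Sup i) - h (Inf i))"
        using uv \<open>u \<le> v\<close> by simp
    qed
    also have "\<dots> = M * ((\<Sum>i\<in>d. norm (g (Sup i) - g (Inf i))) + (\<Sum>i\<in>d. norm (h (Sup i) - h (Inf i))))"
      by (simp add: sum.distrib sum_distrib_left distrib_left)
    also have "\<dots> < M * (\<epsilon> / (2 * M) + \<epsilon> / (2 * M))"
    proof (intro mult_strict_left_mono add_strict_mono)
      show "(\<Sum>i\<in>d. norm (g (Sup i) - g (Inf i))) < \<epsilon> / (2 * M)"
        using \<delta>(3) d dd unfolding T by simp
      show "(\<Sum>i\<in>d. norm (h (Sup i) - h (Inf i))) < \<epsilon> / (2 * M)"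
        using \<delta>(4) d dd unfolding T by simp
    qed (use M in simp)
    also have "\<dots> = \<epsilon>" using M by simp
    finally show "(\<Sum>i\<in>d. norm (f (Sup i) - f (Inf i))) < \<epsilon>" .
  qed (use \<delta> in simp)
qed

section \<open>Differentiability almost everywhere\<close>

lemma frequently_slope_interval:
  fixes f :: "real \<Rightarrow> real"
  assumes "\<exists>\<^sub>F y in at x. P ((f y - f x) / (y - x))" "0 < e"
  shows "\<exists>u v. u < v \<and> x \<in> {u..v} \<and> v - u < e \<and> P ((f v - f u) / (v - u))"
proof -
  have "\<forall>\<^sub>F y in at x. dist y x < e" using assms(2) by (auto simp: eventually_at)
  moreover have "\<forall>\<^sub>F y in at x. y \<noteq> x" by (auto simp: eventually_at_filter)
  ultimately have "\<forall>\<^sub>F y in at x. dist y x < e \<and> y \<noteq> x" by (rule eventually_conj)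
  from frequently_eventually_frequently[OF assms(1) this]
  obtain y where y: "dist y x < e" "y \<noteq> x" "P ((f y - f x) / (y - x))"
    by (auto dest: frequently_ex)
  show ?thesis
  proof (cases "x < y")
    case True
    then show ?thesis using y by (intro exI[of _ x] exI[of _ y]) (auto simp: dist_real_def)
  next
    case False
    \<comment> \<open>A difference quotient is symmetric in its two points, so a point to the left
      of \<open>x\<close> serves as well.\<close>
    moreover have "(f x - f y) / (x - y) = (f y - f x) / (y - x)"
      by (metis minus_diff_eq minus_divide_divide)
    ultimately show ?thesis using y by (intro exI[of _ y] exI[of _ x]) (auto simp: dist_real_def)
  qed
qed

text \<open>In the extended reals the lower and upper limits of the difference quotient always
  exist. If they differ, two rationals separate them; if they agree and are finite, \<open>f\<close>
  is differentiable; otherwise the slope is infinite. Rational bounds leave only countably many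
  exceptional sets.\<close>

lemma nondifferentiable_slopes:
  fixes f :: "real \<Rightarrow> real"
  assumes "\<not> f differentiable (at x)"
  shows "(\<exists>p q::rat. p < q \<and> (\<exists>\<^sub>F y in at x. (f y - f x) / (y - x) < of_rat p) \<and> (\<exists>\<^sub>F y in at x. of_rat q < (f y - f x) / (y - x)))
    \<or> (\<forall>N. \<exists>\<^sub>F y in at x. N < (f y - f x) / (y - x)) \<or> (\<forall>N. \<exists>\<^sub>F y in at x. (f y - f x) / (y - x) < N)"
proof -
  define s where "s y = ereal ((f y - f x) / (y - x))" for y
  have le: "Liminf (at x) s \<le> Limsup (at x) s" by (rule Liminf_le_Limsup) simp
  show ?thesis
  proof (cases "Liminf (at x) s < Limsup (at x) s")
    case True
    then obtain p :: rat where p: "Liminf (at x) s < ereal (of_rat p)" "ereal (of_rat p) < Limsup (at x) s"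
      using ereal_dense3 by blast
    then obtain q :: rat where q: "ereal (of_rat p) < ereal (of_rat q)" "ereal (of_rat q) < Limsup (at x) s"
      using ereal_dense3 by blast
    have "\<exists>\<^sub>F y in at x. s y < ereal (of_rat p)"
      using p(1) Liminf_bounded[of "ereal (of_rat p)" s "at x"] unfolding frequently_def
      by (metis (mono_tags, lifting) eventually_mono leD linorder_not_less)
    moreover have "\<exists>\<^sub>F y in at x. ereal (of_rat q) < s y"
      using q(2) Limsup_bounded[of s "ereal (of_rat q)" "at x"] unfolding frequently_def
      by (metis (mono_tags, lifting) eventually_mono leD linorder_not_less)
    moreover have "p < q" using q(1) by (simp add: of_rat_less)
    ultimately show ?thesis unfolding s_def by auto
  next
    case False
    then have lim: "(s \<longlongrightarrow> Liminf (at x) s) (at x)"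
      using le by (intro Liminf_eq_Limsup) auto
    have fr: "\<exists>\<^sub>F y in at x. P y" if "\<forall>\<^sub>F y in at x. P y" for P
      using that by (rule eventually_frequently[rotated]) simp
    show ?thesis
    proof (cases "Liminf (at x) s")
      case (real r)
      then have "((\<lambda>y. (f y - f x) / (y - x)) \<longlongrightarrow> r) (at x)" using lim unfolding s_def by simp
      then have "(f has_field_derivative r) (at x)" by (simp add: has_field_derivative_iff)
      then show ?thesis using assms by (metis field_differentiable_def field_differentiable_imp_differentiable)
    next
      case PInf
      have "\<exists>\<^sub>F y in at x. N < (f y - f x) / (y - x)" for N
        using fr[OF order_tendstoD(1)[OF lim, of "ereal N"]] PInf unfolding s_def by simp
      then show ?thesis by blast
    next
      case MInf
      have "\<exists>\<^sub>F y in at x. (f y - f x) / (y - x) < N" for N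
        using fr[OF order_tendstoD(2)[OF lim, of "ereal N"]] MInf unfolding s_def by simp
      then show ?thesis by blast
    qed
  qed
qed

lemma ac_on_real_differentiable_ae:
  fixes f :: "real \<Rightarrow> real"
  assumes ac: "ac_on {a..b} f"
  shows "negligible {x \<in> {a<..<b}. \<not> f differentiable (at x)}"
proof -
  define A where "A p q = {x \<in> {a<..<b}. (\<exists>\<^sub>F y in at x. (f y - f x) / (y - x) < real_of_rat p) \<and>
    (\<exists>\<^sub>F y in at x. real_of_rat q < (f y - f x) / (y - x))}" for p q
  define B where "B = {x \<in> {a<..<b}. \<forall>N. \<exists>\<^sub>F y in at x. N < (f y - f x) / (y - x)}"
  define C where "C = {x \<in> {a<..<b}. \<forall>N. \<exists>\<^sub>F y in at x. (f y - f x) / (y - x) < N}"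
  have A: "negligible (A p q)" if "p < q" for p q
  proof (rule dini_negligible)
    \<comment> \<open>Subtracting \<open>p * x\<close> turns slopes below \<open>p\<close> and above
      \<open>q\<close> into negative slopes and slopes above \<open>q - p\<close>, as
      \<open>dini_negligible\<close> requires.\<close>
    show "ac_on {a..b} (\<lambda>x. f x - real_of_rat p * x)"
    proof (rule ac_on_dominated[OF ac lipschitz_ac_on[of _ "\<lambda>x. x" 1], where A = 1 and B = "\<bar>real_of_rat p\<bar>"])
      fix x y :: real
      show "norm ((f x - real_of_rat p * x) - (f y - real_of_rat p * y))
          \<le> 1 * norm (f x - f y) + \<bar>real_of_rat p\<bar> * norm (x - y)"
        using norm_triangle_ineq4[of "f x - f y" "real_of_rat p * (x - y)"]
        by (simp add: algebra_simps abs_mult[symmetric] del: abs_of_rat)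
    qed auto
    show "0 < real_of_rat q - real_of_rat p" using that by (simp add: of_rat_less)
    fix x e :: real assume x: "x \<in> A p q" and e: "0 < e"
    obtain u v where "u < v" "x \<in> {u..v}" "v - u < e" "(f v - f u) / (v - u) < real_of_rat p"
      using frequently_slope_interval[where f = f and x = x and P = "\<lambda>s. s < real_of_rat p" and e = e] x e unfolding A_def by blast
    then show "\<exists>u v. u < v \<and> x \<in> {u..v} \<and> v - u < e \<and> f v - real_of_rat p * v \<le> f u - real_of_rat p * u"
      by (intro exI[of _ u] exI[of _ v]) (auto simp: field_simps)
    obtain u v where "u < v" "x \<in> {u..v}" "v - u < e" "real_of_rat q < (f v - f u) / (v - u)"
      using frequently_slope_interval[where f = f and x = x and P = "\<lambda>s. real_of_rat q < s" and e = e] x e unfolding A_def by blast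
    then show "\<exists>u v. u < v \<and> x \<in> {u..v} \<and> v - u < e \<and>
        (real_of_rat q - real_of_rat p) * (v - u) \<le> f v - real_of_rat p * v - (f u - real_of_rat p * u)"
      by (intro exI[of _ u] exI[of _ v]) (auto simp: field_simps)
  qed (auto simp: A_def)
  have B: "negligible B"
  proof (rule infinite_slope_negligible[OF ac])
    fix x e N :: real assume x: "x \<in> B" and e: "0 < e"
    obtain u v where "u < v" "x \<in> {u..v}" "v - u < e" "N < (f v - f u) / (v - u)"
      using frequently_slope_interval[where f = f and x = x and P = "\<lambda>s. N < s" and e = e] x e unfolding B_def by blast
    then show "\<exists>u v. u < v \<and> x \<in> {u..v} \<and> v - u < e \<and> N * (v - u) \<le> f v - f u"
      by (intro exI[of _ u] exI[of _ v]) (auto simp: field_simps)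
  qed (auto simp: B_def)
  have C: "negligible C"
  proof (rule infinite_slope_negligible)
    show "ac_on {a..b} (\<lambda>x. - f x)"
      by (rule ac_on_dominated[OF ac ac, where A = 1 and B = 0]) auto
    fix x e N :: real assume x: "x \<in> C" and e: "0 < e"
    obtain u v where "u < v" "x \<in> {u..v}" "v - u < e" "(f v - f u) / (v - u) < - N"
      using frequently_slope_interval[where f = f and x = x and P = "\<lambda>s. s < - N" and e = e] x e unfolding C_def by blast
    then show "\<exists>u v. u < v \<and> x \<in> {u..v} \<and> v - u < e \<and> N * (v - u) \<le> - f v - - f u"
      by (intro exI[of _ u] exI[of _ v]) (auto simp: field_simps)
  qed (auto simp: C_def)
  have "negligible (\<Union>r\<in>{r. fst r < snd r}. A (fst r) (snd r))"
    using A by (intro negligible_countable_Union) auto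
  then have "negligible ((\<Union>r\<in>{r. fst r < snd r}. A (fst r) (snd r)) \<union> (B \<union> C))"
    using B C by simp
  moreover have "{x \<in> {a<..<b}. \<not> f differentiable (at x)} \<subseteq> (\<Union>r\<in>{r. fst r < snd r}. A (fst r) (snd r)) \<union> (B \<union> C)"
  proof
    fix x assume "x \<in> {x \<in> {a<..<b}. \<not> f differentiable (at x)}"
    with nondifferentiable_slopes[of f x]
    show "x \<in> (\<Union>r\<in>{r. fst r < snd r}. A (fst r) (snd r)) \<union> (B \<union> C)"
      unfolding A_def B_def C_def by force
  qed
  ultimately show ?thesis by (rule negligible_subset)
qed

lemma ac_on_complex_differentiable_ae:
  fixes f :: "real \<Rightarrow> complex"
  assumes ac: "ac_on {a..b} f"
  shows "negligible {x \<in> {a<..<b}. \<not> f differentiable (at x)}"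
proof -
  have "ac_on {a..b} (\<lambda>x. Re (f x))" "ac_on {a..b} (\<lambda>x. Im (f x))"
    using abs_Re_le_cmod abs_Im_le_cmod
    by (auto intro!: ac_on_dominated[OF ac ac, where A = 1 and B = 0] simp flip: minus_complex.sel)
  then have "negligible ({x \<in> {a<..<b}. \<not> (\<lambda>x. Re (f x)) differentiable (at x)} \<union>
      {x \<in> {a<..<b}. \<not> (\<lambda>x. Im (f x)) differentiable (at x)})"
    by (intro negligible_Un ac_on_real_differentiable_ae)
  moreover have "f differentiable (at x)"
    if re: "(\<lambda>x. Re (f x)) differentiable (at x)" and im: "(\<lambda>x. Im (f x)) differentiable (at x)" for x
  proof -
    have "((\<lambda>x. of_real (Re (f x)) + of_real (Im (f x)) * \<i>) has_vector_derivative
        of_real (vector_derivative (\<lambda>x. Re (f x)) (at x)) + of_real (vector_derivative (\<lambda>x. Im (f x)) (at x)) * \<i>) (at x)"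
      using re im by (intro has_vector_derivative_add has_vector_derivative_mult_left has_vector_derivative_of_real)
        (simp_all add: vector_derivative_works has_real_derivative_iff_has_vector_derivative)
    moreover have "(\<lambda>x. of_real (Re (f x)) + of_real (Im (f x)) * \<i>) = f"
      by (auto simp: complex_eq_iff fun_eq_iff)
    ultimately show ?thesis
      by (auto intro: differentiableI_vector)
  qed
  ultimately show ?thesis
    by (elim negligible_subset) blast
qed

text \<open>At tags outside \<open>N\<close>, differentiability bounds the error on an interval by
  \<open>e1\<close> times its length. Intervals tagged in \<open>N\<close> lie in an open set of
  measure less than \<open>\<delta>\<close>, so there absolute continuity bounds the sum of the
  increments.\<close>

lemma ac_on_has_integral:
  fixes f :: "real \<Rightarrow> 'a::banach"
  assumes "a \<le> b" and ac: "ac_on {a..b} f" and N: "negligible N"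
    and der: "\<And>x. x \<in> {a..b} - N \<Longrightarrow> (f has_vector_derivative f' x) (at x within {a..b})"
  shows "(f' has_integral (f b - f a)) {a..b}"
proof -
  \<comment> \<open>Setting the derivative to 0 on \<open>N\<close> removes the Riemann terms with
    tags there; only the increments of \<open>f\<close> remain.\<close>
  define g where "g x = (if x \<in> N then 0 else f' x)" for x
  have "(g has_integral (f b - f a)) (cbox a b)"
    unfolding has_integral
  proof (intro allI impI)
    fix e :: real assume "0 < e"
    \<comment> \<open>The added 1 makes the final bound strict and covers
      \<open>a = b\<close>.\<close>
    define e1 where "e1 = e / (2 * (b - a + 1))"
    have e1: "0 < e1" using \<open>0 < e\<close> \<open>a \<le> b\<close> unfolding e1_def by simp
    from ac_onD[OF ac half_gt_zero[OF \<open>0 < e\<close>]] obtain \<delta> where \<delta>: "0 < \<delta>"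
      "\<forall>d. d division_of (\<Union>d) \<longrightarrow> \<Union>d \<subseteq> {a..b} \<longrightarrow> (\<Sum>i\<in>d. Sup i - Inf i) < \<delta> \<longrightarrow>
        (\<Sum>i\<in>d. norm (f (Sup i) - f (Inf i))) < e / 2" by blast
    obtain U where U: "open U" "N \<subseteq> U" "(U - N) \<in> lmeasurable" "emeasure lebesgue (U - N) < ennreal \<delta>"
      using sets_lebesgue_outer_open[of N \<delta>] N \<delta> by (auto simp: negligible_imp_sets)
    have NL: "N \<in> lmeasurable" "measure lebesgue N = 0" using N by (auto simp: negligible_iff_measure)
    have UL: "U \<in> lmeasurable"
      using fmeasurable.Un[OF U(3) NL(1)] U(2) by (simp add: Un_absorb2)
    have Um: "measure lebesgue U < \<delta>"
    proof -
      have "measure lebesgue (U - N) < \<delta>"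
        using U(3,4) \<delta>(1) by (simp only: emeasure_eq_measure2 ennreal_less_iff measure_nonneg)
      moreover have "measure lebesgue (U - N) = measure lebesgue U"
        using UL N by (intro measure_Diff_null_set) (auto simp: negligible_iff_null_sets)
      ultimately show ?thesis by simp
    qed
    have "\<exists>d>0. (x \<in> {a..b} - N \<longrightarrow> (\<forall>y\<in>{a..b}. norm (y - x) < d \<longrightarrow> norm (f y - f x - (y - x) *\<^sub>R f' x) \<le> e1 * norm (y - x)))
      \<and> (x \<in> N \<longrightarrow> ball x d \<subseteq> U)" for x
    proof (cases "x \<in> N")
      case True
      then show ?thesis using U(1,2) by (metis DiffE openE subsetD)
    next
      case False
      show ?thesis
      proof (cases "x \<in> {a..b}")
        case True
        then show ?thesis
          using der[of x, unfolded has_vector_derivative_def has_derivative_within_alt] False e1 by blast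
      qed (use False in \<open>auto intro: zero_less_one\<close>)
    qed
    then obtain d where d: "\<And>x. 0 < d x"
      "\<And>x y. \<lbrakk>x \<in> {a..b} - N; y \<in> {a..b}; norm (y - x) < d x\<rbrakk> \<Longrightarrow> norm (f y - f x - (y - x) *\<^sub>R f' x) \<le> e1 * norm (y - x)"
      "\<And>x. x \<in> N \<Longrightarrow> ball x (d x) \<subseteq> U"
      by metis
    show "\<exists>\<gamma>. gauge \<gamma> \<and> (\<forall>p. p tagged_division_of cbox a b \<and> \<gamma> fine p \<longrightarrow>
      norm ((\<Sum>(x, K)\<in>p. measure lborel K *\<^sub>R g x) - (f b - f a)) < e)"
    proof (rule exI, safe)
      show "gauge (\<lambda>x. ball x (d x))" using d(1) gauge_ball_dependent by blast
    next
      fix p assume p: "p tagged_division_of cbox a b" and fine: "(\<lambda>x. ball x (d x)) fine p"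
      have fin: "finite p" using p by blast
      have ba: "b - a = (\<Sum>(x,K)\<in>p. Sup K - Inf K)" "f b - f a = (\<Sum>(x,K)\<in>p. f (Sup K) - f (Inf K))"
        using additive_tagged_division_1[where f = "\<lambda>x. x"] additive_tagged_division_1[where f = f]
          \<open>a \<le> b\<close> p by auto
      define p1 where "p1 = {z\<in>p. fst z \<in> N}"
      define \<phi> where "\<phi> z = (case z of (x, K) \<Rightarrow> measure lborel K *\<^sub>R g x - (f (Sup K) - f (Inf K)))" for z
      have iv: "\<exists>u v. u \<le> v \<and> K = {u..v} \<and> x \<in> K \<and> K \<subseteq> {a..b} \<and> K \<subseteq> ball x (d x)" if "(x, K) \<in> p" for x K
      proof -
        obtain u v where "K = cbox u v" using tagged_division_ofD(4)[OF p \<open>(x, K) \<in> p\<close>] by auto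
        moreover have "x \<in> K" "K \<subseteq> {a..b}" using tagged_division_ofD(2,3)[OF p \<open>(x, K) \<in> p\<close>] by auto
        ultimately show ?thesis using fineD[OF fine \<open>(x, K) \<in> p\<close>] by auto
      qed
      have "(\<Sum>(x, K)\<in>p. measure lborel K *\<^sub>R g x) - (f b - f a) = sum \<phi> p"
        unfolding ba(2) \<phi>_def sum_subtractf[symmetric] by (simp add: split_def)
      also have "\<dots> = sum \<phi> (p - p1) + sum \<phi> p1"
        by (rule sum.subset_diff[OF _ fin]) (auto simp: p1_def)
      finally have eq: "(\<Sum>(x, K)\<in>p. measure lborel K *\<^sub>R g x) - (f b - f a) = sum \<phi> (p - p1) + sum \<phi> p1" .
      have "norm (sum \<phi> (p - p1)) \<le> (\<Sum>z\<in>p - p1. e1 * (case z of (x, K) \<Rightarrow> Sup K - Inf K))"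
      proof (rule sum_norm_le)
        fix z assume "z \<in> p - p1"
        then obtain x K where z: "z = (x, K)" and xK: "(x, K) \<in> p" "(x, K) \<notin> p1" by (cases z) auto
        then have xN: "x \<notin> N" unfolding p1_def by auto
        obtain u v where uv: "u \<le> v" "K = {u..v}" "x \<in> K" "K \<subseteq> {a..b}" "K \<subseteq> ball x (d x)" using iv[OF xK(1)] by blast
        \<comment> \<open>Straddle estimate: both endpoints are compared with the tag between them,
          so the two distances add up to the length.\<close>
        have "norm ((v - u) *\<^sub>R f' x - (f v - f u)) = norm (f u - f x - (u - x) *\<^sub>R f' x - (f v - f x - (v - x) *\<^sub>R f' x))"
          by (auto simp: algebra_simps)
        also have "\<dots> \<le> norm (f u - f x - (u - x) *\<^sub>R f' x) + norm (f v - f x - (v - x) *\<^sub>R f' x)"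
          by (rule norm_triangle_ineq4)
        also have "\<dots> \<le> e1 * norm (u - x) + e1 * norm (v - x)"
        proof -
          have "{u, v} \<subseteq> K" using uv(1,2) by auto
          then have "u \<in> {a..b}" "v \<in> {a..b}" "u \<in> ball x (d x)" "v \<in> ball x (d x)" "x \<in> {a..b} - N"
            using uv(3-5) xN by blast+
          then show ?thesis
            by (intro add_mono d(2)) (auto simp: dist_real_def abs_minus_commute)
        qed
        also have "\<dots> = e1 * (v - u)" using uv(1-3) by (auto simp: algebra_simps)
        finally show "norm (\<phi> z) \<le> e1 * (case z of (x, K) \<Rightarrow> Sup K - Inf K)"
          using uv(1,2) xN z by (simp add: \<phi>_def g_def)
      qed
      also have "\<dots> \<le> (\<Sum>z\<in>p. e1 * (case z of (x, K) \<Rightarrow> Sup K - Inf K))"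
      proof (rule sum_mono2[OF fin])
        fix z assume "z \<in> p - (p - p1)"
        then obtain x K where "z = (x, K)" "(x, K) \<in> p" by (cases z) auto
        then show "0 \<le> e1 * (case z of (x, K) \<Rightarrow> Sup K - Inf K)" using iv[of x K] e1 by auto
      qed auto
      also have "\<dots> = e1 * (b - a)" by (simp add: ba(1) sum_distrib_left)
      also have "\<dots> < e / 2" using \<open>0 < e\<close> \<open>a \<le> b\<close> unfolding e1_def by (simp add: field_simps)
      finally have good: "norm (sum \<phi> (p - p1)) < e / 2" .

      \<comment> \<open>Two tags may share an interval of length 0. Without such intervals, whose
        increments vanish, the map from tagged pairs to intervals is injective.\<close>
      define q where "q = snd ` {z\<in>p1. measure lborel (snd z) \<noteq> 0}"
      have p1: "p1 tagged_partial_division_of cbox a b"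
      proof (rule tagged_partial_division_subset)
        show "p tagged_partial_division_of cbox a b"
          using p by (simp only: tagged_division_of_def)
      qed (auto simp: p1_def)
      have finp1: "finite p1" unfolding p1_def using fin by auto
      have inj: "inj_on snd {z\<in>p1. measure lborel (snd z) \<noteq> 0}"
      proof (rule inj_onI, rule ccontr)
        fix z w assume z: "z \<in> {z\<in>p1. measure lborel (snd z) \<noteq> 0}" and w: "w \<in> {z\<in>p1. measure lborel (snd z) \<noteq> 0}" and eq: "snd z = snd w" "z \<noteq> w"
        obtain x K y L where zw: "z = (x, K)" "w = (y, L)" by (cases z, cases w) auto
        then have "K = L" using eq by simp
        have "interior K \<inter> interior L = {}"
          using tagged_partial_division_ofD(5)[OF p1, of x K y L] z w zw eq(2) by auto
        then have "interior K = {}" using \<open>K = L\<close> by simp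
        moreover obtain u v where "K = cbox u v" using tagged_partial_division_ofD(4)[OF p1, of x K] z zw by auto
        ultimately have "measure lborel K = 0" by (simp add: content_eq_0_interior)
        then show False using z zw by simp
      qed
      have qdiv: "q division_of \<Union>q"
      proof -
        have "snd ` p1 division_of \<Union>(snd ` p1)"
          using p1 by (rule partial_division_of_tagged_division)
        then show ?thesis by (rule division_of_subset) (auto simp: q_def)
      qed
      have inp: "\<exists>x. (x, C) \<in> p \<and> x \<in> N" if "C \<in> q" for C
        using that unfolding q_def p1_def by auto
      have qab: "\<Union>q \<subseteq> {a..b}"
        using inp iv by (meson Sup_least)
      have qU: "\<Union>q \<subseteq> U"
      proof (rule Union_least)
        fix C assume "C \<in> q"
        then obtain x where x: "(x, C) \<in> p" "x \<in> N" using inp by blast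
        then show "C \<subseteq> U" using iv[OF x(1)] d(3)[OF x(2)] by blast
      qed
      have "(\<Sum>C\<in>q. Sup C - Inf C) = sum (measure lebesgue) q"
      proof (rule sum.cong[OF refl])
        fix C assume "C \<in> q"
        then obtain x where "(x, C) \<in> p" using inp by blast
        then obtain u v where "u \<le> v" "C = {u..v}" using iv by blast
        then show "Sup C - Inf C = measure lebesgue C" by simp
      qed
      also have "\<dots> = measure lebesgue (\<Union>q)"
        using content_division[OF qdiv] by simp
      also have "\<dots> \<le> measure lebesgue U"
        using qU UL qdiv by (intro measure_mono_fmeasurable) (auto intro!: fmeasurableD lmeasurable_division)
      finally have "(\<Sum>C\<in>q. Sup C - Inf C) < \<delta>" using Um by simp
      then have small: "(\<Sum>C\<in>q. norm (f (Sup C) - f (Inf C))) < e / 2"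
        using \<delta>(2) qdiv qab by blast
      have "norm (sum \<phi> p1) \<le> (\<Sum>z\<in>p1. norm (f (Sup (snd z)) - f (Inf (snd z))))"
      proof (rule sum_norm_le)
        fix z assume "z \<in> p1"
        then show "norm (\<phi> z) \<le> norm (f (Sup (snd z)) - f (Inf (snd z)))"
          unfolding p1_def by (cases z) (auto simp: \<phi>_def g_def norm_minus_commute)
      qed
      also have "\<dots> = (\<Sum>z\<in>{z\<in>p1. measure lborel (snd z) \<noteq> 0}. norm (f (Sup (snd z)) - f (Inf (snd z))))"
      proof (rule sum.mono_neutral_right[OF finp1])
        show "\<forall>z\<in>p1 - {z \<in> p1. measure lborel (snd z) \<noteq> 0}. norm (f (Sup (snd z)) - f (Inf (snd z))) = 0"
        proof
          fix z assume z: "z \<in> p1 - {z \<in> p1. measure lborel (snd z) \<noteq> 0}"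
          obtain x K where zx: "z = (x, K)" by (cases z)
          then have "(x, K) \<in> p" "measure lborel K = 0" using z unfolding p1_def by auto
          then obtain u v where "u \<le> v" "K = {u..v}" using iv by blast
          then have "Sup K = Inf K" using \<open>measure lborel K = 0\<close> by simp
          then show "norm (f (Sup (snd z)) - f (Inf (snd z))) = 0" using zx by simp
        qed
      qed auto
      also have "\<dots> = (\<Sum>C\<in>q. norm (f (Sup C) - f (Inf C)))"
        unfolding q_def by (simp add: sum.reindex[OF inj])
      finally have "norm (sum \<phi> p1) < e / 2" using small by simp
      then show "norm ((\<Sum>(x, K)\<in>p. measure lborel K *\<^sub>R g x) - (f b - f a)) < e"
        unfolding eq using good norm_triangle_ineq[of "sum \<phi> (p - p1)" "sum \<phi> p1"] by simp
    qed
  qed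
  then have "(g has_integral (f b - f a)) {a..b}" by simp
  then show ?thesis
    by (rule has_integral_spike[OF N, rotated]) (auto simp: g_def)
qed


section \<open>The polarised energy on an interval\<close>

lemma ac_on_inner:
  fixes f g :: "real \<Rightarrow> 'a::real_inner"
  assumes "ac_on S f" "ac_on S g" "bounded (f ` S)" "bounded (g ` S)"
  shows "ac_on S (\<lambda>x. f x \<bullet> g x)"
proof -
  obtain A where A: "0 < A" "\<And>x. x \<in> S \<Longrightarrow> norm (f x) \<le> A"
    using assms(3) by (auto simp: bounded_pos)
  obtain B where B: "0 < B" "\<And>x. x \<in> S \<Longrightarrow> norm (g x) \<le> B"
    using assms(4) by (auto simp: bounded_pos)
  show ?thesis
  proof (rule ac_on_dominated[OF assms(1,2), where A = B and B = A])
    fix x y assume xy: "x \<in> S" "y \<in> S"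
    have "f x \<bullet> g x - f y \<bullet> g y = (f x - f y) \<bullet> g x + f y \<bullet> (g x - g y)"
      by (simp add: inner_diff_left inner_diff_right)
    then have "norm (f x \<bullet> g x - f y \<bullet> g y) \<le> norm ((f x - f y) \<bullet> g x) + norm (f y \<bullet> (g x - g y))"
      by (metis norm_triangle_ineq)
    also have "\<dots> \<le> norm (f x - f y) * norm (g x) + norm (f y) * norm (g x - g y)"
      by (intro add_mono) (simp_all add: Cauchy_Schwarz_ineq2)
    also have "\<dots> \<le> norm (f x - f y) * B + A * norm (g x - g y)"
      using A B xy by (intro add_mono mult_left_mono mult_right_mono) auto
    finally show "norm (f x \<bullet> g x - f y \<bullet> g y) \<le> B * norm (f x - f y) + A * norm (g x - g y)"
      by (simp add: mult.commute)
  qed (use A B in auto)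
qed

lemma vector_derivative_bound_lipschitz:
  fixes f :: "real \<Rightarrow> 'a::real_inner"
  assumes "convex S" "\<And>x. x \<in> S \<Longrightarrow> (f has_vector_derivative f' x) (at x within S)" "\<And>x. x \<in> S \<Longrightarrow> norm (f' x) \<le> L"
    "x \<in> S" "y \<in> S"
  shows "norm (f x - f y) \<le> L * \<bar>x - y\<bar>"
proof -
  have "norm (f x - f y) \<le> L * norm (x - y)"
  proof (rule differentiable_bound[OF assms(1) _ _ assms(4,5)])
    show "(f has_derivative (\<lambda>h. h *\<^sub>R f' x)) (at x within S)" if "x \<in> S" for x
      using assms(2)[OF that] by (simp add: has_vector_derivative_def)
    show "onorm (\<lambda>h. h *\<^sub>R f' x) \<le> L" if "x \<in> S" for x
      using assms(3)[OF that] by (simp add: onorm_scaleR_left onorm_id)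
  qed
  then show ?thesis by simp
qed

lemma C1_ac_on:
  fixes f :: "real \<Rightarrow> 'a::real_inner"
  assumes "\<And>x. x \<in> {a..b} \<Longrightarrow> (f has_vector_derivative f' x) (at x)" "continuous_on {a..b} f'"
  shows "ac_on {a..b} f"
proof -
  have "bounded (f' ` {a..b})"
    using assms(2) by (intro compact_imp_bounded compact_continuous_image) auto
  then obtain L where L: "\<And>x. x \<in> {a..b} \<Longrightarrow> norm (f' x) \<le> L" unfolding bounded_iff by blast
  then show ?thesis
  proof (intro lipschitz_ac_on)
    fix x y assume "x \<in> {a..b}" "y \<in> {a..b}"
    then show "norm (f x - f y) \<le> L * \<bar>x - y\<bar>"
      using assms(1) L
      by (intro vector_derivative_bound_lipschitz[where S = "{a..b}" and f' = f'])
        (auto intro: has_vector_derivative_at_within)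
  qed
qed

lemma ac_on_subset: "ac_on S f \<Longrightarrow> T \<subseteq> S \<Longrightarrow> ac_on T f"
  unfolding ac_on_def by (meson order_trans)

text \<open>The integrand of \<open>BL_norm\<close> for \<open>c = k\<^sup>2\<close>. The
  derivatives are separate arguments, so that polarisation is pointwise algebra and the second
  derivative of \<open>h\<close> can be taken as \<open>g2 - s2\<close> even where a derivative
  fails to exist.\<close>

definition energy_density :: "real \<Rightarrow> (real \<Rightarrow> complex) \<Rightarrow> (real \<Rightarrow> complex) \<Rightarrow> (real \<Rightarrow> complex) \<Rightarrow> real \<Rightarrow> real" where
  "energy_density c f f1 f2 r =
     ((cmod (f2 r))\<^sup>2 + 2 * c * (cmod (f r /\<^sub>R r\<^sup>2 - f1 r /\<^sub>R r))\<^sup>2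
      + (cmod (c *\<^sub>R (f r /\<^sub>R r\<^sup>2) - f1 r /\<^sub>R r))\<^sup>2) * r"

text \<open>
  The coefficients of \<open>h'\<close> and \<open>h\<close> in the polarised energy density at \<open>s\<close>, with \<open>c = k\<^sup>2\<close>. The
  Euler-Lagrange equation \<open>(r s'')'' - flux1' + flux0 = 0\<close> is \<open>L\<^sub>k s = 0\<close>; below, \<open>W\<close> stands for
  \<open>flux1 - (r s'')'\<close>, so that \<open>r s'' \<bullet> h' + W \<bullet> h\<close> is a primitive of the polarised density.
\<close>

definition flux1 :: "real \<Rightarrow> (real \<Rightarrow> complex) \<Rightarrow> (real \<Rightarrow> complex) \<Rightarrow> real \<Rightarrow> complex" where
  "flux1 c s s1 r = ((2 * c + 1) / r) *\<^sub>R s1 r - (3 * c / r\<^sup>2) *\<^sub>R s r"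

definition flux0 :: "real \<Rightarrow> (real \<Rightarrow> complex) \<Rightarrow> (real \<Rightarrow> complex) \<Rightarrow> real \<Rightarrow> complex" where
  "flux0 c s s1 r = ((2 * c + c\<^sup>2) / r ^ 3) *\<^sub>R s r - (3 * c / r\<^sup>2) *\<^sub>R s1 r"

text \<open>Collected by \<open>h2\<close>, \<open>h1\<close> and \<open>h\<close>, the form from
  which integration by parts is read off. The inner product of complex numbers is the real part of
  the Hermitian one, so cross terms are real.\<close>

definition cross_density where
  "cross_density c s s1 s2 h h1 h2 r =
     (r *\<^sub>R s2 r) \<bullet> h2 r + flux1 c s s1 r \<bullet> h1 r + flux0 c s s1 r \<bullet> h r"

lemma energy_density_add:
  assumes "r \<noteq> 0"
  shows "energy_density c (\<lambda>x. s x + h x) (\<lambda>x. s1 x + h1 x) (\<lambda>x. s2 x + h2 x) r =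
    energy_density c s s1 s2 r + energy_density c h h1 h2 r + 2 * cross_density c s s1 s2 h h1 h2 r"
proof -
  have polar: "(cmod (u + v))\<^sup>2 = (cmod u)\<^sup>2 + (cmod v)\<^sup>2 + 2 * (u \<bullet> v)" for u v :: complex
    by (simp add: power2_norm_eq_inner inner_add_left inner_add_right inner_commute)
  have split: "(s r + h r) /\<^sub>R r\<^sup>2 - (s1 r + h1 r) /\<^sub>R r = (s r /\<^sub>R r\<^sup>2 - s1 r /\<^sub>R r) + (h r /\<^sub>R r\<^sup>2 - h1 r /\<^sub>R r)"
    "c *\<^sub>R ((s r + h r) /\<^sub>R r\<^sup>2) - (s1 r + h1 r) /\<^sub>R r
      = (c *\<^sub>R (s r /\<^sub>R r\<^sup>2) - s1 r /\<^sub>R r) + (c *\<^sub>R (h r /\<^sub>R r\<^sup>2) - h1 r /\<^sub>R r)"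
    by (simp_all add: scaleR_add_right)
  \<comment> \<open>Collecting terms explains the flux coefficients: \<open>2 * c + 1\<close> and
    \<open>2 * c + c\<^sup>2\<close> come from equal factors, \<open>3 * c\<close> is
    \<open>2 * c + c\<close> from the mixed products.\<close>
  have "r * (s2 r \<bullet> h2 r + 2 * c * ((s r /\<^sub>R r\<^sup>2 - s1 r /\<^sub>R r) \<bullet> (h r /\<^sub>R r\<^sup>2 - h1 r /\<^sub>R r))
     + (c *\<^sub>R (s r /\<^sub>R r\<^sup>2) - s1 r /\<^sub>R r) \<bullet> (c *\<^sub>R (h r /\<^sub>R r\<^sup>2) - h1 r /\<^sub>R r))
     = cross_density c s s1 s2 h h1 h2 r"
    using assms unfolding cross_density_def flux0_def flux1_def
    by (simp add: inner_diff_left inner_diff_right inner_commute)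
      (simp add: field_simps power2_eq_square power3_eq_cube)
  then show ?thesis
    unfolding energy_density_def split polar by (simp add: algebra_simps)
qed

lemma energy_density_nonneg: "0 \<le> c \<Longrightarrow> 0 \<le> r \<Longrightarrow> 0 \<le> energy_density c f f1 f2 r"
  unfolding energy_density_def by simp

text \<open>On compact subintervals of the open interval the primitive is absolutely continuous and
  \<open>ac_on_has_integral\<close> applies. At an endpoint that is a knot the value of
  \<open>W\<close> is arbitrary; but \<open>W\<close> is Lipschitz inside, hence bounded, so
  \<open>W \<bullet> h\<close> tends to 0 where \<open>h\<close> vanishes and the identity extends
  by continuity.\<close>

lemma cross_density_has_integral:
  fixes s s1 s2 W h h1 h2 :: "real \<Rightarrow> complex"
  assumes uv: "0 < u" "u < v"
    and s0: "continuous_on {u..v} s" "continuous_on {u..v} s1" "continuous_on {u..v} s2"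
    and s1: "\<And>x. x \<in> {u<..<v} \<Longrightarrow> (s has_vector_derivative s1 x) (at x)"
    and s2: "\<And>x. x \<in> {u<..<v} \<Longrightarrow> (s1 has_vector_derivative s2 x) (at x)"
    and s3: "\<And>x. x \<in> {u<..<v} \<Longrightarrow> ((\<lambda>x. x *\<^sub>R s2 x) has_vector_derivative flux1 c s s1 x - W x) (at x)"
    and W: "\<And>x. x \<in> {u<..<v} \<Longrightarrow> (W has_vector_derivative flux0 c s s1 x) (at x)"
    and h1: "\<And>x. x \<in> {u..v} \<Longrightarrow> (h has_vector_derivative h1 x) (at x)"
    and ac: "ac_on {u..v} h1" and cont_h1: "continuous_on {u..v} h1"
    and N: "negligible N" "\<And>x. x \<in> {u<..<v} - N \<Longrightarrow> (h1 has_vector_derivative h2 x) (at x)"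
    and h2: "h2 absolutely_integrable_on {u..v}"
    and left: "h u = 0 \<or> isCont W u" and right: "h v = 0 \<or> isCont W v"
  shows "(cross_density c s s1 s2 h h1 h2 has_integral
    ((v *\<^sub>R s2 v) \<bullet> h1 v + W v \<bullet> h v) - ((u *\<^sub>R s2 u) \<bullet> h1 u + W u \<bullet> h u)) {u..v}"
proof -
  define F where "F = cross_density c s s1 s2 h h1 h2"
  define P where "P x = (x *\<^sub>R s2 x) \<bullet> h1 x + W x \<bullet> h x" for x
  have cont_h: "continuous_on {u..v} h"
    by (intro continuous_at_imp_continuous_on ballI has_vector_derivative_continuous[OF h1])
  have cont_fl: "continuous_on {u..v} (flux1 c s s1)" "continuous_on {u..v} (flux0 c s s1)"
    unfolding flux1_def flux0_def using uv s0 by (auto intro!: continuous_intros)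
  have cont_W: "continuous_on {u<..<v} W"
    by (intro continuous_at_imp_continuous_on ballI has_vector_derivative_continuous[OF W])
  have "(\<lambda>x. (x *\<^sub>R s2 x) \<bullet> h2 x) absolutely_integrable_on {u..v}"
  proof (rule absolutely_integrable_bounded_measurable_product[where h = "(\<bullet>)" and f = "\<lambda>x. x *\<^sub>R s2 x", OF _ _ _ _ h2])
    show "bilinear ((\<bullet>) :: complex \<Rightarrow> complex \<Rightarrow> real)" by (simp add: bilinear_conv_bounded_bilinear bounded_bilinear_inner)
    have c: "continuous_on {u..v} (\<lambda>x. x *\<^sub>R s2 x)" using s0 by (auto intro!: continuous_intros)
    show "bounded ((\<lambda>x. x *\<^sub>R s2 x) ` {u..v})"
      using c by (intro compact_imp_bounded compact_continuous_image) auto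
    show "(\<lambda>x. x *\<^sub>R s2 x) \<in> borel_measurable (lebesgue_on {u..v})"
      using c by (intro continuous_imp_measurable_on_sets_lebesgue) auto
  qed auto
  then have int1: "(\<lambda>x. (x *\<^sub>R s2 x) \<bullet> h2 x) integrable_on {u..v}"
    using absolutely_integrable_on_def by blast
  have "(\<lambda>x. flux1 c s s1 x \<bullet> h1 x + flux0 c s s1 x \<bullet> h x) integrable_on {u..v}"
    using cont_fl cont_h1 cont_h by (intro integrable_continuous_interval continuous_intros)
  from integrable_add[OF int1 this] have F_int: "F integrable_on {u..v}"
    unfolding F_def cross_density_def by (simp add: add.assoc)
  obtain L where L: "\<And>x. x \<in> {u..v} \<Longrightarrow> norm (flux0 c s s1 x) \<le> L"
    using compact_imp_bounded[OF compact_continuous_image[OF cont_fl(2)]] unfolding bounded_iff by blast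
  define z where "z = (u + v) / 2"
  have z: "z \<in> {u<..<v}" using uv unfolding z_def by auto
  have W_bd: "norm (W x) \<le> norm (W z) + \<bar>L\<bar> * (v - u)" if x: "x \<in> {u<..<v}" for x
  proof -
    have "norm (W x - W z) \<le> \<bar>L\<bar> * \<bar>x - z\<bar>"
    proof (rule vector_derivative_bound_lipschitz[OF _ _ _ x z])
      show "(W has_vector_derivative flux0 c s s1 x) (at x within {u<..<v})" if "x \<in> {u<..<v}" for x
        using W[OF that] by (rule has_vector_derivative_at_within)
      show "norm (flux0 c s s1 x) \<le> \<bar>L\<bar>" if "x \<in> {u<..<v}" for x
        using L[of x] that by auto
    qed simp
    also have "\<dots> \<le> \<bar>L\<bar> * (v - u)" using x z by (intro mult_left_mono) auto
    finally show ?thesis using norm_triangle_ineq2[of "W x" "W z"] by simp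
  qed
  have end_cont: "continuous (at w within {u..v}) (\<lambda>x. W x \<bullet> h x)"
    if w: "w \<in> {u, v}" and or: "h w = 0 \<or> isCont W w" for w
  proof -
    have wuv: "w \<in> {u..v}" using w uv by auto
    have hw: "continuous (at w within {u..v}) h" using cont_h wuv by (simp add: continuous_on_eq_continuous_within)
    show ?thesis
    proof (cases "isCont W w")
      case True
      then show ?thesis using hw by (intro continuous_intros) (rule continuous_at_imp_continuous_at_within)
    next
      case False
      then have "h w = 0" using or by simp
      \<comment> \<open>The last two summands cover the values of \<open>W\<close> at the endpoints,
        which the Lipschitz bound does not reach.\<close>
      define M where "M = norm (W z) + \<bar>L\<bar> * (v - u) + norm (W u) + norm (W v)"
      have M: "norm (W x) \<le> M" if "x \<in> {u..v}" for x
      proof -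
        have "x \<in> {u<..<v} \<or> x = u \<or> x = v" using that by auto
        moreover have "0 \<le> \<bar>L\<bar> * (v - u)" using uv by simp
        ultimately show ?thesis
          using W_bd[of x] unfolding M_def
          by (smt (verit, best) norm_ge_zero)
      qed
      have "(h \<longlongrightarrow> 0) (at w within {u..v})" using hw \<open>h w = 0\<close> by (simp add: continuous_within)
      then have "((\<lambda>x. M * norm (h x)) \<longlongrightarrow> 0) (at w within {u..v})"
        by (auto intro!: tendsto_eq_intros)
      then have "((\<lambda>x. W x \<bullet> h x) \<longlongrightarrow> 0) (at w within {u..v})"
      proof (rule Lim_null_comparison[rotated])
        have "norm (W x \<bullet> h x) \<le> M * norm (h x)" if "x \<in> {u..v}" for x
        proof -
          have "norm (W x \<bullet> h x) \<le> norm (W x) * norm (h x)" by (simp add: Cauchy_Schwarz_ineq2)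
          also have "\<dots> \<le> M * norm (h x)" using M[OF that] by (intro mult_right_mono) auto
          finally show ?thesis .
        qed
        then show "\<forall>\<^sub>F x in at w within {u..v}. norm (W x \<bullet> h x) \<le> M * norm (h x)"
          by (auto simp: eventually_at_filter)
      qed
      then show ?thesis using \<open>h w = 0\<close> by (simp add: continuous_within)
    qed
  qed
  have cont_P: "continuous_on {u..v} P"
  proof -
    have "continuous (at x within {u..v}) (\<lambda>x. W x \<bullet> h x)" if x: "x \<in> {u..v}" for x
    proof -
      consider "x = u" | "x = v" | "x \<in> {u<..<v}" using x by fastforce
      then show ?thesis
      proof cases
        case 3
        have "isCont h x" using h1[OF x] by (rule has_vector_derivative_continuous)
        moreover have "isCont W x" using W[OF 3] by (rule has_vector_derivative_continuous)
        ultimately have "isCont (\<lambda>x. W x \<bullet> h x) x" by (intro continuous_intros)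
        then show ?thesis by (rule continuous_at_imp_continuous_at_within)
      qed (use end_cont left right in auto)
    qed
    then have "continuous_on {u..v} (\<lambda>x. W x \<bullet> h x)" by (simp add: continuous_on_eq_continuous_within)
    moreover have "continuous_on {u..v} (\<lambda>x. (x *\<^sub>R s2 x) \<bullet> h1 x)"
      using s0 cont_h1 by (intro continuous_intros)
    ultimately show ?thesis unfolding P_def by (intro continuous_on_add)
  qed
  have inner_int: "(F has_integral (P q - P p)) {p..q}" if pq: "u < p" "p \<le> q" "q < v" for p q
  proof (rule ac_on_has_integral[OF pq(2) _ N(1)])
    have sub: "{p..q} \<subseteq> {u<..<v}" "{p..q} \<subseteq> {u..v}" using pq by auto
    have cT: "continuous_on {p..q} (\<lambda>x. flux1 c s s1 x - W x)"
      using continuous_on_subset[OF cont_fl(1) sub(2)] continuous_on_subset[OF cont_W sub(1)]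
      by (intro continuous_intros)
    have bnd: "bounded (f ` {p..q})" if "continuous_on {p..q} f" for f :: "real \<Rightarrow> complex"
      using that by (intro compact_imp_bounded compact_continuous_image) auto
    have a1: "ac_on {p..q} (\<lambda>x. (x *\<^sub>R s2 x) \<bullet> h1 x)"
    proof (rule ac_on_inner)
      show "ac_on {p..q} (\<lambda>x. x *\<^sub>R s2 x)"
        using s3 sub(1) cT by (intro C1_ac_on) auto
      show "ac_on {p..q} h1" using ac sub(2) by (rule ac_on_subset)
      show "bounded ((\<lambda>x. x *\<^sub>R s2 x) ` {p..q})"
        using continuous_on_subset[OF s0(3) sub(2)] by (intro bnd continuous_intros)
      show "bounded (h1 ` {p..q})" using continuous_on_subset[OF cont_h1 sub(2)] by (rule bnd)
    qed
    have a2: "ac_on {p..q} (\<lambda>x. W x \<bullet> h x)"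
    proof (rule ac_on_inner)
      show "ac_on {p..q} W"
        using W sub(1) continuous_on_subset[OF cont_fl(2) sub(2)] by (intro C1_ac_on) auto
      show "ac_on {p..q} h"
        using h1 sub(2) continuous_on_subset[OF cont_h1 sub(2)] by (intro C1_ac_on) auto
      show "bounded (W ` {p..q})" using continuous_on_subset[OF cont_W sub(1)] by (rule bnd)
      show "bounded (h ` {p..q})" using continuous_on_subset[OF cont_h sub(2)] by (rule bnd)
    qed
    show "ac_on {p..q} P"
      unfolding P_def
      by (rule ac_on_dominated[OF a1 a2, where A = 1 and B = 1]) auto
    fix x assume "x \<in> {p..q} - N"
    then have x: "x \<in> {u<..<v}" "x \<in> {u..v}" "x \<in> {u<..<v} - N" using sub by auto
    have "(P has_vector_derivative
      ((x *\<^sub>R s2 x) \<bullet> h2 x + (flux1 c s s1 x - W x) \<bullet> h1 x) + (W x \<bullet> h1 x + flux0 c s s1 x \<bullet> h x)) (at x)"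
      unfolding P_def
      using bounded_bilinear.has_vector_derivative[OF bounded_bilinear_inner s3[OF x(1)] N(2)[OF x(3)]]
        bounded_bilinear.has_vector_derivative[OF bounded_bilinear_inner W[OF x(1)] h1[OF x(2)]]
      by (intro has_vector_derivative_add)
    then have "(P has_vector_derivative F x) (at x)"
      unfolding F_def cross_density_def by (simp add: inner_diff_left algebra_simps)
    then show "(P has_vector_derivative F x) (at x within {p..q})"
      by (rule has_vector_derivative_at_within)
  qed
  \<comment> \<open>Constant inside by the previous step and continuous up to the endpoints, hence
    constant throughout. The continuity rests on \<open>F_int\<close>, integrability on all of
    \<open>{u..v}\<close>.\<close>
  define D where "D x = P x - integral {u..x} F" for x
  have cont_D: "continuous_on {u..v} D"
    unfolding D_def using cont_P indefinite_integral_continuous_1[OF F_int] by (intro continuous_intros)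
  have D_const: "D q = D p" if pq: "u < p" "p \<le> q" "q < v" for p q
  proof -
    have "integral {u..p} F + integral {p..q} F = integral {u..q} F"
      using pq by (intro Henstock_Kurzweil_Integration.integral_combine integrable_subinterval_real[OF F_int]) auto
    then show ?thesis using integral_unique[OF inner_int[OF pq]] unfolding D_def by simp
  qed
  have Dz: "D x = D z" if "x \<in> {u<..<v}" for x
    using D_const[of x z] D_const[of z x] that z by (cases "x \<le> z") auto
  have cl: "closure {u<..<v} = {u..v}" using uv by simp
  have "D u = D z" "D v = D z"
    using continuous_constant_on_closure[of "{u<..<v}" D "D z"] cont_D Dz uv unfolding cl by auto
  then have "integral {u..v} F = P v - P u" unfolding D_def by simp
  then show ?thesis using F_int has_integral_integral unfolding F_def P_def by metis
qed


section \<open>The end intervals\<close>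

text \<open>The indicial roots are \<open>a\<close> and \<open>a + 2\<close>. Reduction of order: a
  weighted \<open>s1 - (a / x) *\<^sub>R s\<close> is constant, which leaves a first-order equation
  for \<open>s\<close>.\<close>

lemma euler_ode_solution:
  fixes s s1 s2 :: "real \<Rightarrow> complex"
  assumes I: "open I" "convex I" "I \<subseteq> {0<..}"
    and s1: "\<And>x. x \<in> I \<Longrightarrow> (s has_vector_derivative s1 x) (at x)"
    and s2: "\<And>x. x \<in> I \<Longrightarrow> (s1 has_vector_derivative s2 x) (at x)"
    and ode: "\<And>x. x \<in> I \<Longrightarrow> s2 x = ((2 * a + 1) / x) *\<^sub>R s1 x - (a * (a + 2) / x\<^sup>2) *\<^sub>R s x"
  obtains c1 c2 where
    "\<And>x. x \<in> I \<Longrightarrow> s x = x powr a *\<^sub>R c1 + x powr (a + 2) *\<^sub>R c2"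
    "\<And>x. x \<in> I \<Longrightarrow> s1 x = (a * x powr (a - 1)) *\<^sub>R c1 + ((a + 2) * x powr (a + 1)) *\<^sub>R c2"
proof -
  have zero_const: "\<exists>c. \<forall>x\<in>I. f x = c" if "\<And>x. x \<in> I \<Longrightarrow> (f has_vector_derivative 0) (at x)" for f :: "real \<Rightarrow> complex"
    using that has_vector_derivative_zero_constant[OF I(2), of f] by (metis has_vector_derivative_at_within)
  have pw: "((\<lambda>x. x powr p) has_vector_derivative p * x powr (p - 1)) (at x)" if "x \<in> I" for x p
    using that I(3)
    by (auto intro!: derivative_eq_intros simp: has_real_derivative_iff_has_vector_derivative[symmetric])
  have pws: "x powr (p - 1) = x powr p / x" "x powr (p + 1) = x powr p * x" "x powr (p + 2) = x powr p * x\<^sup>2"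
    if "x \<in> I" for x p
    using that I(3) by (auto simp: powr_diff powr_add powr_numeral)
  \<comment> \<open>On \<open>x powr a *\<^sub>R c1 + x powr (a + 2) *\<^sub>R c2\<close> this
    combination equals \<open>2 *\<^sub>R c2\<close>.\<close>
  define q where "q x = x powr (- a - 1) *\<^sub>R s1 x - (a * x powr (- a - 2)) *\<^sub>R s x" for x
  have "(q has_vector_derivative 0) (at x)" if x: "x \<in> I" for x
  proof -
    have x0: "0 < x" using x I(3) by auto
    have "(q has_vector_derivative
       (x powr (- a - 1) *\<^sub>R s2 x + ((- a - 1) * x powr (- a - 1 - 1)) *\<^sub>R s1 x)
       - ((a * x powr (- a - 2)) *\<^sub>R s1 x + (a * ((- a - 2) * x powr (- a - 2 - 1))) *\<^sub>R s x)) (at x)"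
      unfolding q_def
      by (intro has_vector_derivative_diff has_vector_derivative_scaleR has_vector_derivative_mult_right
          pw[OF x] s1[OF x] s2[OF x] has_real_derivative_iff_has_vector_derivative[THEN iffD2])
    moreover have "(x powr (- a - 1) *\<^sub>R s2 x + ((- a - 1) * x powr (- a - 1 - 1)) *\<^sub>R s1 x)
       - ((a * x powr (- a - 2)) *\<^sub>R s1 x + (a * ((- a - 2) * x powr (- a - 2 - 1))) *\<^sub>R s x) = 0"
    proof -
      have e: "- a - 1 - 1 = - a - 2" "- a - 2 - 1 = - a - 3" by simp_all
      have p: "x powr (- a - 1) = x powr (- a) / x" "x powr (- a - 2) = x powr (- a) / x\<^sup>2"
        "x powr (- a - 3) = x powr (- a) / x ^ 3"
        unfolding powr_diff using x0 by (simp_all add: powr_numeral)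
      show ?thesis
        unfolding e p ode[OF x] using x0
        by (simp add: complex_eq_iff field_simps power2_eq_square power3_eq_cube)
    qed
    ultimately show ?thesis by simp
  qed
  then obtain c where c: "\<And>x. x \<in> I \<Longrightarrow> q x = c" using zero_const by blast
  \<comment> \<open>Removing the part already found leaves the coefficient of
    \<open>x powr a\<close>.\<close>
  define v where "v x = x powr (- a) *\<^sub>R s x - (x\<^sup>2 / 2) *\<^sub>R c" for x
  have s1_eq: "s1 x = (a / x) *\<^sub>R s x + (x powr (a + 1)) *\<^sub>R c" if x: "x \<in> I" for x
  proof -
    have x0: "0 < x" using x I(3) by auto
    have "x powr (a + 1) *\<^sub>R q x = s1 x - (a / x) *\<^sub>R s x"
      unfolding q_def using x0
      by (simp add: scaleR_diff_right powr_add[symmetric] mult.left_commute)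
    then show ?thesis using c[OF x] by simp
  qed
  have "(v has_vector_derivative 0) (at x)" if x: "x \<in> I" for x
  proof -
    have x0: "0 < x" using x I(3) by auto
    have "((\<lambda>x. x\<^sup>2 / 2) has_real_derivative x) (at x)"
      by (auto intro!: derivative_eq_intros)
    then have "((\<lambda>x. x\<^sup>2 / 2) has_vector_derivative x) (at x)"
      by (simp only: has_real_derivative_iff_has_vector_derivative)
    then have "(v has_vector_derivative
       (x powr (- a) *\<^sub>R s1 x + (- a * x powr (- a - 1)) *\<^sub>R s x) - ((x\<^sup>2 / 2) *\<^sub>R 0 + x *\<^sub>R c)) (at x)"
      unfolding v_def
      by (intro has_vector_derivative_diff has_vector_derivative_scaleR has_vector_derivative_const
          pw[OF x] s1[OF x] has_real_derivative_iff_has_vector_derivative[THEN iffD2])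
    moreover have "x powr (- a) *\<^sub>R s1 x = (a * x powr (- a - 1)) *\<^sub>R s x + x *\<^sub>R c"
      unfolding s1_eq[OF x] using x0
      by (simp add: scaleR_add_right powr_add[symmetric] powr_diff)
    ultimately show ?thesis by (simp add: scaleR_add_left[symmetric])
  qed
  then obtain d where d: "\<And>x. x \<in> I \<Longrightarrow> v x = d" using zero_const by blast
  have s_eq: "s x = x powr a *\<^sub>R d + x powr (a + 2) *\<^sub>R (c /\<^sub>R 2)" if x: "x \<in> I" for x
  proof -
    have x0: "0 < x" using x I(3) by auto
    have "x powr a *\<^sub>R v x = s x - (x powr (a + 2) / 2) *\<^sub>R c"
      unfolding v_def using x0 by (simp add: scaleR_diff_right powr_add[symmetric] pws(3)[OF x])
    then show ?thesis using d[OF x] by simp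
  qed
  show ?thesis
  proof (rule that[OF s_eq])
    fix x assume x: "x \<in> I"
    then have x0: "0 < x" using I(3) by auto
    show "s1 x = (a * x powr (a - 1)) *\<^sub>R d + ((a + 2) * x powr (a + 1)) *\<^sub>R (c /\<^sub>R 2)"
      unfolding s1_eq[OF x] s_eq[OF x] pws[OF x] using x0
      by (simp add: scaleR_add_right complex_eq_iff field_simps power2_eq_square)
  qed
qed

text \<open>
  The value of \<open>W\<close> on the end intervals, where \<open>s\<close> is a combination of \<open>r\<^sup>a\<close> and \<open>r\<^sup>a\<^sup>+\<^sup>2\<close>:
  \<open>a = \<bar>k\<bar>\<close> is the equation \<open>G\<^sub>k s = 0\<close> and \<open>a = -\<bar>k\<bar>\<close> is \<open>R\<^sub>k s = 0\<close>.
\<close>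

definition end_flux :: "real \<Rightarrow> (real \<Rightarrow> complex) \<Rightarrow> (real \<Rightarrow> complex) \<Rightarrow> real \<Rightarrow> complex" where
  "end_flux a s s1 x = (a\<^sup>2 * (2 * a + 1) / x\<^sup>2) *\<^sub>R s x - (a * (a + 2) / x) *\<^sub>R s1 x"

text \<open>
  For \<open>c = 1\<close> the space \<open>\<Lambda>\<^sub>1\<close> controls only \<open>f' - f / r\<close>. This suffices because there
  \<open>W = - s''\<close> on the end intervals, so that the boundary term is \<open>r s'' \<bullet> (h' - h / r)\<close>.
\<close>

definition end_size :: "real \<Rightarrow> (real \<Rightarrow> complex) \<Rightarrow> (real \<Rightarrow> complex) \<Rightarrow> real \<Rightarrow> real" where
  "end_size c f f1 x = (if c = 1 then norm (f1 x - f x /\<^sub>R x) else norm (f1 x) + norm (f x) / x)"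

lemma rdiv_deriv:
  fixes f :: "real \<Rightarrow> complex"
  assumes "x \<noteq> 0" "(f has_vector_derivative f') (at x)"
  shows "((\<lambda>x. (p / x) *\<^sub>R f x) has_vector_derivative ((p / x) *\<^sub>R f' - (p / x\<^sup>2) *\<^sub>R f x)) (at x)"
    and "((\<lambda>x. (p / x\<^sup>2) *\<^sub>R f x) has_vector_derivative ((p / x\<^sup>2) *\<^sub>R f' - (2 * p / x ^ 3) *\<^sub>R f x)) (at x)"
proof -
  have "((\<lambda>x. p / x) has_real_derivative (- p / x\<^sup>2)) (at x)"
    using assms(1) by (auto intro!: derivative_eq_intros simp: field_simps power2_eq_square)
  from has_vector_derivative_scaleR[OF this assms(2)]
  show "((\<lambda>x. (p / x) *\<^sub>R f x) has_vector_derivative ((p / x) *\<^sub>R f' - (p / x\<^sup>2) *\<^sub>R f x)) (at x)" by simp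
  have "((\<lambda>x. p / x\<^sup>2) has_real_derivative (- (2 * p / x ^ 3))) (at x)"
    using assms(1) by (auto intro!: derivative_eq_intros simp: field_simps power2_eq_square power3_eq_cube)
  from has_vector_derivative_scaleR[OF this assms(2)]
  show "((\<lambda>x. (p / x\<^sup>2) *\<^sub>R f x) has_vector_derivative ((p / x\<^sup>2) *\<^sub>R f' - (2 * p / x ^ 3) *\<^sub>R f x)) (at x)" by simp
qed

text \<open>Only two derivatives are given on an end interval. Multiplied by \<open>x\<close>, the
  equation expresses \<open>x *\<^sub>R s2 x\<close> through \<open>s\<close> and \<open>s1\<close>,
  so it can be differentiated once more; eliminating \<open>s2\<close> from \<open>flux1\<close>
  minus that derivative yields exactly \<open>end_flux\<close>.\<close>

lemma end_flux_derivatives: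
  fixes s s1 s2 :: "real \<Rightarrow> complex"
  assumes "open I" "x \<in> I" "0 \<notin> I" 
    and s1: "(s has_vector_derivative s1 x) (at x)"
    and s2: "(s1 has_vector_derivative s2 x) (at x)"
    and ode: "\<And>x. x \<in> I \<Longrightarrow> s2 x = ((2 * a + 1) / x) *\<^sub>R s1 x - (a * (a + 2) / x\<^sup>2) *\<^sub>R s x"
  shows "((\<lambda>x. x *\<^sub>R s2 x) has_vector_derivative flux1 (a\<^sup>2) s s1 x - end_flux a s s1 x) (at x)"
    and "(end_flux a s s1 has_vector_derivative flux0 (a\<^sup>2) s s1 x) (at x)"
    and "isCont s2 x"
proof -
  have x: "x \<noteq> 0" using assms(2,3) by auto
  note d = rdiv_deriv[OF x]
  have "((\<lambda>x. (2 * a + 1) *\<^sub>R s1 x - (a * (a + 2) / x) *\<^sub>R s x) has_vector_derivative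
      (2 * a + 1) *\<^sub>R s2 x - ((a * (a + 2) / x) *\<^sub>R s1 x - (a * (a + 2) / x\<^sup>2) *\<^sub>R s x)) (at x)"
    by (intro has_vector_derivative_diff d(1) s1 bounded_linear.has_vector_derivative[OF bounded_linear_scaleR_right] s2)
  moreover have "(2 * a + 1) *\<^sub>R s2 x - ((a * (a + 2) / x) *\<^sub>R s1 x - (a * (a + 2) / x\<^sup>2) *\<^sub>R s x)
      = flux1 (a\<^sup>2) s s1 x - end_flux a s s1 x"
    unfolding ode[OF assms(2)] flux1_def end_flux_def using x
    by (simp add: complex_eq_iff field_simps power2_eq_square)
  ultimately have D: "((\<lambda>x. (2 * a + 1) *\<^sub>R s1 x - (a * (a + 2) / x) *\<^sub>R s x) has_vector_derivative
      flux1 (a\<^sup>2) s s1 x - end_flux a s s1 x) (at x)" by simp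
  have eq: "(2 * a + 1) *\<^sub>R s1 y - (a * (a + 2) / y) *\<^sub>R s y = y *\<^sub>R s2 y" if "y \<in> I" for y
    unfolding ode[OF that] using that assms(3) by (auto simp: scaleR_diff_right power2_eq_square)
  show "((\<lambda>x. x *\<^sub>R s2 x) has_vector_derivative flux1 (a\<^sup>2) s s1 x - end_flux a s s1 x) (at x)"
    by (rule has_vector_derivative_transform_within_open[OF D assms(1,2) eq])
  have "(end_flux a s s1 has_vector_derivative
     ((a\<^sup>2 * (2 * a + 1) / x\<^sup>2) *\<^sub>R s1 x - (2 * (a\<^sup>2 * (2 * a + 1)) / x ^ 3) *\<^sub>R s x)
     - ((a * (a + 2) / x) *\<^sub>R s2 x - (a * (a + 2) / x\<^sup>2) *\<^sub>R s1 x)) (at x)"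
    unfolding end_flux_def by (intro has_vector_derivative_diff d s1 s2)
  moreover have "((a\<^sup>2 * (2 * a + 1) / x\<^sup>2) *\<^sub>R s1 x - (2 * (a\<^sup>2 * (2 * a + 1)) / x ^ 3) *\<^sub>R s x)
     - ((a * (a + 2) / x) *\<^sub>R s2 x - (a * (a + 2) / x\<^sup>2) *\<^sub>R s1 x) = flux0 (a\<^sup>2) s s1 x"
    unfolding ode[OF assms(2)] flux0_def using x
    by (simp add: complex_eq_iff field_simps power2_eq_square power3_eq_cube)
  ultimately show "(end_flux a s s1 has_vector_derivative flux0 (a\<^sup>2) s s1 x) (at x)" by simp
  have "isCont (\<lambda>x. ((2 * a + 1) / x) *\<^sub>R s1 x - (a * (a + 2) / x\<^sup>2) *\<^sub>R s x) x"
    using x by (intro continuous_intros has_vector_derivative_continuous[OF s1] has_vector_derivative_continuous[OF s2]) auto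
  moreover have "\<forall>\<^sub>F y in nhds x. s2 y = ((2 * a + 1) / y) *\<^sub>R s1 y - (a * (a + 2) / y\<^sup>2) *\<^sub>R s y"
    using eventually_nhds_in_open[OF assms(1,2)] ode by (rule eventually_mono)
  ultimately show "isCont s2 x" by (simp add: isCont_cong)
qed

lemma end_boundary_term_le:
  fixes s s1 s2 h h1 :: "real \<Rightarrow> complex"
  assumes "0 < x"
    and ode: "s2 x = ((2 * a + 1) / x) *\<^sub>R s1 x - (a * (a + 2) / x\<^sup>2) *\<^sub>R s x"
  shows "\<bar>(x *\<^sub>R s2 x) \<bullet> h1 x + end_flux a s s1 x \<bullet> h x\<bar>
    \<le> (\<bar>2 * a + 1\<bar> + \<bar>a * (a + 2)\<bar> + a\<^sup>2 * \<bar>2 * a + 1\<bar> + 1) * end_size (a\<^sup>2) s s1 x * end_size (a\<^sup>2) h h1 x"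
proof -
  \<comment> \<open>Dominates the coefficients of \<open>x *\<^sub>R s2 x\<close> and of
    \<open>end_flux\<close> once the equation has eliminated \<open>s2\<close>.\<close>
  define C where "C = \<bar>2 * a + 1\<bar> + \<bar>a * (a + 2)\<bar> + a\<^sup>2 * \<bar>2 * a + 1\<bar> + 1"
  have xs2: "x *\<^sub>R s2 x = (2 * a + 1) *\<^sub>R s1 x - (a * (a + 2)) *\<^sub>R (s x /\<^sub>R x)"
    unfolding ode using assms(1) by (simp add: complex_eq_iff field_simps power2_eq_square)
  have xW: "end_flux a s s1 x = (1 / x) *\<^sub>R ((a\<^sup>2 * (2 * a + 1)) *\<^sub>R (s x /\<^sub>R x) - (a * (a + 2)) *\<^sub>R s1 x)"
    unfolding end_flux_def using assms(1) by (simp add: complex_eq_iff field_simps power2_eq_square)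
  have C0: "0 \<le> a\<^sup>2 * \<bar>2 * a + 1\<bar>" by simp
  show ?thesis
  proof (cases "a\<^sup>2 = 1")
    case True
    \<comment> \<open>For \<open>a\<^sup>2 = 1\<close> the coefficients in \<open>xs2\<close> and
      \<open>xW\<close> all become \<open>2 * a + 1\<close>, so \<open>s\<close> enters only through
      \<open>e\<close>, and the two terms combine to an inner product with
      \<open>h1 x - h x /\<^sub>R x\<close>.\<close>
    have a2: "a * (a + 2) = 2 * a + 1" using True by (simp add: power2_eq_square algebra_simps)
    define e where "e = s1 x - s x /\<^sub>R x"
    have "(x *\<^sub>R s2 x) \<bullet> h1 x + end_flux a s s1 x \<bullet> h x = (2 * a + 1) * (e \<bullet> (h1 x - h x /\<^sub>R x))"
    proof -
      have 1: "x *\<^sub>R s2 x = (2 * a + 1) *\<^sub>R e"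
        unfolding xs2 a2 e_def by (simp add: scaleR_diff_right)
      have 2: "end_flux a s s1 x = (- (2 * a + 1) / x) *\<^sub>R e"
        unfolding xW a2 True e_def using assms(1) by (simp add: complex_eq_iff field_simps)
      show ?thesis
        unfolding 1 2 inner_scaleR_left inner_diff_right inner_scaleR_right
        using assms(1) by (simp add: field_simps)
    qed
    moreover have "\<bar>(2 * a + 1) * (e \<bullet> (h1 x - h x /\<^sub>R x))\<bar> \<le> C * (norm e * norm (h1 x - h x /\<^sub>R x))"
      unfolding abs_mult using Cauchy_Schwarz_ineq2[of e "h1 x - h x /\<^sub>R x"] C0
      by (intro mult_mono) (auto simp: C_def)
    ultimately show ?thesis
      unfolding end_size_def C_def[symmetric] e_def[symmetric] using True by (simp add: e_def mult.assoc)
  next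
    case False
    define Y where "Y = norm (s1 x) + norm (s x) / x"
    have Y: "norm (s1 x) \<le> Y" "norm (s x /\<^sub>R x) \<le> Y" "0 \<le> Y"
      unfolding Y_def using assms(1) by (auto simp: divide_inverse mult.commute)
    have n1: "norm (x *\<^sub>R s2 x) \<le> C * Y"
    proof -
      have "norm (x *\<^sub>R s2 x) \<le> norm ((2 * a + 1) *\<^sub>R s1 x) + norm ((a * (a + 2)) *\<^sub>R (s x /\<^sub>R x))"
        unfolding xs2 by (rule norm_triangle_ineq4)
      also have "\<dots> \<le> \<bar>2 * a + 1\<bar> * Y + \<bar>a * (a + 2)\<bar> * Y"
        unfolding norm_scaleR[of "2 * a + 1"] norm_scaleR[of "a * (a + 2)"]
        using Y by (intro add_mono mult_left_mono) auto
      also have "\<dots> \<le> C * Y" unfolding C_def distrib_right[symmetric] using C0 Y by (intro mult_right_mono) auto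
      finally show ?thesis .
    qed
    have n2: "norm (end_flux a s s1 x) \<le> C * Y / x"
    proof -
      have "norm (end_flux a s s1 x) = norm ((a\<^sup>2 * (2 * a + 1)) *\<^sub>R (s x /\<^sub>R x) - (a * (a + 2)) *\<^sub>R s1 x) / x"
        unfolding xW using assms(1) by simp
      also have "\<dots> \<le> (norm ((a\<^sup>2 * (2 * a + 1)) *\<^sub>R (s x /\<^sub>R x)) + norm ((a * (a + 2)) *\<^sub>R s1 x)) / x"
        using assms(1) by (intro divide_right_mono norm_triangle_ineq4) auto
      also have "\<dots> \<le> (\<bar>a\<^sup>2 * (2 * a + 1)\<bar> * Y + \<bar>a * (a + 2)\<bar> * Y) / x"
        unfolding norm_scaleR[of "a\<^sup>2 * (2 * a + 1)"] norm_scaleR[of "a * (a + 2)"]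
        using Y assms(1) by (intro divide_right_mono add_mono mult_left_mono) auto
      also have "\<dots> \<le> C * Y / x"
        unfolding C_def distrib_right[symmetric] using Y assms(1)
        by (intro divide_right_mono mult_right_mono) (auto simp: abs_mult)
      finally show ?thesis .
    qed
    have "\<bar>(x *\<^sub>R s2 x) \<bullet> h1 x + end_flux a s s1 x \<bullet> h x\<bar>
      \<le> norm (x *\<^sub>R s2 x) * norm (h1 x) + norm (end_flux a s s1 x) * norm (h x)"
      using Cauchy_Schwarz_ineq2[of "x *\<^sub>R s2 x" "h1 x"] Cauchy_Schwarz_ineq2[of "end_flux a s s1 x" "h x"] by linarith
    also have "\<dots> \<le> C * Y * norm (h1 x) + C * Y / x * norm (h x)"
      using n1 n2 by (intro add_mono mult_right_mono) auto
    also have "\<dots> = C * Y * (norm (h1 x) + norm (h x) / x)" by (simp add: algebra_simps)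
    finally show ?thesis
      unfolding end_size_def C_def[symmetric] using False by (simp add: Y_def)
  qed
qed

lemma end_size_diff_le:
  assumes "0 < x"
  shows "end_size c (\<lambda>x. g x - s x) (\<lambda>x. g1 x - s1 x) x \<le> end_size c g g1 x + end_size c s s1 x"
proof (cases "c = 1")
  case True
  have "g1 x - s1 x - (g x - s x) /\<^sub>R x = (g1 x - g x /\<^sub>R x) - (s1 x - s x /\<^sub>R x)"
    by (simp add: scaleR_diff_right)
  then have "norm (g1 x - s1 x - (g x - s x) /\<^sub>R x) \<le> norm (g1 x - g x /\<^sub>R x) + norm (s1 x - s x /\<^sub>R x)"
    by (metis norm_triangle_ineq4)
  then show ?thesis using True by (simp add: end_size_def)
next
  case False
  have "norm (g x - s x) / x \<le> norm (g x) / x + norm (s x) / x"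
    unfolding add_divide_distrib[symmetric] using assms by (intro divide_right_mono norm_triangle_ineq4) auto
  then show ?thesis using False norm_triangle_ineq4[of "g1 x" "s1 x"] unfolding end_size_def by simp
qed

text \<open>Both \<open>s x / x\<close> and \<open>s1 x\<close> combine the powers
  \<open>a - 1\<close> and \<open>a + 1\<close> of \<open>x\<close>. For \<open>a = 1\<close> or
  \<open>a = - 1\<close> one of these is constant and cannot be small, but it stems from a multiple
  of \<open>x\<close> in \<open>s\<close>, which \<open>s1 x - s x / x\<close> annihilates. Hence
  the exceptions in the assumptions on \<open>B\<close>.\<close>

lemma end_size_powr_le:
  fixes s s1 :: "real \<Rightarrow> complex"
  assumes x: "0 < x"
    and s: "s x = x powr a *\<^sub>R c1 + x powr (a + 2) *\<^sub>R c2"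
    and s1: "s1 x = (a * x powr (a - 1)) *\<^sub>R c1 + ((a + 2) * x powr (a + 1)) *\<^sub>R c2"
    and B: "a \<noteq> 1 \<Longrightarrow> x powr (a - 1) \<le> B" "a \<noteq> - 1 \<Longrightarrow> x powr (a + 1) \<le> B"
  shows "end_size (a\<^sup>2) s s1 x \<le> (\<bar>a - 1\<bar> + \<bar>a\<bar> + \<bar>a + 1\<bar> + \<bar>a + 2\<bar> + 1) * (norm c1 + norm c2) * B"
proof -
  define K where "K = \<bar>a - 1\<bar> + \<bar>a\<bar> + \<bar>a + 1\<bar> + \<bar>a + 2\<bar> + 1"
  have B0: "0 \<le> B" using B by (cases "a = 1") (auto intro: order_trans[OF powr_ge_zero])
  have sx: "s x /\<^sub>R x = x powr (a - 1) *\<^sub>R c1 + x powr (a + 1) *\<^sub>R c2"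
    unfolding s using x by (simp add: powr_diff powr_add powr_numeral complex_eq_iff field_simps power2_eq_square)
  \<comment> \<open>The coefficient of a power without a bound by \<open>B\<close> is required to
    vanish.\<close>
  have gen: "norm ((p * x powr (a - 1)) *\<^sub>R c1 + (q * x powr (a + 1)) *\<^sub>R c2) \<le> m * (norm c1 + norm c2) * B"
    if "\<bar>p\<bar> \<le> m" "\<bar>q\<bar> \<le> m" "a = 1 \<Longrightarrow> p = 0" "a = - 1 \<Longrightarrow> q = 0" for p q m
  proof -
    have m: "0 \<le> m" using that(1) by linarith
    have 1: "\<bar>p * x powr (a - 1)\<bar> \<le> m * B"
    proof (cases "a = 1")
      case True then show ?thesis using that(3) m B0 by simp
    next
      case False then show ?thesis unfolding abs_mult using that(1) B(1) m by (intro mult_mono) auto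
    qed
    have 2: "\<bar>q * x powr (a + 1)\<bar> \<le> m * B"
    proof (cases "a = - 1")
      case True then show ?thesis using that(4) m B0 by simp
    next
      case False then show ?thesis unfolding abs_mult using that(2) B(2) m by (intro mult_mono) auto
    qed
    have "norm ((p * x powr (a - 1)) *\<^sub>R c1 + (q * x powr (a + 1)) *\<^sub>R c2)
      \<le> \<bar>p * x powr (a - 1)\<bar> * norm c1 + \<bar>q * x powr (a + 1)\<bar> * norm c2"
      by (rule order_trans[OF norm_triangle_ineq]) simp
    also have "\<dots> \<le> m * B * norm c1 + m * B * norm c2"
      using 1 2 by (intro add_mono mult_right_mono) auto
    finally show ?thesis by (simp add: algebra_simps)
  qed
  show ?thesis
  proof (cases "a\<^sup>2 = 1")
    case True
    have "s1 x - s x /\<^sub>R x = ((a - 1) * x powr (a - 1)) *\<^sub>R c1 + ((a + 1) * x powr (a + 1)) *\<^sub>R c2"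
      unfolding sx s1 by (simp add: complex_eq_iff algebra_simps)
    then have "norm (s1 x - s x /\<^sub>R x) \<le> K * (norm c1 + norm c2) * B"
      using gen[of "a - 1" K "a + 1"] unfolding K_def by simp
    then show ?thesis using True unfolding end_size_def K_def by simp
  next
    case False
    then have a: "a \<noteq> 1" "a \<noteq> - 1" by auto
    have "norm (s1 x) \<le> (\<bar>a\<bar> + \<bar>a + 2\<bar>) * (norm c1 + norm c2) * B"
      unfolding s1 using a by (intro gen) auto
    moreover have "norm (s x) / x \<le> 1 * (norm c1 + norm c2) * B"
      using gen[of 1 1 1] sx a x by (metis (no_types, lifting) abs_one divide_inverse_commute mult_1 norm_scaleR abs_inverse abs_of_pos order_refl)
    ultimately have "norm (s1 x) + norm (s x) / x \<le> (\<bar>a\<bar> + \<bar>a + 2\<bar> + 1) * ((norm c1 + norm c2) * B)"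
      by (simp add: algebra_simps)
    also have "\<dots> \<le> K * ((norm c1 + norm c2) * B)"
      using B0 unfolding K_def by (intro mult_right_mono) auto
    finally show ?thesis using False unfolding end_size_def K_def by (simp add: mult.assoc)
  qed
qed


section \<open>Splines\<close>

lemma nderiv_0 [simp]: "nderiv 0 f = f"
  by (simp add: nderiv_def)

lemma nderiv_Suc: "nderiv (Suc m) f = (\<lambda>x. vector_derivative (nderiv m f) (at x))"
  by (simp add: nderiv_def)

lemma times_differentiable_on_derivative:
  assumes "times_differentiable_on m f S" "i < m" "x \<in> S"
  shows "(nderiv i f has_vector_derivative nderiv (Suc i) f x) (at x)"
  using assms unfolding times_differentiable_on_def nderiv_Suc
  by (auto simp: vector_derivative_works[symmetric])

lemma knots_cases:
  fixes \<rho> :: "nat \<Rightarrow> real"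
  assumes "1 \<le> n"
  shows "x < \<rho> 1 \<or> \<rho> n < x \<or> x \<in> \<rho> ` {1..n} \<or> (\<exists>j\<in>{1..<n}. \<rho> j < x \<and> x < \<rho> (Suc j))"
  using assms
proof (induction n rule: nat_induct_at_least)
  case base
  then show ?case by auto
next
  case (Suc n)
  then consider "x < \<rho> 1" | "\<rho> n < x" | "x \<in> \<rho> ` {1..n}" | j where "j \<in> {1..<n}" "\<rho> j < x" "x < \<rho> (Suc j)"
    by blast
  then show ?case
  proof cases
    case 2
    then show ?thesis using Suc.hyps by (cases "x < \<rho> (Suc n)"; cases "x = \<rho> (Suc n)") auto
  next
    case 3
    then show ?thesis by auto
  next
    case 4
    then have "j \<in> {1..<Suc n}" by auto
    then show ?thesis using 4 by blast
  qed auto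
qed

text \<open>Gathers the spline conditions in the form that integration by parts needs: \<sigma> is
  twice continuously differentiable on the whole half-line, and a single \<open>W\<close> satisfies
  the flux equations off the knots. Between the knots the equation for the derivative of
  \<open>W\<close> is \<open>L_op k \<sigma> x = 0\<close>; on the end intervals it comes from
  \<open>end_flux_derivatives\<close>.\<close>

lemma BL_spline_flux:
  fixes \<sigma> :: "real \<Rightarrow> complex" and \<rho> :: "nat \<Rightarrow> real" and n :: nat
  assumes n: "1 \<le> n" and \<rho>1: "0 < \<rho> 1" and mono: "strict_mono_on {1..n} \<rho>"
    and \<sigma>: "\<sigma> \<in> BL_splines k n \<rho>"
  obtains W where
    "\<And>x. 0 < x \<Longrightarrow> (\<sigma> has_vector_derivative nderiv 1 \<sigma> x) (at x)"
    "\<And>x. 0 < x \<Longrightarrow> (nderiv 1 \<sigma> has_vector_derivative nderiv 2 \<sigma> x) (at x)"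
    "\<And>x. 0 < x \<Longrightarrow> isCont (nderiv 2 \<sigma>) x"
    "\<And>x. 0 < x \<Longrightarrow> x \<notin> \<rho> ` {1..n} \<Longrightarrow>
      ((\<lambda>x. x *\<^sub>R nderiv 2 \<sigma> x) has_vector_derivative flux1 ((of_int k)\<^sup>2) \<sigma> (nderiv 1 \<sigma>) x - W x) (at x)"
    "\<And>x. 0 < x \<Longrightarrow> x \<notin> \<rho> ` {1..n} \<Longrightarrow>
      (W has_vector_derivative flux0 ((of_int k)\<^sup>2) \<sigma> (nderiv 1 \<sigma>) x) (at x)"
    "\<And>x. x \<in> {0<..<\<rho> 1} \<Longrightarrow> W x = end_flux \<bar>of_int k\<bar> \<sigma> (nderiv 1 \<sigma>) x"
    "\<And>x. x \<in> {0<..<\<rho> 1} \<Longrightarrow> nderiv 2 \<sigma> x =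
      ((2 * \<bar>of_int k\<bar> + 1) / x) *\<^sub>R nderiv 1 \<sigma> x - (\<bar>of_int k\<bar> * (\<bar>of_int k\<bar> + 2) / x\<^sup>2) *\<^sub>R \<sigma> x"
    "\<And>x. x \<in> {\<rho> n<..} \<Longrightarrow> W x = end_flux (- \<bar>of_int k\<bar>) \<sigma> (nderiv 1 \<sigma>) x"
    "\<And>x. x \<in> {\<rho> n<..} \<Longrightarrow> nderiv 2 \<sigma> x =
      ((2 * (- \<bar>of_int k\<bar>) + 1) / x) *\<^sub>R nderiv 1 \<sigma> x - (- \<bar>of_int k\<bar> * (- \<bar>of_int k\<bar> + 2) / x\<^sup>2) *\<^sub>R \<sigma> x"
proof -
  define \<kappa> :: real where "\<kappa> = \<bar>of_int k\<bar>"
  define c :: real where "c = (of_int k)\<^sup>2"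
  have c: "\<kappa>\<^sup>2 = c" "(- \<kappa>)\<^sup>2 = c" unfolding \<kappa>_def c_def by auto
  define s1 s2 s3 s4 where "s1 = nderiv 1 \<sigma>" and "s2 = nderiv 2 \<sigma>" and "s3 = nderiv 3 \<sigma>" and "s4 = nderiv 4 \<sigma>"
  note s_defs = s1_def s2_def s3_def s4_def
  have S: "times_differentiable_on 4 \<sigma> {\<rho> j<..<\<rho> (Suc j)}" "\<And>r. r \<in> {\<rho> j<..<\<rho> (Suc j)} \<Longrightarrow> L_op k \<sigma> r = 0"
    if "j \<in> {1..<n}" for j
    using \<sigma> that unfolding BL_splines_def by auto
  have L: "times_differentiable_on 2 \<sigma> {0<..<\<rho> 1}" "\<And>r. r \<in> {0<..<\<rho> 1} \<Longrightarrow> G_op k \<sigma> r = 0"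
    and R: "times_differentiable_on 2 \<sigma> {\<rho> n<..}" "\<And>r. r \<in> {\<rho> n<..} \<Longrightarrow> R_op k \<sigma> r = 0"
    and K: "\<And>j. j \<in> {1..n} \<Longrightarrow> C_at 2 \<sigma> (\<rho> j)"
    using \<sigma> unfolding BL_splines_def by auto
  have mono_le: "\<rho> i \<le> \<rho> j" if "1 \<le> i" "i \<le> j" "j \<le> n" for i j
    using strict_mono_on_leD[OF mono] that by auto
  have \<rho>1n: "\<rho> 1 \<le> \<rho> n" using n by (intro mono_le) auto
  then have \<rho>n: "0 < \<rho> n" using \<rho>1 by simp
  have two: "nderiv (Suc 0) \<sigma> = s1" "nderiv (Suc (Suc 0)) \<sigma> = s2" "nderiv (Suc (Suc (Suc 0))) \<sigma> = s3"
    "nderiv (Suc (Suc (Suc (Suc 0)))) \<sigma> = s4"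
    unfolding s_defs by (simp_all add: eval_nat_numeral)
  have d2: "(\<sigma> has_vector_derivative s1 x) (at x)" "(s1 has_vector_derivative s2 x) (at x)"
    if "times_differentiable_on m \<sigma> U" "x \<in> U" "2 \<le> m" for U x m
    using times_differentiable_on_derivative[OF that(1) _ that(2), of 0]
      times_differentiable_on_derivative[OF that(1) _ that(2), of "Suc 0"] that(3) unfolding two by auto
  have d4: "(s2 has_vector_derivative s3 x) (at x)" "(s3 has_vector_derivative s4 x) (at x)"
    if "times_differentiable_on 4 \<sigma> U" "x \<in> U" for U x
    using times_differentiable_on_derivative[OF that(1) _ that(2), of "Suc (Suc 0)"]
      times_differentiable_on_derivative[OF that(1) _ that(2), of "Suc (Suc (Suc 0))"] unfolding two by auto
  have solve: "p = q - r" if "p - q + r = 0" for p q r :: complex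
    using that by (auto simp: complex_eq_iff)
  have odeL: "s2 x = ((2 * \<kappa> + 1) / x) *\<^sub>R s1 x - (\<kappa> * (\<kappa> + 2) / x\<^sup>2) *\<^sub>R \<sigma> x" if "x \<in> {0<..<\<rho> 1}" for x
    using L(2)[OF that] that unfolding G_op_def s_defs \<kappa>_def by (intro solve) simp
  \<comment> \<open>\<open>R_op\<close> is \<open>G_op\<close> with \<open>\<bar>k\<bar>\<close>
    replaced by its negative, so both ends share one equation.\<close>
  have odeR: "s2 x = ((2 * (- \<kappa>) + 1) / x) *\<^sub>R s1 x - (- \<kappa> * (- \<kappa> + 2) / x\<^sup>2) *\<^sub>R \<sigma> x" if "x \<in> {\<rho> n<..}" for x
  proof -
    have "s2 x + ((2 * \<kappa> - 1) / x) *\<^sub>R s1 x + (\<kappa> * (\<kappa> - 2) / x\<^sup>2) *\<^sub>R \<sigma> x = 0"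
      using R(2)[OF that] that \<rho>n unfolding R_op_def s_defs \<kappa>_def by simp
    moreover have "(2 * (- \<kappa>) + 1) / x = - ((2 * \<kappa> - 1) / x)" "- \<kappa> * (- \<kappa> + 2) / x\<^sup>2 = \<kappa> * (\<kappa> - 2) / x\<^sup>2"
      by (simp_all add: minus_divide_left algebra_simps)
    ultimately show ?thesis by (intro solve) (simp only: scaleR_minus_left diff_minus_eq_add)
  qed
  \<comment> \<open>At a knot the third derivative need not exist, so \<open>M\<close> may have an
    unspecified value there. This is harmless: \<open>W\<close> enters the boundary term only
    multiplied by \<open>h\<close>, which vanishes at the knots.\<close>
  define M where "M x = flux1 c \<sigma> s1 x - (s2 x + x *\<^sub>R s3 x)" for x
  define W where "W x = (if x < \<rho> 1 then end_flux \<kappa> \<sigma> s1 x else if \<rho> n < x then end_flux (- \<kappa>) \<sigma> s1 x else M x)" for x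
  have left: "(\<sigma> has_vector_derivative s1 x) (at x)" "(s1 has_vector_derivative s2 x) (at x)" "isCont s2 x"
      "((\<lambda>x. x *\<^sub>R s2 x) has_vector_derivative flux1 c \<sigma> s1 x - W x) (at x)"
      "(W has_vector_derivative flux0 c \<sigma> s1 x) (at x)" if x: "x \<in> {0<..<\<rho> 1}" for x
  proof -
    show d: "(\<sigma> has_vector_derivative s1 x) (at x)" "(s1 has_vector_derivative s2 x) (at x)"
      by (rule d2[OF L(1) x order_refl])+
    have z: "0 \<notin> {0<..<\<rho> 1}" by simp
    note e = end_flux_derivatives[OF open_greaterThanLessThan x z d odeL, unfolded c]
    show "isCont s2 x" by (rule e(3))
    have eq: "end_flux \<kappa> \<sigma> s1 y = W y" if "y \<in> {0<..<\<rho> 1}" for y using that unfolding W_def by auto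
    show "((\<lambda>x. x *\<^sub>R s2 x) has_vector_derivative flux1 c \<sigma> s1 x - W x) (at x)" using e(1) eq[OF x] by simp
    show "(W has_vector_derivative flux0 c \<sigma> s1 x) (at x)"
      by (rule has_vector_derivative_transform_within_open[OF e(2) open_greaterThanLessThan x eq])
  qed
  have right: "(\<sigma> has_vector_derivative s1 x) (at x)" "(s1 has_vector_derivative s2 x) (at x)" "isCont s2 x"
      "((\<lambda>x. x *\<^sub>R s2 x) has_vector_derivative flux1 c \<sigma> s1 x - W x) (at x)"
      "(W has_vector_derivative flux0 c \<sigma> s1 x) (at x)" if x: "x \<in> {\<rho> n<..}" for x
  proof -
    show d: "(\<sigma> has_vector_derivative s1 x) (at x)" "(s1 has_vector_derivative s2 x) (at x)"
      by (rule d2[OF R(1) x order_refl])+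
    have z: "0 \<notin> {\<rho> n<..}" using \<rho>n by simp
    note e = end_flux_derivatives[OF open_greaterThan x z d odeR, unfolded c]
    show "isCont s2 x" by (rule e(3))
    have eq: "end_flux (- \<kappa>) \<sigma> s1 y = W y" if "y \<in> {\<rho> n<..}" for y using that \<rho>1n unfolding W_def by auto
    show "((\<lambda>x. x *\<^sub>R s2 x) has_vector_derivative flux1 c \<sigma> s1 x - W x) (at x)" using e(1) eq[OF x] by simp
    show "(W has_vector_derivative flux0 c \<sigma> s1 x) (at x)"
      by (rule has_vector_derivative_transform_within_open[OF e(2) open_greaterThan x eq])
  qed
  have mid: "(\<sigma> has_vector_derivative s1 x) (at x)" "(s1 has_vector_derivative s2 x) (at x)" "isCont s2 x"
      "((\<lambda>x. x *\<^sub>R s2 x) has_vector_derivative flux1 c \<sigma> s1 x - W x) (at x)"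
      "(W has_vector_derivative flux0 c \<sigma> s1 x) (at x)" if j: "j \<in> {1..<n}" and x: "x \<in> {\<rho> j<..<\<rho> (Suc j)}" for x j
  proof -
    show d: "(\<sigma> has_vector_derivative s1 x) (at x)" "(s1 has_vector_derivative s2 x) (at x)"
      by (rule d2[OF S(1)[OF j] x]; simp)+
    note dd = d4[OF S(1)[OF j] x]
    show "isCont s2 x" by (rule has_vector_derivative_continuous[OF dd(1)])
    have b: "\<rho> 1 \<le> \<rho> j" "\<rho> (Suc j) \<le> \<rho> n" using j by (auto intro!: mono_le)
    then have x0: "0 < x" using x \<rho>1 by auto
    then have xne: "x \<noteq> 0" by simp
    have eq: "M y = W y" if "y \<in> {\<rho> j<..<\<rho> (Suc j)}" for y using that b unfolding W_def by auto
    have "((\<lambda>x. x *\<^sub>R s2 x) has_vector_derivative x *\<^sub>R s3 x + 1 *\<^sub>R s2 x) (at x)"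
      by (intro has_vector_derivative_scaleR dd(1) DERIV_ident)
    moreover have "x *\<^sub>R s3 x + 1 *\<^sub>R s2 x = flux1 c \<sigma> s1 x - W x"
      unfolding eq[OF x, symmetric] M_def by simp
    ultimately show "((\<lambda>x. x *\<^sub>R s2 x) has_vector_derivative flux1 c \<sigma> s1 x - W x) (at x)" by simp
    have "(M has_vector_derivative ((((2 * c + 1) / x) *\<^sub>R s2 x - ((2 * c + 1) / x\<^sup>2) *\<^sub>R s1 x)
        - ((3 * c / x\<^sup>2) *\<^sub>R s1 x - (2 * (3 * c) / x ^ 3) *\<^sub>R \<sigma> x)) - (s3 x + (x *\<^sub>R s4 x + 1 *\<^sub>R s3 x))) (at x)"
      unfolding M_def flux1_def
      by (intro has_vector_derivative_diff has_vector_derivative_add rdiv_deriv[OF xne] d dd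
          has_vector_derivative_scaleR DERIV_ident)
    \<comment> \<open>This is \<open>L_op k \<sigma> x = 0\<close> rearranged, with
      \<open>k ^ 4 - 4 * k\<^sup>2\<close> written as \<open>c\<^sup>2 - 4 * c\<close>; the term
      \<open>6 * c\<close> from differentiating \<open>flux1\<close> completes it to
      \<open>2 * c + c\<^sup>2\<close>.\<close>
    moreover have "((((2 * c + 1) / x) *\<^sub>R s2 x - ((2 * c + 1) / x\<^sup>2) *\<^sub>R s1 x)
        - ((3 * c / x\<^sup>2) *\<^sub>R s1 x - (2 * (3 * c) / x ^ 3) *\<^sub>R \<sigma> x)) - (s3 x + (x *\<^sub>R s4 x + 1 *\<^sub>R s3 x)) = flux0 c \<sigma> s1 x"
    proof -
      have "x *\<^sub>R s4 x + 2 *\<^sub>R s3 x - ((2 * c + 1) / x) *\<^sub>R s2 x + ((2 * c + 1) / x\<^sup>2) *\<^sub>R s1 x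
         + ((c\<^sup>2 - 4 * c) / x ^ 3) *\<^sub>R \<sigma> x = 0"
      proof -
        have "(of_int k) ^ 4 = c\<^sup>2" unfolding c_def by simp
        then show ?thesis using S(2)[OF j x] unfolding L_op_def s_defs c_def[symmetric] by simp
      qed
      then have e1: "x *\<^sub>R s4 x + 2 *\<^sub>R s3 x = ((2 * c + 1) / x) *\<^sub>R s2 x - ((2 * c + 1) / x\<^sup>2) *\<^sub>R s1 x
         - ((c\<^sup>2 - 4 * c) / x ^ 3) *\<^sub>R \<sigma> x"
        by (simp add: algebra_simps eq_neg_iff_add_eq_0)
      have e2: "s3 x + (x *\<^sub>R s4 x + 1 *\<^sub>R s3 x) = x *\<^sub>R s4 x + 2 *\<^sub>R s3 x"
        by (simp add: scaleR_2)
      show ?thesis unfolding flux0_def e2 e1 using x0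
        by (simp add: complex_eq_iff field_simps power2_eq_square power3_eq_cube)
    qed
    ultimately have "(M has_vector_derivative flux0 c \<sigma> s1 x) (at x)" by simp
    then show "(W has_vector_derivative flux0 c \<sigma> s1 x) (at x)"
      by (rule has_vector_derivative_transform_within_open[OF _ open_greaterThanLessThan x eq])
  qed
  have knot: "(\<sigma> has_vector_derivative s1 x) (at x)" "(s1 has_vector_derivative s2 x) (at x)" "isCont s2 x"
    if x: "x \<in> \<rho> ` {1..n}" for x
  proof -
    obtain U where U: "open U" "x \<in> U" "times_differentiable_on 2 \<sigma> U" "continuous_on U s2"
      using x K unfolding C_at_def C_on_def s_defs by blast
    show "(\<sigma> has_vector_derivative s1 x) (at x)" "(s1 has_vector_derivative s2 x) (at x)"
      by (rule d2[OF U(3,2) order_refl])+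
    show "isCont s2 x" using U by (simp add: continuous_on_eq_continuous_at)
  qed
  have cases: "x \<in> {0<..<\<rho> 1} \<or> x \<in> {\<rho> n<..} \<or> x \<in> \<rho> ` {1..n} \<or> (\<exists>j\<in>{1..<n}. x \<in> {\<rho> j<..<\<rho> (Suc j)})" if "0 < x" for x
    using knots_cases[OF n, of x \<rho>] that by auto
  have reg: "(\<sigma> has_vector_derivative s1 x) (at x) \<and> (s1 has_vector_derivative s2 x) (at x) \<and> isCont s2 x"
    if "0 < x" for x
    using cases[OF that]
  proof (elim disjE bexE)
    assume "x \<in> {0<..<\<rho> 1}"
    then show ?thesis by (intro conjI left)
  next
    assume "x \<in> {\<rho> n<..}"
    then show ?thesis by (intro conjI right)
  next
    assume "x \<in> \<rho> ` {1..n}"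
    then show ?thesis by (intro conjI knot)
  next
    fix j assume "j \<in> {1..<n}" "x \<in> {\<rho> j<..<\<rho> (Suc j)}"
    then show ?thesis by (intro conjI mid)
  qed
  have flux: "((\<lambda>x. x *\<^sub>R s2 x) has_vector_derivative flux1 c \<sigma> s1 x - W x) (at x) \<and>
      (W has_vector_derivative flux0 c \<sigma> s1 x) (at x)" if "0 < x" "x \<notin> \<rho> ` {1..n}" for x
    using cases[OF that(1)]
  proof (elim disjE bexE)
    assume "x \<in> {0<..<\<rho> 1}"
    then show ?thesis by (intro conjI left)
  next
    assume "x \<in> {\<rho> n<..}"
    then show ?thesis by (intro conjI right)
  next
    assume "x \<in> \<rho> ` {1..n}"
    then show ?thesis using that(2) by simp
  next
    fix j assume "j \<in> {1..<n}" "x \<in> {\<rho> j<..<\<rho> (Suc j)}"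
    then show ?thesis by (intro conjI mid)
  qed
  show ?thesis
  proof (rule that[of W, folded s_defs \<kappa>_def c_def])
    show "(\<sigma> has_vector_derivative s1 x) (at x)" "(s1 has_vector_derivative s2 x) (at x)" "isCont s2 x" if "0 < x" for x
      using reg[OF that] by auto
    show "((\<lambda>x. x *\<^sub>R s2 x) has_vector_derivative flux1 c \<sigma> s1 x - W x) (at x)"
        "(W has_vector_derivative flux0 c \<sigma> s1 x) (at x)" if "0 < x" "x \<notin> \<rho> ` {1..n}" for x
      using flux[OF that] by auto
    show "W x = end_flux \<kappa> \<sigma> s1 x" if "x \<in> {0<..<\<rho> 1}" for x using that unfolding W_def by auto
    show "W x = end_flux (- \<kappa>) \<sigma> s1 x" if "x \<in> {\<rho> n<..}" for x using that \<rho>1n unfolding W_def by auto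
    show "s2 x = ((2 * \<kappa> + 1) / x) *\<^sub>R s1 x - (\<kappa> * (\<kappa> + 2) / x\<^sup>2) *\<^sub>R \<sigma> x" if "x \<in> {0<..<\<rho> 1}" for x
      using that by (rule odeL)
    show "s2 x = ((2 * (- \<kappa>) + 1) / x) *\<^sub>R s1 x - (- \<kappa> * (- \<kappa> + 2) / x\<^sup>2) *\<^sub>R \<sigma> x" if "x \<in> {\<rho> n<..}" for x
      using that by (rule odeR)
  qed
qed

text \<open>The pieces telescope because the boundary term has the same value from both sides of a
  knot: there \<open>h\<close> vanishes, and \<open>s2\<close> and \<open>h1\<close> are continuous.
  At \<open>a\<close> and \<open>b\<close>, which lie off the knots, \<open>W\<close> is continuous
  instead.\<close>

lemma cross_density_integral_over_knots:
  fixes s s1 s2 W h h1 h2 :: "real \<Rightarrow> complex" and \<rho> :: "nat \<Rightarrow> real" and n :: nat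
  assumes n: "1 \<le> n" and \<rho>1: "0 < \<rho> 1" and mono: "strict_mono_on {1..n} \<rho>"
    and s1: "\<And>x. 0 < x \<Longrightarrow> (s has_vector_derivative s1 x) (at x)"
    and s2: "\<And>x. 0 < x \<Longrightarrow> (s1 has_vector_derivative s2 x) (at x)" "\<And>x. 0 < x \<Longrightarrow> isCont s2 x"
    and s3: "\<And>x. 0 < x \<Longrightarrow> x \<notin> \<rho> ` {1..n} \<Longrightarrow> ((\<lambda>x. x *\<^sub>R s2 x) has_vector_derivative flux1 c s s1 x - W x) (at x)"
    and W: "\<And>x. 0 < x \<Longrightarrow> x \<notin> \<rho> ` {1..n} \<Longrightarrow> (W has_vector_derivative flux0 c s s1 x) (at x)"
    and h1: "\<And>x. 0 < x \<Longrightarrow> (h has_vector_derivative h1 x) (at x)" "\<And>x. 0 < x \<Longrightarrow> isCont h1 x"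
    and ac: "\<And>u v. 0 < u \<Longrightarrow> u < v \<Longrightarrow> ac_on {u..v} h1"
    and h2: "\<And>x. 0 < x \<Longrightarrow> h1 differentiable (at x) \<Longrightarrow> (h1 has_vector_derivative h2 x) (at x)"
    and h2_int: "\<And>u v. 0 < u \<Longrightarrow> u < v \<Longrightarrow> h2 absolutely_integrable_on {u..v}"
    and knots: "\<And>j. j \<in> {1..n} \<Longrightarrow> h (\<rho> j) = 0"
    and ab: "a \<in> {0<..<\<rho> 1}" "\<rho> n < b"
  shows "(cross_density c s s1 s2 h h1 h2 has_integral
    ((b *\<^sub>R s2 b) \<bullet> h1 b + W b \<bullet> h b) - ((a *\<^sub>R s2 a) \<bullet> h1 a + W a \<bullet> h a)) {a..b}"
proof -
  define P where "P x = (x *\<^sub>R s2 x) \<bullet> h1 x + W x \<bullet> h x" for x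
  have mono_le: "\<rho> i \<le> \<rho> j" if "1 \<le> i" "i \<le> j" "j \<le> n" for i j
    using strict_mono_on_leD[OF mono] that by auto
  have piece: "(cross_density c s s1 s2 h h1 h2 has_integral (P v - P u)) {u..v}"
    if uv: "0 < u" "u < v" and no: "{u<..<v} \<inter> \<rho> ` {1..n} = {}" and "h u = 0 \<or> isCont W u" "h v = 0 \<or> isCont W v" for u v
    unfolding P_def
  proof (rule cross_density_has_integral[OF uv])
    have pos: "0 < x" if "x \<in> {u..v}" for x using that uv by auto
    show "continuous_on {u..v} s"
      by (intro continuous_at_imp_continuous_on ballI has_vector_derivative_continuous[OF s1] pos)
    show "continuous_on {u..v} s1"
      by (intro continuous_at_imp_continuous_on ballI has_vector_derivative_continuous[OF s2(1)] pos)
    show "continuous_on {u..v} s2" "continuous_on {u..v} h1"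
      by (intro continuous_at_imp_continuous_on ballI s2(2) h1(2) pos; assumption)+
    show "negligible {x\<in>{u<..<v}. \<not> h1 differentiable (at x)}"
      using ac[OF uv] by (rule ac_on_complex_differentiable_ae)
    fix x
    show "(h has_vector_derivative h1 x) (at x)" if "x \<in> {u..v}" using h1(1) pos that by auto
    show "(h1 has_vector_derivative h2 x) (at x)" if "x \<in> {u<..<v} - {x\<in>{u<..<v}. \<not> h1 differentiable (at x)}"
      using h2 uv that by auto
    assume x: "x \<in> {u<..<v}"
    then have "0 < x" "x \<notin> \<rho> ` {1..n}" using uv no by auto
    then show "(s has_vector_derivative s1 x) (at x)" "(s1 has_vector_derivative s2 x) (at x)"
      "((\<lambda>x. x *\<^sub>R s2 x) has_vector_derivative flux1 c s s1 x - W x) (at x)"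
      "(W has_vector_derivative flux0 c s s1 x) (at x)"
      using s1 s2 s3 W by blast+
  qed (use that ac[OF uv] h2_int[OF uv] in auto)
  have outside: "{a<..<\<rho> 1} \<inter> \<rho> ` {1..n} = {}" "{\<rho> n<..<b} \<inter> \<rho> ` {1..n} = {}" "a \<notin> \<rho> ` {1..n}" "b \<notin> \<rho> ` {1..n}"
    using mono_le[of 1] mono_le[of _ n] ab by fastforce+
  have gap: "{\<rho> j<..<\<rho> (Suc j)} \<inter> \<rho> ` {1..n} = {}" if "j \<in> {1..<n}" for j
  proof -
    have "\<rho> i \<le> \<rho> j \<or> \<rho> (Suc j) \<le> \<rho> i" if "i \<in> {1..n}" for i
      using mono_le[of i j] mono_le[of "Suc j" i] that \<open>j \<in> {1..<n}\<close> by (cases "i \<le> j") auto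
    then show ?thesis by fastforce
  qed
  have "(cross_density c s s1 s2 h h1 h2 has_integral (P (\<rho> m) - P a)) {a..\<rho> m}" if "1 \<le> m" "m \<le> n" for m
    using that
  proof (induction m rule: nat_induct_at_least)
    case base
    show ?case
      using ab outside knots[of 1] n has_vector_derivative_continuous[OF W[of a]]
      by (intro piece) auto
  next
    case (Suc m)
    have "\<rho> 1 \<le> \<rho> m" using Suc by (intro mono_le) auto
    then have pos: "a \<le> \<rho> m" "0 < \<rho> m" using ab \<rho>1 by auto
    have lt: "\<rho> m < \<rho> (Suc m)" using strict_mono_onD[OF mono, of m "Suc m"] Suc by auto
    have "(cross_density c s s1 s2 h h1 h2 has_integral (P (\<rho> (Suc m)) - P (\<rho> m))) {\<rho> m..\<rho> (Suc m)}"
      using pos lt gap[of m] knots Suc by (intro piece) auto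
    from has_integral_combine[OF pos(1) less_imp_le[OF lt] Suc.IH this] Suc.prems
    show ?case by simp
  qed
  from this[OF n order_refl]
  have l: "(cross_density c s s1 s2 h h1 h2 has_integral (P (\<rho> n) - P a)) {a..\<rho> n}" .
  have pos: "a \<le> \<rho> n" "0 < \<rho> n" using mono_le[OF order_refl n order_refl] ab \<rho>1 by auto
  have "(cross_density c s s1 s2 h h1 h2 has_integral (P b - P (\<rho> n))) {\<rho> n..b}"
    using ab outside knots[of n] n pos has_vector_derivative_continuous[OF W[of b]]
    by (intro piece) auto
  from has_integral_combine[OF pos(1) less_imp_le[OF ab(2)] l this] show ?thesis
    unfolding P_def by (simp add: algebra_simps)
qed


section \<open>The spaces of competitors\<close>

text \<open>
  Since \<open>1 / x\<close> is not integrable at \<open>0\<close> or at \<open>\<infinity>\<close>, this yields points near either end at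
  which \<open>x \<phi>(x)\<close> is small.
\<close>

lemma logarithmic_divergence:
  fixes \<phi> :: "real \<Rightarrow> real"
  assumes int: "\<phi> integrable_on {0<..}" and nonneg: "\<And>x. 0 < x \<Longrightarrow> 0 \<le> \<phi> x" and "0 < \<epsilon>"
  obtains M where "1 \<le> M" "\<And>p. 0 < p \<Longrightarrow> \<exists>x\<in>{p..p * M}. x * \<phi> x < \<epsilon>"
proof -
  define I where "I = integral {0<..} \<phi>"
  \<comment> \<open>Chosen so that \<open>\<epsilon> / x\<close> has integral
    \<open>\<epsilon> * ln M = I + 1\<close> over every window \<open>{p..p * M}\<close>, more than
    the whole integral of \<open>\<phi>\<close>. By scale invariance one \<open>M\<close> serves
    both ends of the half-line.\<close>
  define M where "M = exp ((I + 1) / \<epsilon>)"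
  have I0: "0 \<le> I" unfolding I_def using int nonneg by (intro integral_nonneg) auto
  then have M1: "1 \<le> M" unfolding M_def using \<open>0 < \<epsilon>\<close> by simp
  have "\<exists>x\<in>{p..p * M}. x * \<phi> x < \<epsilon>" if p: "0 < p" for p
  proof (rule ccontr)
    assume "\<not> ?thesis"
    then have ge: "\<epsilon> \<le> x * \<phi> x" if "x \<in> {p..p * M}" for x using that by force
    have le: "p \<le> p * M" using p M1 by simp
    have "((\<lambda>x. \<epsilon> / x) has_integral (\<epsilon> * ln (p * M) - \<epsilon> * ln p)) {p..p * M}"
    proof (rule fundamental_theorem_of_calculus[OF le])
      fix x assume "x \<in> {p..p * M}"
      then have "0 < x" using p by auto
      then have "((\<lambda>x. \<epsilon> * ln x) has_real_derivative \<epsilon> / x) (at x within {p..p * M})"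
        by (auto intro!: derivative_eq_intros)
      then show "((\<lambda>x. \<epsilon> * ln x) has_vector_derivative \<epsilon> / x) (at x within {p..p * M})"
        by (simp only: has_real_derivative_iff_has_vector_derivative)
    qed
    moreover have "\<epsilon> * ln (p * M) - \<epsilon> * ln p = I + 1"
    proof -
      have "ln (p * M) = ln p + (I + 1) / \<epsilon>" using p by (subst ln_mult_pos) (auto simp: M_def)
      then show ?thesis using \<open>0 < \<epsilon>\<close> by (simp add: field_simps)
    qed
    ultimately have h: "((\<lambda>x. \<epsilon> / x) has_integral (I + 1)) {p..p * M}" by simp
    have sub: "{p..p * M} \<subseteq> {0<..}" using p by auto
    have int': "\<phi> integrable_on {p..p * M}"
      using integrable_on_subcbox[OF int, of p "p * M"] sub by simp
    have "I + 1 \<le> integral {p..p * M} \<phi>"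
    proof (rule has_integral_le[OF h integrable_integral[OF int']])
      fix x assume x: "x \<in> {p..p * M}"
      then have "0 < x" using p by auto
      then show "\<epsilon> / x \<le> \<phi> x" using ge[OF x] by (simp add: divide_le_eq mult.commute)
    qed
    also have "\<dots> \<le> I"
      unfolding I_def using nonneg by (intro integral_subset_le[OF sub int' int]) auto
    finally show False by simp
  qed
  then show ?thesis using M1 that by blast
qed

section \<open>Consequences of the square integrability conditions\<close>

lemma L2_on_measurable:
  assumes "L2_on S f" "S \<in> sets lebesgue"
  shows "f \<in> borel_measurable (lebesgue_on S)"
  using assms by (simp add: L2_on_def set_borel_measurable_def borel_measurable_restrict_space_iff)

lemma L2_on_linear_combination:
  assumes u: "L2_on S u" and v: "L2_on S v" and S: "S \<in> sets lebesgue"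
  shows "L2_on S (\<lambda>r. a *\<^sub>R u r + b *\<^sub>R v r)"
proof -
  have "(\<lambda>r. a *\<^sub>R u r + b *\<^sub>R v r) \<in> borel_measurable (lebesgue_on S)"
    using L2_on_measurable[OF u S] L2_on_measurable[OF v S] by measurable
  then have m: "set_borel_measurable lebesgue S (\<lambda>r. a *\<^sub>R u r + b *\<^sub>R v r)"
    using S by (simp add: set_borel_measurable_def borel_measurable_restrict_space_iff)
  have "(\<lambda>r. (cmod (a *\<^sub>R u r + b *\<^sub>R v r))\<^sup>2) \<in> borel_measurable (lebesgue_on S)"
    using L2_on_measurable[OF u S] L2_on_measurable[OF v S] by measurable
  moreover have "(\<lambda>r. (2 * a\<^sup>2) * (cmod (u r))\<^sup>2 + (2 * b\<^sup>2) * (cmod (v r))\<^sup>2) absolutely_integrable_on S"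
    using u v unfolding L2_on_def by (intro set_integral_add set_integrable_mult_right) auto
  then have "(\<lambda>r. (2 * a\<^sup>2) * (cmod (u r))\<^sup>2 + (2 * b\<^sup>2) * (cmod (v r))\<^sup>2) integrable_on S"
    by (rule set_lebesgue_integral_eq_integral(1))
  moreover have "norm ((cmod (a *\<^sub>R u r + b *\<^sub>R v r))\<^sup>2) \<le> (2 * a\<^sup>2) * (cmod (u r))\<^sup>2 + (2 * b\<^sup>2) * (cmod (v r))\<^sup>2" for r
  proof -
    have "(cmod (a *\<^sub>R u r + b *\<^sub>R v r))\<^sup>2 \<le> (\<bar>a\<bar> * cmod (u r) + \<bar>b\<bar> * cmod (v r))\<^sup>2"
      by (intro power_mono order_trans[OF norm_triangle_ineq]) auto
    also have "\<dots> \<le> (2 * a\<^sup>2) * (cmod (u r))\<^sup>2 + (2 * b\<^sup>2) * (cmod (v r))\<^sup>2"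
      using sum_squares_bound[of "\<bar>a\<bar> * cmod (u r)" "\<bar>b\<bar> * cmod (v r)"]
      by (simp add: power2_sum power_mult_distrib)
    finally show ?thesis by simp
  qed
  ultimately have "(\<lambda>r. (cmod (a *\<^sub>R u r + b *\<^sub>R v r))\<^sup>2) absolutely_integrable_on S"
    using S by (intro measurable_bounded_by_integrable_imp_absolutely_integrable) auto
  with m show ?thesis unfolding L2_on_def by simp
qed

lemma Lambda_regular:
  assumes "g \<in> Lambda1 \<or> g \<in> Lambda2"
  shows "\<And>x. 0 < x \<Longrightarrow> (g has_vector_derivative nderiv 1 g x) (at x)"
    and "\<And>x. 0 < x \<Longrightarrow> isCont (nderiv 1 g) x"
    and "\<And>u v. 0 < u \<Longrightarrow> u < v \<Longrightarrow> ac_on {u..v} (nderiv 1 g)"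
    and "\<And>u v. 0 < u \<Longrightarrow> u < v \<Longrightarrow> nderiv 2 g absolutely_integrable_on {u..v}"
proof -
  have C: "C_on 1 g {0<..}" and ac: "nderiv 1 g \<in> AC_loc" and L: "L2_on {0<..} (\<lambda>r. (r powr (1/2)) *\<^sub>R nderiv 2 g r)"
    using assms unfolding Lambda1_def Lambda2_def by auto
  show "(g has_vector_derivative nderiv 1 g x) (at x)" if "0 < x" for x
    using times_differentiable_on_derivative[of 1 g "{0<..}" 0 x] C that unfolding C_on_def by simp
  show "isCont (nderiv 1 g) x" if "0 < x" for x
    using C that unfolding C_on_def by (simp add: continuous_on_eq_continuous_at)
  show "ac_on {u..v} (nderiv 1 g)" if "0 < u" "u < v" for u v
    using ac that unfolding AC_loc_def abs_continuous_on_def ac_on_def by auto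
  show "nderiv 2 g absolutely_integrable_on {u..v}" if uv: "0 < u" "u < v" for u v
  proof -
    have sub: "{u..v} \<subseteq> {0<..}" using uv by auto
    define w where "w r = (r powr (1/2)) *\<^sub>R nderiv 2 g r" for r
    have "w \<in> borel_measurable (lebesgue_on {0<..})" using L2_on_measurable[OF L] unfolding w_def by simp
    then have "(\<lambda>r. (r powr (-1/2)) *\<^sub>R w r) \<in> borel_measurable (lebesgue_on {0<..})"
      by (intro borel_measurable_scaleR) (auto intro!: measurable_restrict_space1 measurable_completion)
    then have "(\<lambda>r. (r powr (-1/2)) *\<^sub>R w r) \<in> borel_measurable (lebesgue_on {u..v})"
      using sub by (rule measurable_restrict_mono)
    then have m: "nderiv 2 g \<in> borel_measurable (lebesgue_on {u..v})"
      using uv by (subst measurable_cong[where g = "\<lambda>r. (r powr (-1/2)) *\<^sub>R w r"])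
        (auto simp: w_def powr_add[symmetric])
    have "(\<lambda>r. (cmod (w r))\<^sup>2) absolutely_integrable_on {0<..}" using L unfolding L2_on_def w_def by simp
    then have "(\<lambda>r. (cmod (w r))\<^sup>2) absolutely_integrable_on {u..v}"
      by (rule set_integrable_subset) (use sub in auto)
    \<comment> \<open>A majorant for the norm \<open>d\<close> of the second derivative:
      \<open>d \<le> 1 + d\<^sup>2\<close>, and the weight satisfies \<open>1 \<le> r / u\<close> on
      the interval.\<close>
    then have "(\<lambda>r. 1 + (1 / u) * (cmod (w r))\<^sup>2) integrable_on {u..v}"
      by (intro integrable_add integrable_on_cmult_left set_lebesgue_integral_eq_integral(1)) auto
    moreover have "norm (nderiv 2 g r) \<le> 1 + (1 / u) * (cmod (w r))\<^sup>2" if r: "r \<in> {u..v}" for r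
    proof -
      have r0: "0 < r" using r uv by auto
      define d where "d = norm (nderiv 2 g r)"
      have "(cmod (w r))\<^sup>2 = r * d\<^sup>2"
        using r0 unfolding w_def d_def by (simp add: power_mult_distrib powr_power)
      then have "(1 / u) * (cmod (w r))\<^sup>2 = (r / u) * d\<^sup>2" by simp
      moreover have "1 * d\<^sup>2 \<le> (r / u) * d\<^sup>2" using r uv by (intro mult_right_mono) auto
      moreover have "d \<le> 1 + d\<^sup>2" using sum_squares_bound[of d 1] norm_ge_zero[of "nderiv 2 g r"]
        unfolding d_def[symmetric] power2_eq_square by linarith
      ultimately show ?thesis unfolding d_def by linarith
    qed
    ultimately show ?thesis
      using m by (intro measurable_bounded_by_integrable_imp_absolutely_integrable) auto
  qed
qed

text \<open>For \<open>\<bar>k\<bar> = 1\<close> both first-order squares of the energy reduce to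
  the one combination that \<open>Lambda1\<close> controls, so its energy is finite without separate
  bounds on \<open>g\<close> and its derivative. The function \<open>\<phi>\<close> is the majorant
  to which \<open>logarithmic_divergence\<close> is applied.\<close>

lemma Lambda_energy:
  assumes k: "k \<noteq> 0" and g: "\<bar>k\<bar> = 1 \<longrightarrow> g \<in> Lambda1" "\<bar>k\<bar> \<ge> 2 \<longrightarrow> g \<in> Lambda2"
  defines "c \<equiv> (real_of_int k)\<^sup>2"
  shows "energy_density c g (nderiv 1 g) (nderiv 2 g) absolutely_integrable_on {0<..}"
    and "\<exists>\<phi>. \<phi> integrable_on {0<..} \<and> (\<forall>x>0. 0 \<le> \<phi> x \<and> (end_size c g (nderiv 1 g) x)\<^sup>2 \<le> x * \<phi> x)"
proof -
  define w p q where "w r = (r powr (1/2)) *\<^sub>R nderiv 2 g r" and "p r = (r powr (-1/2)) *\<^sub>R nderiv 1 g r"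
    and "q r = (r powr (-3/2)) *\<^sub>R g r" for r
  define sq where "sq f r = (cmod (f r))\<^sup>2" for f :: "real \<Rightarrow> complex" and r
  have sqi: "sq f absolutely_integrable_on {0<..}" if "L2_on {0<..} f" for f
    using that unfolding L2_on_def sq_def by simp
  have pw: "r * (r powr (1/2))\<^sup>2 = r\<^sup>2" "r powr (-1/2) = r powr (1/2) / r" "r powr (-3/2) = r powr (1/2) / r\<^sup>2" "(r powr (1/2))\<^sup>2 = r"
    if "0 < r" for r :: real
    using that powr_add[of r "1/2" "1/2"] powr_diff[of r "1/2" 1] powr_diff[of r "1/2" 2]
    by (simp_all add: powr_power power2_eq_square powr_numeral)
  have w: "sq w r = (cmod (nderiv 2 g r))\<^sup>2 * r" if "0 < r" for r
    unfolding sq_def w_def using pw[OF that] by (simp add: power_mult_distrib mult.commute)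
  \<comment> \<open>The weights in \<open>p\<close> and \<open>q\<close> absorb the factor
    \<open>r\<close> of the measure, so each first-order square of the energy is the square of a
    combination of \<open>p\<close> and \<open>q\<close>.\<close>
  have comb: "sq (\<lambda>r. a *\<^sub>R q r + b *\<^sub>R p r) r = (cmod (a *\<^sub>R (g r /\<^sub>R r\<^sup>2) + b *\<^sub>R (nderiv 1 g r /\<^sub>R r)))\<^sup>2 * r"
    if "0 < r" for r a b
  proof -
    have "a *\<^sub>R q r + b *\<^sub>R p r = (r powr (1/2)) *\<^sub>R (a *\<^sub>R (g r /\<^sub>R r\<^sup>2) + b *\<^sub>R (nderiv 1 g r /\<^sub>R r))"
      unfolding p_def q_def pw(2,3)[OF that] using that
      by (simp add: complex_eq_iff field_simps)
    then show ?thesis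
      unfolding sq_def using pw(4)[OF that] by (simp add: power_mult_distrib mult.commute)
  qed
  have energy: "energy_density c g (nderiv 1 g) (nderiv 2 g) r
      = sq w r + 2 * c * sq (\<lambda>r. 1 *\<^sub>R q r + (-1) *\<^sub>R p r) r + sq (\<lambda>r. c *\<^sub>R q r + (-1) *\<^sub>R p r) r" if "r \<in> {0<..}" for r
  proof -
    have "0 < r" using that by simp
    then show ?thesis unfolding comb[OF \<open>0 < r\<close>] w[OF \<open>0 < r\<close>] energy_density_def
      by (simp add: distrib_right)
  qed
  have L2s: "L2_on {0<..} w \<and> L2_on {0<..} (\<lambda>r. 1 *\<^sub>R q r + (-1) *\<^sub>R p r) \<and> L2_on {0<..} (\<lambda>r. c *\<^sub>R q r + (-1) *\<^sub>R p r)
      \<and> (\<exists>\<phi>. \<phi> absolutely_integrable_on {0<..} \<and> (\<forall>x>0. 0 \<le> \<phi> x \<and> (end_size c g (nderiv 1 g) x)\<^sup>2 \<le> x * \<phi> x))"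
  proof (cases "\<bar>k\<bar> = 1")
    case True
    then have c1: "c = 1" unfolding c_def by (metis of_int_1 of_int_abs one_power2 power2_abs)
    have L: "L2_on {0<..} w" "L2_on {0<..} (\<lambda>r. p r - q r)"
      using g(1) True unfolding Lambda1_def w_def p_def q_def by auto
    have 1: "L2_on {0<..} (\<lambda>r. 1 *\<^sub>R q r + (-1) *\<^sub>R p r)"
      using L2_on_linear_combination[OF L(2) L(2), of "- 1" 0] by simp
    have "(end_size c g (nderiv 1 g) x)\<^sup>2 \<le> x * sq (\<lambda>r. 1 *\<^sub>R q r + (-1) *\<^sub>R p r) x" if "0 < x" for x
    proof -
      have "nderiv 1 g x - g x /\<^sub>R x = - (x *\<^sub>R (1 *\<^sub>R (g x /\<^sub>R x\<^sup>2) + (-1) *\<^sub>R (nderiv 1 g x /\<^sub>R x)))"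
        using that by (simp add: complex_eq_iff field_simps power2_eq_square)
      then show ?thesis
        unfolding comb[OF that] end_size_def c1 using that
        by (simp only: if_True norm_minus_cancel norm_scaleR power_mult_distrib refl) (simp add: power2_eq_square)
    qed
    then have "\<exists>\<phi>. \<phi> absolutely_integrable_on {0<..} \<and> (\<forall>x>0. 0 \<le> \<phi> x \<and> (end_size c g (nderiv 1 g) x)\<^sup>2 \<le> x * \<phi> x)"
      using sqi[OF 1] by (intro exI[of _ "sq (\<lambda>r. 1 *\<^sub>R q r + (-1) *\<^sub>R p r)"]) (auto simp: sq_def)
    then show ?thesis using L(1) 1 c1 by simp
  next
    case False
    then have k2: "\<bar>k\<bar> \<ge> 2" using k by linarith
    then have "c \<noteq> 1" unfolding c_def using False by (simp add: power2_eq_1_iff) linarith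
    have L: "L2_on {0<..} w" "L2_on {0<..} p" "L2_on {0<..} q"
      using g(2) k2 unfolding Lambda2_def w_def p_def q_def by auto
    have "(end_size c g (nderiv 1 g) x)\<^sup>2 \<le> x * (2 * sq p x + 2 * sq q x)" if "0 < x" for x
    proof -
      have "(end_size c g (nderiv 1 g) x)\<^sup>2 = (norm (nderiv 1 g x) + norm (g x) / x)\<^sup>2"
        using \<open>c \<noteq> 1\<close> by (simp add: end_size_def)
      also have "\<dots> \<le> 2 * (norm (nderiv 1 g x))\<^sup>2 + 2 * (norm (g x) / x)\<^sup>2"
        using sum_squares_bound[of "norm (nderiv 1 g x)" "norm (g x) / x"] unfolding power2_sum by linarith
      also have "\<dots> = x * (2 * sq p x + 2 * sq q x)"
      proof -
        have "(norm (nderiv 1 g x))\<^sup>2 = x * sq p x"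
          using comb[OF that, of 0 1] that by (simp add: sq_def field_simps power2_eq_square)
        moreover have "(norm (g x) / x)\<^sup>2 = x * sq q x"
          using comb[OF that, of 1 0] that by (simp add: sq_def field_simps power2_eq_square)
        ultimately show ?thesis by (simp add: distrib_left)
      qed
      finally show ?thesis .
    qed
    moreover have "(\<lambda>x. 2 * sq p x + 2 * sq q x) absolutely_integrable_on {0<..}"
      by (intro set_integral_add set_integrable_mult_right sqi L)
    ultimately have "\<exists>\<phi>. \<phi> absolutely_integrable_on {0<..} \<and> (\<forall>x>0. 0 \<le> \<phi> x \<and> (end_size c g (nderiv 1 g) x)\<^sup>2 \<le> x * \<phi> x)"
      by (intro exI[of _ "\<lambda>x. 2 * sq p x + 2 * sq q x"]) (auto simp: sq_def)
    then show ?thesis using L by (intro conjI L2_on_linear_combination) auto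
  qed
  have "(\<lambda>r. sq w r + 2 * c * sq (\<lambda>r. 1 *\<^sub>R q r + (-1) *\<^sub>R p r) r + sq (\<lambda>r. c *\<^sub>R q r + (-1) *\<^sub>R p r) r)
      absolutely_integrable_on {0<..}"
    using L2s by (intro set_integral_add set_integrable_mult_right sqi) auto
  then show "energy_density c g (nderiv 1 g) (nderiv 2 g) absolutely_integrable_on {0<..}"
    by (subst set_integrable_cong[OF refl refl energy]) auto
  show "\<exists>\<phi>. \<phi> integrable_on {0<..} \<and> (\<forall>x>0. 0 \<le> \<phi> x \<and> (end_size c g (nderiv 1 g) x)\<^sup>2 \<le> x * \<phi> x)"
    using L2s set_lebesgue_integral_eq_integral(1) by blast
qed


text \<open>The decay variable \<open>t\<close> will be \<open>x\<close> near 0 and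
  \<open>1 / x\<close> near infinity. The size of \<open>s\<close> is of order \<open>t\<close>,
  that of \<open>g - s\<close> stays bounded wherever \<open>end_size\<close> of \<open>g\<close> is
  at most 1, and the boundary term is bounded by their product. \<open>E\<close> depends neither on
  \<open>x\<close> nor on \<open>g\<close>, so one constant serves a whole sequence of
  points.\<close>

lemma end_boundary_term_decay:
  fixes s s1 s2 :: "real \<Rightarrow> complex" and t :: "real \<Rightarrow> real"
  assumes I: "open I" "convex I" "I \<subseteq> {0<..}"
    and s1: "\<And>x. x \<in> I \<Longrightarrow> (s has_vector_derivative s1 x) (at x)"
    and s2: "\<And>x. x \<in> I \<Longrightarrow> (s1 has_vector_derivative s2 x) (at x)"
    and ode: "\<And>x. x \<in> I \<Longrightarrow> s2 x = ((2 * a + 1) / x) *\<^sub>R s1 x - (a * (a + 2) / x\<^sup>2) *\<^sub>R s x"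
    and pow: "\<And>x. x \<in> I \<Longrightarrow> a \<noteq> 1 \<Longrightarrow> x powr (a - 1) \<le> b * t x" "\<And>x. x \<in> I \<Longrightarrow> a \<noteq> - 1 \<Longrightarrow> x powr (a + 1) \<le> b * t x"
    and "0 \<le> b"
  obtains E where "\<And>x g g1. x \<in> I \<Longrightarrow> 0 \<le> t x \<Longrightarrow> t x \<le> 1 \<Longrightarrow> end_size (a\<^sup>2) g g1 x \<le> 1 \<Longrightarrow>
    \<bar>(x *\<^sub>R s2 x) \<bullet> (g1 x - s1 x) + end_flux a s s1 x \<bullet> (g x - s x)\<bar> \<le> E * t x"
proof -
  obtain c1 c2 where c: "\<And>x. x \<in> I \<Longrightarrow> s x = x powr a *\<^sub>R c1 + x powr (a + 2) *\<^sub>R c2"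
    "\<And>x. x \<in> I \<Longrightarrow> s1 x = (a * x powr (a - 1)) *\<^sub>R c1 + ((a + 2) * x powr (a + 1)) *\<^sub>R c2"
    using euler_ode_solution[OF I s1 s2 ode] by metis
  define D where "D = (\<bar>a - 1\<bar> + \<bar>a\<bar> + \<bar>a + 1\<bar> + \<bar>a + 2\<bar> + 1) * (norm c1 + norm c2) * b"
  define C where "C = \<bar>2 * a + 1\<bar> + \<bar>a * (a + 2)\<bar> + a\<^sup>2 * \<bar>2 * a + 1\<bar> + 1"
  have D0: "0 \<le> D" unfolding D_def using \<open>0 \<le> b\<close> by simp
  have C0: "0 \<le> C" unfolding C_def by simp
  have "\<bar>(x *\<^sub>R s2 x) \<bullet> (g1 x - s1 x) + end_flux a s s1 x \<bullet> (g x - s x)\<bar> \<le> (C * D * (1 + D)) * t x"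
    if x: "x \<in> I" and t: "0 \<le> t x" "t x \<le> 1" and g: "end_size (a\<^sup>2) g g1 x \<le> 1" for x g g1
  proof -
    have x0: "0 < x" using x I(3) by auto
    have s: "end_size (a\<^sup>2) s s1 x \<le> D * t x"
      using end_size_powr_le[where s = s and ?s1.0 = s1 and x = x and a = a and B = "b * t x", OF x0 c(1)[OF x] c(2)[OF x] pow(1)[OF x] pow(2)[OF x]]
      unfolding D_def by (simp add: mult.assoc)
    also have "\<dots> \<le> D" using D0 t by (simp add: mult_left_le)
    finally have h: "end_size (a\<^sup>2) (\<lambda>x. g x - s x) (\<lambda>x. g1 x - s1 x) x \<le> 1 + D"
      using end_size_diff_le[OF x0, of "a\<^sup>2" g s g1 s1] g by linarith
    have nonneg: "0 \<le> end_size (a\<^sup>2) f f1 x" for f f1 using x0 by (simp add: end_size_def)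
    have "\<bar>(x *\<^sub>R s2 x) \<bullet> (g1 x - s1 x) + end_flux a s s1 x \<bullet> (g x - s x)\<bar>
        \<le> C * end_size (a\<^sup>2) s s1 x * end_size (a\<^sup>2) (\<lambda>x. g x - s x) (\<lambda>x. g1 x - s1 x) x"
      using end_boundary_term_le[where s = s and ?s1.0 = s1 and ?s2.0 = s2 and x = x and a = a
          and ?h1.0 = "\<lambda>x. g1 x - s1 x" and h = "\<lambda>x. g x - s x", OF x0 ode[OF x]] unfolding C_def by simp
    also have "\<dots> \<le> C * (D * t x) * (1 + D)"
      using s h nonneg C0 D0 t by (intro mult_mono mult_left_mono) auto
    finally show ?thesis by (simp add: algebra_simps)
  qed
  then show ?thesis using that by blast
qed

text \<open>Integrability of the energy of \<open>g - s\<close> is read off from the polarisation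
  identity, the other three terms being integrable.\<close>

lemma energy_splitting:
  fixes s s1 s2 g g1 g2 :: "real \<Rightarrow> complex"
  assumes ab: "0 < a" "a \<le> b"
    and cont: "continuous_on {a..b} s" "continuous_on {a..b} s1" "continuous_on {a..b} s2"
    and g: "energy_density c g g1 g2 integrable_on {a..b}"
    and cross: "(cross_density c s s1 s2 (\<lambda>x. g x - s x) (\<lambda>x. g1 x - s1 x) (\<lambda>x. g2 x - s2 x) has_integral i) {a..b}"
  defines "e \<equiv> energy_density c (\<lambda>x. g x - s x) (\<lambda>x. g1 x - s1 x) (\<lambda>x. g2 x - s2 x)"
  shows "energy_density c s s1 s2 integrable_on {a..b}" "e integrable_on {a..b}"
    and "integral {a..b} (energy_density c g g1 g2) = integral {a..b} (energy_density c s s1 s2) + integral {a..b} e + 2 * i"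
proof -
  show s: "energy_density c s s1 s2 integrable_on {a..b}"
    unfolding energy_density_def using cont ab
    by (intro integrable_continuous_interval continuous_intros) auto
  have id: "energy_density c g g1 g2 x = energy_density c s s1 s2 x + e x
      + 2 * cross_density c s s1 s2 (\<lambda>x. g x - s x) (\<lambda>x. g1 x - s1 x) (\<lambda>x. g2 x - s2 x) x" if "x \<in> {a..b}" for x
    using energy_density_add[of x c s "\<lambda>x. g x - s x" s1 "\<lambda>x. g1 x - s1 x" s2 "\<lambda>x. g2 x - s2 x"] that ab
    unfolding e_def by simp
  have "((\<lambda>x. energy_density c g g1 g2 x - energy_density c s s1 s2 x
      - 2 * cross_density c s s1 s2 (\<lambda>x. g x - s x) (\<lambda>x. g1 x - s1 x) (\<lambda>x. g2 x - s2 x) x) has_integral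
      integral {a..b} (energy_density c g g1 g2) - integral {a..b} (energy_density c s s1 s2) - 2 * i) {a..b}"
    by (intro has_integral_diff integrable_integral g s has_integral_mult_right cross)
  then have "(e has_integral
      integral {a..b} (energy_density c g g1 g2) - integral {a..b} (energy_density c s s1 s2) - 2 * i) {a..b}"
    by (rule has_integral_eq[rotated]) (simp add: id)
  then show "e integrable_on {a..b}"
    "integral {a..b} (energy_density c g g1 g2) = integral {a..b} (energy_density c s s1 s2) + integral {a..b} e + 2 * i"
    by (auto simp: has_integral_iff)
qed

section \<open>Passage from compact intervals to the half-line\<close>

lemma BL_norm_eq: "BL_norm k f =
  sqrt (LINT r:{0<..}|lebesgue. energy_density ((of_int k)\<^sup>2) f (nderiv 1 f) (nderiv 2 f) r)"
  unfolding BL_norm_def energy_density_def by simp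

text \<open>Dominated convergence: the endpoints are going to be chosen points, so the intervals
  need not be nested.\<close>

lemma set_integral_exhaustion:
  fixes f :: "real \<Rightarrow> real"
  assumes f: "f absolutely_integrable_on {0<..}"
    and \<alpha>: "\<And>N. 0 < \<alpha> N" "\<alpha> \<longlonglongrightarrow> 0" and \<beta>: "filterlim \<beta> at_top sequentially"
  shows "(\<lambda>N. integral {\<alpha> N..\<beta> N} f) \<longlonglongrightarrow> (LINT x:{0<..}|lebesgue. f x)"
proof -
  have sub: "{\<alpha> N..\<beta> N} \<subseteq> {0<..}" for N using \<alpha>(1)[of N] by auto
  have abs: "f absolutely_integrable_on {\<alpha> N..\<beta> N}" for N
    using f by (rule set_integrable_subset) (use sub in auto)
  have "(\<lambda>N. LINT x:{\<alpha> N..\<beta> N}|lebesgue. f x) \<longlonglongrightarrow> (LINT x:{0<..}|lebesgue. f x)"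
    unfolding set_lebesgue_integral_def
  proof (rule integral_dominated_convergence)
    show "(\<lambda>x. indicat_real {0<..} x *\<^sub>R f x) \<in> borel_measurable lebesgue"
      using f unfolding set_integrable_def by (rule borel_measurable_integrable)
    show "(\<lambda>x. indicat_real {\<alpha> N..\<beta> N} x *\<^sub>R f x) \<in> borel_measurable lebesgue" for N
      using abs unfolding set_integrable_def by (rule borel_measurable_integrable)
    show "integrable lebesgue (\<lambda>x. norm (indicat_real {0<..} x *\<^sub>R f x))"
      using f unfolding set_integrable_def by (rule integrable_norm)
    show "AE x in lebesgue. norm (indicat_real {\<alpha> N..\<beta> N} x *\<^sub>R f x) \<le> norm (indicat_real {0<..} x *\<^sub>R f x)" for N
      using sub[of N] by (intro AE_I2) (auto simp: indicator_def)
    show "AE x in lebesgue. (\<lambda>N. indicat_real {\<alpha> N..\<beta> N} x *\<^sub>R f x) \<longlonglongrightarrow> indicat_real {0<..} x *\<^sub>R f x"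
    proof (intro AE_I2)
      fix x :: real
      show "(\<lambda>N. indicat_real {\<alpha> N..\<beta> N} x *\<^sub>R f x) \<longlonglongrightarrow> indicat_real {0<..} x *\<^sub>R f x"
      proof (cases "0 < x")
        case True
        have "\<forall>\<^sub>F N in sequentially. \<alpha> N < x" using \<alpha>(2) True by (rule order_tendstoD(2))
        moreover have "\<forall>\<^sub>F N in sequentially. x \<le> \<beta> N" using \<beta> by (simp add: filterlim_at_top)
        ultimately have "\<forall>\<^sub>F N in sequentially. indicat_real {\<alpha> N..\<beta> N} x *\<^sub>R f x = indicat_real {0<..} x *\<^sub>R f x"
          by eventually_elim (use True in auto)
        then show ?thesis by (rule tendsto_eventually)
      next
        case False
        then have "x \<notin> {\<alpha> N..\<beta> N}" for N using \<alpha>(1)[of N] by auto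
        then show ?thesis using False by simp
      qed
    qed
  qed
  moreover have "(LINT x:{\<alpha> N..\<beta> N}|lebesgue. f x) = integral {\<alpha> N..\<beta> N} f" for N
    using abs by (rule set_lebesgue_integral_eq_integral(2))
  ultimately show ?thesis by simp
qed

theorem theorem4:
  fixes n :: nat and k :: int and \<rho> :: "nat \<Rightarrow> real" and \<nu> :: "nat \<Rightarrow> real"
    and \<sigma> g :: "real \<Rightarrow> complex"
  assumes "n \<ge> 2" and "0 < \<rho> 1" and "strict_mono_on {1..n} \<rho>"
    and "k \<noteq> 0"
    and "\<sigma> \<in> BL_splines k n \<rho>"
    and "\<forall>j\<in>{1..n}. \<sigma> (\<rho> j) = complex_of_real (\<nu> j)"
    and "\<bar>k\<bar> = 1 \<longrightarrow> g \<in> Lambda1"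
    and "\<bar>k\<bar> \<ge> 2 \<longrightarrow> g \<in> Lambda2"
    and "\<forall>j\<in>{1..n}. g (\<rho> j) = complex_of_real (\<nu> j)"
    and "\<exists>r>0. g r \<noteq> \<sigma> r"
  shows "BL_norm k \<sigma> < BL_norm k g"
proof -
  have n1: "1 \<le> n" using assms(1) by simp
  define c :: real where "c = (of_int k)\<^sup>2"
  define \<kappa> :: real where "\<kappa> = \<bar>of_int k\<bar>"
  have \<kappa>c: "\<kappa>\<^sup>2 = c" "(- \<kappa>)\<^sup>2 = c" unfolding \<kappa>_def c_def by auto
  have \<kappa>: "\<kappa> = 1 \<or> 2 \<le> \<kappa>" 
  proof -
    have "\<bar>k\<bar> = 1 \<or> 2 \<le> \<bar>k\<bar>" using assms(4) by linarith
    then have "real_of_int \<bar>k\<bar> = 1 \<or> 2 \<le> real_of_int \<bar>k\<bar>" by linarith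
    then show ?thesis unfolding \<kappa>_def by simp
  qed
  have c0: "0 < c" unfolding c_def using assms(4) by simp
  define s1 s2 g1 g2 where "s1 = nderiv 1 \<sigma>" and "s2 = nderiv 2 \<sigma>" and "g1 = nderiv 1 g" and "g2 = nderiv 2 g"
  define h h1 h2 where "h x = g x - \<sigma> x" and "h1 x = g1 x - s1 x" and "h2 x = g2 x - s2 x" for x
  obtain W where s: "\<And>x. 0 < x \<Longrightarrow> (\<sigma> has_vector_derivative s1 x) (at x)"
      "\<And>x. 0 < x \<Longrightarrow> (s1 has_vector_derivative s2 x) (at x)" "\<And>x. 0 < x \<Longrightarrow> isCont s2 x"
    and fl: "\<And>x. 0 < x \<Longrightarrow> x \<notin> \<rho> ` {1..n} \<Longrightarrow> ((\<lambda>x. x *\<^sub>R s2 x) has_vector_derivative flux1 c \<sigma> s1 x - W x) (at x)"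
      "\<And>x. 0 < x \<Longrightarrow> x \<notin> \<rho> ` {1..n} \<Longrightarrow> (W has_vector_derivative flux0 c \<sigma> s1 x) (at x)"
    and l: "\<And>x. x \<in> {0<..<\<rho> 1} \<Longrightarrow> W x = end_flux \<kappa> \<sigma> s1 x"
      "\<And>x. x \<in> {0<..<\<rho> 1} \<Longrightarrow> s2 x = ((2 * \<kappa> + 1) / x) *\<^sub>R s1 x - (\<kappa> * (\<kappa> + 2) / x\<^sup>2) *\<^sub>R \<sigma> x"
    and r: "\<And>x. x \<in> {\<rho> n<..} \<Longrightarrow> W x = end_flux (- \<kappa>) \<sigma> s1 x"
      "\<And>x. x \<in> {\<rho> n<..} \<Longrightarrow> s2 x = ((2 * (- \<kappa>) + 1) / x) *\<^sub>R s1 x - (- \<kappa> * (- \<kappa> + 2) / x\<^sup>2) *\<^sub>R \<sigma> x"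
    by (rule BL_spline_flux[OF n1 assms(2,3,5), folded s1_def s2_def c_def \<kappa>_def]) blast
  have "g \<in> Lambda1 \<or> g \<in> Lambda2" using assms(4,7,8) by (cases "\<bar>k\<bar> = 1") auto
  note greg = Lambda_regular[OF this, folded g1_def g2_def]
  note gen = Lambda_energy[OF assms(4,7,8), folded g1_def g2_def c_def]
  have \<rho>n: "\<rho> 1 \<le> \<rho> n" "0 < \<rho> n"
    using strict_mono_on_leD[OF assms(3), of 1 n] n1 assms(2) by auto

  have h1: "(h has_vector_derivative h1 x) (at x)" "isCont h1 x" if "0 < x" for x
    unfolding h_def h1_def
    using greg(1,2)[OF that] s(1)[OF that] has_vector_derivative_continuous[OF s(2)[OF that]]
    by (auto intro: has_vector_derivative_diff)
  have hknot: "h (\<rho> j) = 0" if "j \<in> {1..n}" for j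
    using assms(6,9) that unfolding h_def by simp
  have s_cont: "continuous_on {u..v} \<sigma>" "continuous_on {u..v} s1" "continuous_on {u..v} s2" if "0 < u" for u v
  proof -
    have pos: "0 < x" if "x \<in> {u..v}" for x using that \<open>0 < u\<close> by simp
    show "continuous_on {u..v} \<sigma>"
      by (intro continuous_at_imp_continuous_on ballI has_vector_derivative_continuous[OF s(1)] pos)
    show "continuous_on {u..v} s1"
      by (intro continuous_at_imp_continuous_on ballI has_vector_derivative_continuous[OF s(2)] pos)
    show "continuous_on {u..v} s2"
      by (intro continuous_at_imp_continuous_on ballI s(3) pos)
  qed

  define P where "P x = (x *\<^sub>R s2 x) \<bullet> h1 x + W x \<bullet> h x" for x
  have cross: "(cross_density c \<sigma> s1 s2 h h1 h2 has_integral (P b - P a)) {a..b}"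
    if ab: "a \<in> {0<..<\<rho> 1}" "\<rho> n < b" for a b
    unfolding P_def
  proof (rule cross_density_integral_over_knots[OF n1 assms(2,3) s fl h1 _ _ _ hknot ab])
    fix u v :: real assume uv: "0 < u" "u < v"
    have "ac_on {u..v} s1"
      using s(2) uv s_cont(3)[OF uv(1)] by (intro C1_ac_on[where f' = s2]) auto
    then show "ac_on {u..v} h1"
      unfolding h1_def
      by (rule ac_on_dominated[OF greg(3)[OF uv], where A = 1 and B = 1])
        (auto simp: algebra_simps intro: order_trans[OF _ norm_triangle_ineq4])
    have "s2 absolutely_integrable_on {u..v}"
      using s_cont(3)[OF uv(1)] by (rule absolutely_integrable_continuous_real)
    then show "h2 absolutely_integrable_on {u..v}"
      unfolding h2_def using greg(4)[OF uv] by (intro set_integral_diff)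
  next
    fix x :: real assume x: "0 < x" "h1 differentiable (at x)"
    have "s1 differentiable (at x)" using s(2)[OF x(1)] by (rule differentiableI_vector)
    then have "(\<lambda>x. h1 x + s1 x) differentiable (at x)" using x(2) by (rule differentiable_add[rotated])
    then have "g1 differentiable (at x)" by (simp add: h1_def)
    \<comment> \<open>By definition \<open>g2\<close> is the derivative of \<open>g1\<close>
      wherever one exists, so only differentiability of \<open>g1\<close> is at issue.\<close>
    moreover have "g2 x = vector_derivative g1 (at x)"
      using nderiv_Suc[of 1 g] unfolding g1_def g2_def by (simp add: numeral_2_eq_2)
    ultimately have "(g1 has_vector_derivative g2 x) (at x)" by (simp add: vector_derivative_works)
    then show "(h1 has_vector_derivative h2 x) (at x)"
      unfolding h1_def h2_def using s(2)[OF x(1)] by (intro has_vector_derivative_diff)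
  qed

  define Eg where "Eg = (LINT r:{0<..}|lebesgue. energy_density c g g1 g2 r)"
  define Es where "Es = (LINT r:{0<..}|lebesgue. energy_density c \<sigma> s1 s2 r)"
  have g_int: "energy_density c g g1 g2 integrable_on {0<..}" and Eg: "Eg = integral {0<..} (energy_density c g g1 g2)"
    using set_lebesgue_integral_eq_integral[OF gen(1)] unfolding Eg_def by auto
  have nonneg: "0 \<le> energy_density c f f1 f2 x" if "0 < x" for f f1 f2 x
    using c0 that by (intro energy_density_nonneg) auto

  have "\<exists>z>0. h1 z \<noteq> h z /\<^sub>R z"
  proof (rule ccontr)
    assume "\<not> ?thesis"
    then have eq: "h1 x = h x /\<^sub>R x" if "0 < x" for x using that by blast
    have "((\<lambda>x. (1 / x) *\<^sub>R h x) has_vector_derivative 0) (at x within {0<..})" if "x \<in> {0<..}" for x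
    proof -
      have x: "0 < x" using that by simp
      have "(1 / x) *\<^sub>R h1 x - (1 / x\<^sup>2) *\<^sub>R h x = 0"
        unfolding eq[OF x] by (simp add: power2_eq_square divide_inverse)
      then show ?thesis
        using rdiv_deriv(1)[OF _ h1(1)[OF x], of 1] x by (auto intro: has_vector_derivative_at_within)
    qed
    then obtain d where d: "\<And>x. x \<in> {0<..} \<Longrightarrow> (1 / x) *\<^sub>R h x = d"
      using has_vector_derivative_zero_constant[of "{0<..}" "\<lambda>x. (1 / x) *\<^sub>R h x"] by auto
    have "d = 0" using d[of "\<rho> 1"] hknot[of 1] n1 assms(2) by simp
    then have "h x = 0" if "0 < x" for x using d[of x] that by simp
    then show False using assms(10) unfolding h_def by auto
  qed
  then obtain z where z: "0 < z" "h1 z \<noteq> h z /\<^sub>R z" by blast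

  \<comment> \<open>The middle term of the energy density of \<open>h\<close>. It contains no second
    derivative, hence is continuous, and being nonzero at \<open>z\<close> it has a positive
    integral over \<open>{z..z + 1}\<close>.\<close>
  define e where "e x = 2 * c * (cmod (h x /\<^sub>R x\<^sup>2 - h1 x /\<^sub>R x))\<^sup>2 * x" for x
  define \<delta> where "\<delta> = integral {z..z + 1} e"
  have e_cont: "continuous_on {z..z + 1} e"
  proof -
    have pos: "0 < x" if "x \<in> {z..z + 1}" for x using that z(1) by simp
    have "continuous_on {z..z + 1} h"
      by (intro continuous_at_imp_continuous_on ballI has_vector_derivative_continuous[OF h1(1)] pos)
    moreover have "continuous_on {z..z + 1} h1"
      by (intro continuous_at_imp_continuous_on ballI h1(2) pos)
    ultimately show ?thesis unfolding e_def using z(1) by (intro continuous_intros) auto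
  qed
  have e_nonneg: "0 \<le> e x" if "0 < x" for x unfolding e_def using c0 that by simp
  have \<delta>0: "0 < \<delta>"
  proof -
    have "e z \<noteq> 0"
    proof
      assume "e z = 0"
      then have "h z /\<^sub>R z\<^sup>2 - h1 z /\<^sub>R z = 0" unfolding e_def using c0 z(1) by simp
      then have "z *\<^sub>R (h z /\<^sub>R z\<^sup>2) = z *\<^sub>R (h1 z /\<^sub>R z)" by simp
      then have "h z /\<^sub>R z = h1 z" using z(1) by (simp add: power2_eq_square mult.assoc[symmetric])
      then show False using z(2) by simp
    qed
    then have "integral {z..z + 1} e \<noteq> 0"
      using integral_eq_0_iff[OF e_cont] e_nonneg z(1) by fastforce
    moreover have "0 \<le> integral {z..z + 1} e"
      using e_nonneg z(1) e_cont by (intro integral_nonneg integrable_continuous_interval) auto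
    ultimately show ?thesis unfolding \<delta>_def by simp
  qed

  have compact_bound: "integral {a..b} (energy_density c \<sigma> s1 s2) + \<delta> + 2 * (P b - P a) \<le> Eg"
    if ab: "a \<in> {0<..<\<rho> 1}" "\<rho> n < b" and zz: "a \<le> z" "z + 1 \<le> b" for a b
  proof -
    have a0: "0 < a" "a \<le> b" using ab \<rho>n by auto
    have sub: "{a..b} \<subseteq> {0<..}" using a0 by auto
    have gi: "energy_density c g g1 g2 integrable_on {a..b}"
      using integrable_on_subcbox[OF g_int, of a b] sub by simp
    note sp = energy_splitting[OF a0 s_cont[OF a0(1)] gi cross[OF ab, unfolded h_def h1_def h2_def], folded h_def h1_def h2_def]
    have "\<delta> \<le> integral {z..z + 1} (energy_density c h h1 h2)"
      unfolding \<delta>_def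
    proof (rule integral_le)
      show "e integrable_on {z..z + 1}" using e_cont by (rule integrable_continuous_interval)
      show "energy_density c h h1 h2 integrable_on {z..z + 1}"
        using sp(2) integrable_subinterval_real zz by (metis atLeastatMost_subset_iff)
      show "e x \<le> energy_density c h h1 h2 x" if "x \<in> {z..z + 1}" for x
        unfolding e_def energy_density_def using that z(1) by (intro mult_right_mono) auto
    qed
    also have "\<dots> \<le> integral {a..b} (energy_density c h h1 h2)"
      using sp(2) integrable_subinterval_real zz nonneg a0
      by (intro integral_subset_le) (auto intro: integrable_subinterval_real)
    finally have "\<delta> \<le> integral {a..b} (energy_density c h h1 h2)" .
    moreover have "integral {a..b} (energy_density c g g1 g2) \<le> Eg"
      unfolding Eg using nonneg by (intro integral_subset_le[OF sub gi g_int]) auto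
    ultimately show ?thesis using sp(3) by linarith
  qed

  obtain EL where EL: "\<And>x. x \<in> {0<..<\<rho> 1} \<Longrightarrow> x \<le> 1 \<Longrightarrow> end_size c g g1 x \<le> 1 \<Longrightarrow> \<bar>P x\<bar> \<le> EL * x"
  proof -
    \<comment> \<open>Used with \<open>p = \<kappa> - 2\<close> and \<open>p = \<kappa>\<close>. The
      first is negative for \<open>\<kappa> = 1\<close>, but then
      \<open>x powr (\<kappa> - 1)\<close> is the power exempted in
      \<open>end_boundary_term_decay\<close>; otherwise \<open>2 \<le> \<kappa>\<close> because
      \<open>k\<close> is an integer.\<close>
    have pw: "x powr (p + 1) \<le> (\<rho> 1 powr (\<kappa> - 2) + \<rho> 1 powr \<kappa>) * x"
      if "x \<in> {0<..<\<rho> 1}" "0 \<le> p" "p = \<kappa> - 2 \<or> p = \<kappa>" for x p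
    proof -
      have "x powr (p + 1) = x powr p * x" using that by (simp add: powr_add)
      also have "\<dots> \<le> \<rho> 1 powr p * x" using that by (intro mult_right_mono powr_mono2) auto
      also have "\<dots> \<le> (\<rho> 1 powr (\<kappa> - 2) + \<rho> 1 powr \<kappa>) * x" using that by (intro mult_right_mono) auto
      finally show ?thesis .
    qed
    have I: "open {0<..<\<rho> 1}" "convex {0<..<\<rho> 1}" "{0<..<\<rho> 1} \<subseteq> {0<..}" by auto
    show ?thesis
    proof (rule end_boundary_term_decay[OF I s(1) s(2) l(2), of "\<rho> 1 powr (\<kappa> - 2) + \<rho> 1 powr \<kappa>" "\<lambda>x. x"])
      show "x powr (\<kappa> - 1) \<le> (\<rho> 1 powr (\<kappa> - 2) + \<rho> 1 powr \<kappa>) * x" if "x \<in> {0<..<\<rho> 1}" "\<kappa> \<noteq> 1" for x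
        using pw[OF that(1), of "\<kappa> - 2"] that(2) \<kappa> by simp
      show "x powr (\<kappa> + 1) \<le> (\<rho> 1 powr (\<kappa> - 2) + \<rho> 1 powr \<kappa>) * x" if "x \<in> {0<..<\<rho> 1}" for x
        using pw[OF that, of \<kappa>] \<kappa> by auto
      fix E assume E: "\<And>x g g1. x \<in> {0<..<\<rho> 1} \<Longrightarrow> 0 \<le> x \<Longrightarrow> x \<le> 1 \<Longrightarrow> end_size (\<kappa>\<^sup>2) g g1 x \<le> 1 \<Longrightarrow>
        \<bar>(x *\<^sub>R s2 x) \<bullet> (g1 x - s1 x) + end_flux \<kappa> \<sigma> s1 x \<bullet> (g x - \<sigma> x)\<bar> \<le> E * x"
      show thesis
        by (rule that[of E]) (use E[of _ g g1] l(1) in \<open>auto simp: P_def h_def h1_def \<kappa>c\<close>)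
    qed auto
  qed
  obtain ER where ER: "\<And>x. x \<in> {\<rho> n<..} \<Longrightarrow> 1 \<le> x \<Longrightarrow> end_size c g g1 x \<le> 1 \<Longrightarrow> \<bar>P x\<bar> \<le> ER * (1 / x)"
  proof -
    \<comment> \<open>The mirror image at infinity: with exponent parameter
      \<open>- \<kappa>\<close> it is \<open>x powr (- \<kappa> + 1)\<close> that is exempt for
      \<open>\<kappa> = 1\<close>.\<close>
    have pw: "x powr (p - 1) \<le> (\<rho> n powr (2 - \<kappa>) + \<rho> n powr (- \<kappa>)) * (1 / x)"
      if "x \<in> {\<rho> n<..}" "p \<le> 0" "p = 2 - \<kappa> \<or> p = - \<kappa>" for x p
    proof -
      have x0: "0 < x" using that(1) \<rho>n by auto
      then have "x powr (p - 1) = x powr p * (1 / x)" by (simp add: powr_diff)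
      also have "\<dots> \<le> \<rho> n powr p * (1 / x)" using that \<rho>n x0 by (intro mult_right_mono powr_mono2') auto
      also have "\<dots> \<le> (\<rho> n powr (2 - \<kappa>) + \<rho> n powr (- \<kappa>)) * (1 / x)" using that x0 by (intro mult_right_mono) auto
      finally show ?thesis .
    qed
    have I: "open {\<rho> n<..}" "convex {\<rho> n<..}" "{\<rho> n<..} \<subseteq> {0<..}" using \<rho>n by auto
    have pos: "0 < x" if "x \<in> {\<rho> n<..}" for x using that \<rho>n by auto
    show ?thesis
    proof (rule end_boundary_term_decay[OF I s(1)[OF pos] s(2)[OF pos] r(2), of "\<rho> n powr (2 - \<kappa>) + \<rho> n powr (- \<kappa>)" "\<lambda>x. 1 / x"])
      show "x powr (- \<kappa> - 1) \<le> (\<rho> n powr (2 - \<kappa>) + \<rho> n powr (- \<kappa>)) * (1 / x)" if "x \<in> {\<rho> n<..}" for x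
        using pw[OF that, of "- \<kappa>"] \<kappa> by auto
      show "x powr (- \<kappa> + 1) \<le> (\<rho> n powr (2 - \<kappa>) + \<rho> n powr (- \<kappa>)) * (1 / x)" if "x \<in> {\<rho> n<..}" "- \<kappa> \<noteq> - 1" for x
        using pw[OF that(1), of "2 - \<kappa>"] that(2) \<kappa> by (simp add: algebra_simps)
      fix E assume E: "\<And>x g g1. x \<in> {\<rho> n<..} \<Longrightarrow> 0 \<le> 1 / x \<Longrightarrow> 1 / x \<le> 1 \<Longrightarrow> end_size ((- \<kappa>)\<^sup>2) g g1 x \<le> 1 \<Longrightarrow>
        \<bar>(x *\<^sub>R s2 x) \<bullet> (g1 x - s1 x) + end_flux (- \<kappa>) \<sigma> s1 x \<bullet> (g x - \<sigma> x)\<bar> \<le> E * (1 / x)"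
      show thesis
        by (rule that[of E]) (use E[of _ g g1] r(1) pos in \<open>auto simp: P_def h_def h1_def \<kappa>c\<close>)
    qed auto
  qed

  obtain \<phi> where \<phi>: "\<phi> integrable_on {0<..}" "\<And>x. 0 < x \<Longrightarrow> 0 \<le> \<phi> x" "\<And>x. 0 < x \<Longrightarrow> (end_size c g g1 x)\<^sup>2 \<le> x * \<phi> x"
    using gen(2) by blast
  obtain M where M: "1 \<le> M" "\<And>p. 0 < p \<Longrightarrow> \<exists>x\<in>{p..p * M}. x * \<phi> x < 1"
    using logarithmic_divergence[OF \<phi>(1,2), of 1] by auto
  have small: "\<exists>x\<in>{p..p * M}. end_size c g g1 x \<le> 1" if "0 < p" for p
  proof -
    obtain x where x: "x \<in> {p..p * M}" "x * \<phi> x < 1" using M(2)[OF \<open>0 < p\<close>] by blast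
    then have "0 < x" using that by auto
    then have "(end_size c g g1 x)\<^sup>2 \<le> 1\<^sup>2" using \<phi>(3)[of x] x(2) by simp
    then have "end_size c g g1 x \<le> 1" by (rule power2_le_imp_le) simp
    then show ?thesis using x(1) by blast
  qed
  \<comment> \<open>Endpoints at most \<open>m\<close> on the left and at least \<open>T\<close> on
    the right enclose all knots and \<open>{z..z + 1}\<close>, and there the decay variables
    \<open>x\<close> and \<open>1 / x\<close> are at most 1.\<close>
  define m where "m = Min {\<rho> 1 / 2, z, 1}"
  define T where "T = Max {\<rho> n + 1, z + 1, 1}"
  have m: "0 < m" "m < \<rho> 1" "m \<le> z" "m \<le> 1" unfolding m_def using assms(2) z(1) by auto
  have T: "\<rho> n < T" "z + 1 \<le> T" "1 \<le> T" unfolding T_def by auto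
  have "\<exists>x. 0 < x \<and> x \<le> m / real (Suc N) \<and> end_size c g g1 x \<le> 1" for N
  proof -
    \<comment> \<open>The window starts at \<open>m / real (Suc N) / M\<close>, so that it ends at
      \<open>m / real (Suc N)\<close>.\<close>
    have "0 < m / real (Suc N) / M" using m M(1) by simp
    moreover from small[OF this] obtain x where "x \<in> {m / real (Suc N) / M..m / real (Suc N) / M * M}" "end_size c g g1 x \<le> 1"
      by blast
    moreover have "m / real (Suc N) / M * M = m / real (Suc N)" using M(1) by simp
    ultimately show ?thesis by (intro exI[of _ x]) auto
  qed
  then obtain \<alpha> where \<alpha>: "\<And>N. 0 < \<alpha> N" "\<And>N. \<alpha> N \<le> m / real (Suc N)" "\<And>N. end_size c g g1 (\<alpha> N) \<le> 1" by metis
  have "\<exists>x. T * real (Suc N) \<le> x \<and> end_size c g g1 x \<le> 1" for N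
  proof -
    have "0 < T * real (Suc N)" using T by simp
    from small[OF this] show ?thesis by auto
  qed
  then obtain \<beta> where \<beta>: "\<And>N. T * real (Suc N) \<le> \<beta> N" "\<And>N. end_size c g g1 (\<beta> N) \<le> 1" by metis
  have \<alpha>m: "\<alpha> N \<le> m" for N
    using \<alpha>(2)[of N] m(1) by (elim order_trans) (simp add: field_simps)
  have \<beta>T: "T \<le> \<beta> N" "real (Suc N) \<le> \<beta> N" for N
  proof -
    have "T * 1 \<le> T * real (Suc N)" using T by (intro mult_left_mono) auto
    then show "T \<le> \<beta> N" using \<beta>(1)[of N] by linarith
    have "1 * real (Suc N) \<le> T * real (Suc N)" using T by (intro mult_right_mono) auto
    then show "real (Suc N) \<le> \<beta> N" using \<beta>(1)[of N] unfolding mult_1 by (rule order_trans)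
  qed
  have \<alpha>_lim: "\<alpha> \<longlonglongrightarrow> 0"
  proof (rule tendsto_sandwich[of "\<lambda>_. 0" \<alpha> _ "\<lambda>N. m / real (Suc N)"])
    show "(\<lambda>N. m / real (Suc N)) \<longlonglongrightarrow> 0"
      using tendsto_mult_left[OF LIMSEQ_inverse_real_of_nat, of m] by (simp add: divide_inverse)
  qed (use \<alpha> in \<open>auto intro!: always_eventually less_imp_le\<close>)
  have \<beta>_lim: "filterlim \<beta> at_top sequentially"
  proof (rule filterlim_at_top_mono)
    show "filterlim (\<lambda>N. real (Suc N)) at_top sequentially"
      using filterlim_real_sequentially by (rule filterlim_compose[OF _ filterlim_Suc])
    show "\<forall>\<^sub>F N in sequentially. real (Suc N) \<le> \<beta> N" using \<beta>T by simp
  qed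
  have P\<alpha>: "(\<lambda>N. P (\<alpha> N)) \<longlonglongrightarrow> 0"
  proof (rule Lim_null_comparison)
    show "\<forall>\<^sub>F N in sequentially. norm (P (\<alpha> N)) \<le> EL * \<alpha> N"
    proof (intro always_eventually allI)
      fix N
      show "norm (P (\<alpha> N)) \<le> EL * \<alpha> N" using EL[of "\<alpha> N"] \<alpha>(1,3)[of N] \<alpha>m[of N] m by simp
    qed
    show "(\<lambda>N. EL * \<alpha> N) \<longlonglongrightarrow> 0" using tendsto_mult_left[OF \<alpha>_lim, of EL] by simp
  qed
  have P\<beta>: "(\<lambda>N. P (\<beta> N)) \<longlonglongrightarrow> 0"
  proof (rule Lim_null_comparison)
    show "\<forall>\<^sub>F N in sequentially. norm (P (\<beta> N)) \<le> ER * (1 / \<beta> N)"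
    proof (intro always_eventually allI)
      fix N
      show "norm (P (\<beta> N)) \<le> ER * (1 / \<beta> N)" using ER[of "\<beta> N"] \<beta>(2)[of N] \<beta>T[of N] T by simp
    qed
    have "(\<lambda>N. 1 / \<beta> N) \<longlonglongrightarrow> 0"
      using tendsto_inverse_0_at_top[OF \<beta>_lim] by (simp add: inverse_eq_divide)
    from tendsto_mult_left[OF this, of ER] show "(\<lambda>N. ER * (1 / \<beta> N)) \<longlonglongrightarrow> 0" by simp
  qed
  have bound: "integral {\<alpha> N..\<beta> N} (energy_density c \<sigma> s1 s2) + \<delta> + 2 * (P (\<beta> N) - P (\<alpha> N)) \<le> Eg" for N
    using \<alpha>(1)[of N] \<alpha>m[of N] m \<beta>T(1)[of N] T by (intro compact_bound) auto
  have lim2: "(\<lambda>N. 2 * (P (\<beta> N) - P (\<alpha> N))) \<longlonglongrightarrow> 0"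
    using tendsto_mult_left[OF tendsto_diff[OF P\<beta> P\<alpha>], of 2] by simp
  have "Es + \<delta> \<le> Eg"
  \<comment> \<open>The bound on compact intervals holds in either case; integrability decides only
    how its left side is compared with \<open>Es\<close>.\<close>
  proof (cases "energy_density c \<sigma> s1 s2 absolutely_integrable_on {0<..}")
    case True
    have "(\<lambda>N. integral {\<alpha> N..\<beta> N} (energy_density c \<sigma> s1 s2) + \<delta> + 2 * (P (\<beta> N) - P (\<alpha> N))) \<longlonglongrightarrow> Es + \<delta> + 0"
      unfolding Es_def
      by (intro tendsto_add tendsto_const lim2 set_integral_exhaustion[OF True \<alpha>(1) \<alpha>_lim \<beta>_lim])
    then show ?thesis using bound by (intro LIMSEQ_le_const2[of _ "Es + \<delta>"]) auto
  next
    case False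
    \<comment> \<open>a non-integrable function has the junk integral 0\<close>
    then have "Es = 0"
      unfolding Es_def set_lebesgue_integral_def set_integrable_def by (rule not_integrable_integral_eq)
    moreover have "\<delta> + 2 * (P (\<beta> N) - P (\<alpha> N)) \<le> Eg" for N
    proof -
      have "0 \<le> integral {\<alpha> N..\<beta> N} (energy_density c \<sigma> s1 s2)"
      proof (cases "energy_density c \<sigma> s1 s2 integrable_on {\<alpha> N..\<beta> N}")
        case True
        have "0 < x" if "x \<in> {\<alpha> N..\<beta> N}" for x using that \<alpha>(1)[of N] by auto
        then show ?thesis using nonneg by (intro integral_nonneg True) auto
      qed (simp add: not_integrable_integral)
      then show ?thesis using bound[of N] by linarith
    qed
    moreover have "(\<lambda>N. \<delta> + 2 * (P (\<beta> N) - P (\<alpha> N))) \<longlonglongrightarrow> \<delta> + 0"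
      by (intro tendsto_add tendsto_const lim2)
    ultimately show ?thesis using LIMSEQ_le_const2[of _ "\<delta>" Eg] by auto
  qed
  then have "Es < Eg" using \<delta>0 by simp
  then have "sqrt Es < sqrt Eg" by (rule real_sqrt_less_mono)
  then show ?thesis
    unfolding BL_norm_eq Es_def Eg_def c_def s1_def s2_def g1_def g2_def .
qed


end
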